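(* Let $0<s\le1$ and assume that the solution $u$ of the periodic problem $iu_t-(-\partial_{xx})^su+|u|^2u=0$, $u(x,0)=u_0(x)$, belongs to $H^\mu$ for $\mu$ large enough. Assume that $k$ is small enough, that $$3\|U^0\|^2\,kN\max_{1\le j\le q}|b_j|<1,$$ and that the local temporal errors satisfy $$\max_{0\le n\le M-1}\|\Theta^n\|\lesssim k^{\alpha+1}$$ for some integer $\alpha>0$. Then the fully discrete scheme $$Y^{n,0}=U^n,\quad Y^{n,j}=Y^{n,j-1}+kb_jF\Big(\tfrac{Y^{n,j}+Y^{n,j-1}}2\Big)\ (1\le j\le q),\quad U^{n+1}=Y^{n,q},\qquad U^0=P_Nu_0,$$ has for all $n$ a unique solution, and it satisfies $$\max_{0\le n\le M}\|U^n-u(t_n)\|\lesssim k^\alpha+N^{-\mu}.$$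
   Context: $T>0$ fixed; $u_0$ is smooth and $2\pi$-periodic. Functions are complex-valued, $2\pi$-periodic in $x$; $\|\cdot\|$ is the norm of $L^2(-\pi,\pi)$. $\widehat u(k)=\frac1{2\pi}\int_{-\pi}^{\pi}u(x)e^{-ikx}dx$; $H^\mu$ has norm $\|u\|_\mu=(\sum_{k\in\mathbb Z}(1+k^2)^\mu|\widehat u(k)|^2)^{1/2}$; "$u$ belongs to $H^\mu$" means $u(t)\in H^\mu$ with bounded norm for $0\le t\le T$. $(-\partial_{xx})^s$ has Fourier symbol $|k|^{2s}$. $N\ge1$ is an integer, $S_N=\mathrm{span}\{e^{ikx}:-N\le k\le N\}$, $P_Nu=\sum_{|k|\le N}\widehat u(k)e^{ikx}$, and $F:S_N\to S_N$, $F(u)=-i(-\partial_{xx})^su+iP_N(|u|^2u)$. The semidiscrete solution $u^N$ with values in $S_N$ solves $\frac{d}{dt}u^N=F(u^N)$, $u^N(0)=P_Nu_0$. Time discretization: $k>0$ is the time step, $M$ an integer with $T=Mk$, $t_n=nk$. For $p\ge1$ the method has $q=3^{p-1}$ stages with nonzero real coefficients $b_1,\dots,b_q$ of Yoshida's triple-jump composition: for $p=1$, $b_1=1$; if $b=(b_1,\dots,b_q)$ is the vector for $p$, the one for $p+1$ is the concatenation $(\gamma b,(1-2\gamma)b,\gamma b)$ with $\gamma=1/(2-2^{1/(2p+1)})$. The stages $U^n,Y^{n,j}$ belong to $S_N$. If needed, $u$ and $u^N$ are understood as extended to $[-k,T+k]$ with the same properties. Local temporal error: let $Z^{n,0}=Z^n=u^N(t_n)$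 and let $Z^{n,j}\in S_N$ satisfy $Z^{n,j}=Z^{n,j-1}+kb_jF\big(\frac{Z^{n,j}+Z^{n,j-1}}2\big)$, $1\le j\le q$; then $\Theta^n=u^N(t_{n+1})-Z^{n,q}$, $0\le n\le M-1$. $g_1\lesssim g_2$ means $g_1\le Cg_2$ with a constant $C$ independent of $k$, $N$ and $n$. *)

theory Defs
  imports "HOL-Analysis.Analysis"
begin

definition periodic_2pi :: "(real \<Rightarrow> complex) \<Rightarrow> bool" where
  "periodic_2pi f \<longleftrightarrow> (\<forall>x. f (x + 2 * pi) = f x)"

definition smooth_fun :: "(real \<Rightarrow> complex) \<Rightarrow> bool" where
  "smooth_fun f \<longleftrightarrow>
     (\<exists>D :: nat \<Rightarrow> real \<Rightarrow> complex. D 0 = f \<and>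
        (\<forall>m x. (D m has_vector_derivative D (Suc m) x) (at x)))"

definition L2norm :: "(real \<Rightarrow> complex) \<Rightarrow> real" where
  "L2norm f = sqrt (LINT x:{-pi..pi}|lborel. (cmod (f x))\<^sup>2)"

definition fourier_coeff :: "(real \<Rightarrow> complex) \<Rightarrow> int \<Rightarrow> complex" where
  "fourier_coeff f l =
     1 / (2 * of_real pi) * (LINT x:{-pi..pi}|lborel. f x * cis (- (of_int l * x)))"

definition sobolev_weight :: "real \<Rightarrow> (real \<Rightarrow> complex) \<Rightarrow> int \<Rightarrow> real" where
  "sobolev_weight \<mu> f l = (1 + (of_int l)\<^sup>2) powr \<mu> * (cmod (fourier_coeff f l))\<^sup>2"

definition sobolev_norm :: "real \<Rightarrow> (real \<Rightarrow> complex) \<Rightarrow> real" where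
  "sobolev_norm \<mu> f = sqrt (\<Sum>\<^sub>\<infinity>l\<in>UNIV. sobolev_weight \<mu> f l)"

text \<open>The periodic Sobolev space \<open>H\<^sup>\<mu>\<close>, for \<open>\<mu> \<ge> 0\<close>. Summability is required explicitly since
  \<^const>\<open>infsum\<close> is \<open>0\<close> on families that are not summable.\<close>

definition sobolev_space :: "real \<Rightarrow> (real \<Rightarrow> complex) set" where
  "sobolev_space \<mu> =
     {f. periodic_2pi f \<and> f \<in> borel_measurable borel \<and>
         set_integrable lborel {-pi..pi} (\<lambda>x. (cmod (f x))\<^sup>2) \<and>
         sobolev_weight \<mu> f summable_on UNIV}"

definition belongs_to_sobolev :: "real \<Rightarrow> real \<Rightarrow> (real \<Rightarrow> real \<Rightarrow> complex) \<Rightarrow> bool" where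
  "belongs_to_sobolev \<mu> T u \<longleftrightarrow>
     (\<forall>t\<in>{0..T}. u t \<in> sobolev_space \<mu>) \<and> (\<exists>B. \<forall>t\<in>{0..T}. sobolev_norm \<mu> (u t) \<le> B)"

text \<open>The operator \<open>(-\<partial>\<^sub>x\<^sub>x)\<^sup>s\<close>. The series converges absolutely for functions in \<open>H\<^sup>\<mu>\<close> with
  \<open>\<mu> > 2 s + 1/2\<close> and is a finite sum for trigonometric polynomials. The zero mode is
  annihilated because \<open>0 powr a = 0\<close>.\<close>

definition frac_laplacian :: "real \<Rightarrow> (real \<Rightarrow> complex) \<Rightarrow> real \<Rightarrow> complex" where
  "frac_laplacian s f x =
     (\<Sum>\<^sub>\<infinity>l\<in>UNIV. of_real (\<bar>of_int l\<bar> powr (2 * s)) * fourier_coeff f l * cis (of_int l * x))"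

definition cubic :: "(real \<Rightarrow> complex) \<Rightarrow> real \<Rightarrow> complex" where
  "cubic f x = of_real ((cmod (f x))\<^sup>2) * f x"

text \<open>Classical solutions of \<open>i u\<^sub>t - (-\<partial>\<^sub>x\<^sub>x)\<^sup>s u + |u|\<^sup>2 u = 0\<close>, \<open>u(0) = u\<^sub>0\<close>, on \<open>[0,T]\<close>;
  time comes first, and the time derivative is one-sided at \<open>0\<close> and \<open>T\<close>.\<close>

definition nls_solution ::
  "real \<Rightarrow> real \<Rightarrow> (real \<Rightarrow> complex) \<Rightarrow> (real \<Rightarrow> real \<Rightarrow> complex) \<Rightarrow> bool" where
  "nls_solution s T u0 u \<longleftrightarrow>
     u 0 = u0 \<and>
     (\<forall>t\<in>{0..T}. periodic_2pi (u t) \<and> continuous_on UNIV (u t)) \<and>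
     (\<forall>t\<in>{0..T}. \<forall>x. \<exists>ut.
        ((\<lambda>r. u r x) has_vector_derivative ut) (at t within {0..T}) \<and>
        \<i> * ut - frac_laplacian s (u t) x + cubic (u t) x = 0)"

definition trig_polys :: "nat \<Rightarrow> (real \<Rightarrow> complex) set" where
  "trig_polys N = {f. \<exists>c. f = (\<lambda>x. \<Sum>l\<in>{- int N..int N}. c l * cis (of_int l * x))}"

definition fourier_proj :: "nat \<Rightarrow> (real \<Rightarrow> complex) \<Rightarrow> real \<Rightarrow> complex" where
  "fourier_proj N f x = (\<Sum>l\<in>{- int N..int N}. fourier_coeff f l * cis (of_int l * x))"

definition rhs_F :: "real \<Rightarrow> nat \<Rightarrow> (real \<Rightarrow> complex) \<Rightarrow> real \<Rightarrow> complex" where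
  "rhs_F s N f x = - \<i> * frac_laplacian s f x + \<i> * fourier_proj N (cubic f) x"

text \<open>Since the values lie in a fixed finite-dimensional space of functions, the time
  derivative may be taken pointwise in \<open>x\<close>.\<close>

definition semidiscrete_solution ::
  "real \<Rightarrow> nat \<Rightarrow> real \<Rightarrow> (real \<Rightarrow> complex) \<Rightarrow> (real \<Rightarrow> real \<Rightarrow> complex) \<Rightarrow> bool" where
  "semidiscrete_solution s N T u0 v \<longleftrightarrow>
     v 0 = fourier_proj N u0 \<and>
     (\<forall>t\<in>{0..T}. v t \<in> trig_polys N) \<and>
     (\<forall>t\<in>{0..T}. \<forall>x.
        ((\<lambda>r. v r x) has_vector_derivative rhs_F s N (v t) x) (at t within {0..T}))"

text \<open>Coefficients of the triple-jump composition. The list for \<open>p\<close> is 0-based, so the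
  coefficient \<open>b\<^sub>j\<close> is \<open>triple_jump p ! (j - 1)\<close>; the value at \<open>p = 0\<close> is irrelevant.\<close>

fun triple_jump :: "nat \<Rightarrow> real list" where
  "triple_jump 0 = []"
| "triple_jump (Suc 0) = [1]"
| "triple_jump (Suc (Suc m)) =
     (let p = Suc m; b = triple_jump p; \<gamma> = 1 / (2 - 2 powr (1 / (2 * real p + 1)))
      in map (\<lambda>c. \<gamma> * c) b @ map (\<lambda>c. (1 - 2 * \<gamma>) * c) b @ map (\<lambda>c. \<gamma> * c) b)"

definition num_stages :: "nat \<Rightarrow> nat" where
  "num_stages p = 3 ^ (p - 1)"

definition coeff_b :: "nat \<Rightarrow> nat \<Rightarrow> real" where
  "coeff_b p j = triple_jump p ! (j - 1)"

lemma length_triple_jump: "1 \<le> p \<Longrightarrow> length (triple_jump p) = num_stages p"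
  by (induction p rule: triple_jump.induct) (auto simp: num_stages_def Let_def)

text \<open>\<open>Y 0, \<dots>, Y q\<close> are the stages of one step of length \<open>k\<close> started from \<open>V\<close>; the values
  \<open>Y j\<close> with \<open>j > q\<close> are unconstrained.\<close>

definition is_stages ::
  "real \<Rightarrow> nat \<Rightarrow> nat \<Rightarrow> real \<Rightarrow> (real \<Rightarrow> complex) \<Rightarrow> (nat \<Rightarrow> real \<Rightarrow> complex) \<Rightarrow> bool" where
  "is_stages s p N k V Y \<longleftrightarrow>
     Y 0 = V \<and>
     (\<forall>j\<le>num_stages p. Y j \<in> trig_polys N) \<and>
     (\<forall>j\<in>{1..num_stages p}. \<forall>x.
        Y j x = Y (j - 1) x
          + of_real (k * coeff_b p j) * rhs_F s N (\<lambda>y. (Y j y + Y (j - 1) y) / 2) x)"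

text \<open>The first \<open>m\<close> steps of the scheme: \<open>U 0, \<dots>, U m\<close> and the stages \<open>Y n j\<close> for \<open>n < m\<close>,
  \<open>j \<le> q\<close>.\<close>

definition fully_discrete ::
  "real \<Rightarrow> nat \<Rightarrow> nat \<Rightarrow> real \<Rightarrow> (real \<Rightarrow> complex) \<Rightarrow> nat \<Rightarrow>
   (nat \<Rightarrow> real \<Rightarrow> complex) \<Rightarrow> (nat \<Rightarrow> nat \<Rightarrow> real \<Rightarrow> complex) \<Rightarrow> bool" where
  "fully_discrete s p N k u0 m U Y \<longleftrightarrow>
     U 0 = fourier_proj N u0 \<and>
     (\<forall>n<m. is_stages s p N k (U n) (Y n) \<and> U (Suc n) = Y n (num_stages p))"

text \<open>Existence of the first \<open>m\<close> steps and uniqueness of the entries they constrain.\<close>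

definition uniquely_solvable ::
  "real \<Rightarrow> nat \<Rightarrow> nat \<Rightarrow> real \<Rightarrow> (real \<Rightarrow> complex) \<Rightarrow> nat \<Rightarrow> bool" where
  "uniquely_solvable s p N k u0 m \<longleftrightarrow>
     (\<exists>U Y. fully_discrete s p N k u0 m U Y) \<and>
     (\<forall>U Y U' Y'. fully_discrete s p N k u0 m U Y \<and> fully_discrete s p N k u0 m U' Y' \<longrightarrow>
        (\<forall>n\<le>m. U n = U' n) \<and> (\<forall>n<m. \<forall>j\<le>num_stages p. Y n j = Y' n j))"

end

theory Submission
  imports Defs
begin

text \<open>Everything takes place on Fourier coefficients: \<open>l2\<close> measures errors and the Wiener norm
  \<open>l1\<close> replaces the sup norm. The linear part of the equation acts by unimodular or contractive
  multipliers, hence is invisible to both norms, and the cubic term is Lipschitz in \<open>l2\<close> on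
  \<open>l1\<close>-bounded sets. Each midpoint stage conserves \<open>l2\<close>; with the inverse inequality
  \<open>l1\<^sup>2 \<le> 3 N l2\<^sup>2\<close> the step-size condition makes a stage a contraction with a unique fixed point
  and bounds its \<open>l1\<close> norm by a fixed multiple of that of its initial value. So all stages are
  controlled once \<open>U\<^sup>n\<close> is, and local errors accumulate by a discrete Gronwall argument. The
  bound on \<open>U\<^sup>n\<close> is propagated along with the error estimate: since \<open>k N\<close> is bounded, \<open>N\<^bsup>1/2\<^esup> k\<^sup>\<alpha>\<close>
  is small for small \<open>k\<close>. The spatial error is treated the same way in continuous time.\<close>

subsection \<open>Fourier coefficients of trigonometric polynomials\<close>

text \<open>Two kinds of smallness have to be kept apart. Bounding \<open>l1\<close> by
  \<open>sqrt (3 * real N)\<close> times the conserved \<open>l2\<close> norm gives the cubic term a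
  Lipschitz constant of order N. Multiplied by k it is small under the step-size condition, which
  suffices for existence and uniqueness of a stage. Summing over T / k steps requires a constant
  times k instead, hence an \<open>l1\<close> bound on the numerical solution that is independent of
  N. The growth factor 5 of \<open>l1\<close> per stage would compound over the steps; comparison
  with the semidiscrete solution avoids this.

  The symbol \<open>\<bar>l\<bar> powr (2 * s)\<close> is never estimated against k in the time
  stepping. Either the real part of a pairing kills it, or it is moved to the left of the midpoint
  equation, where it becomes a factor 1 + i a with real a.

  The step-size hypothesis is stated for \<open>L2norm\<close>, whose square is 2 pi times that of
  \<open>l2\<close>. As pi > 3, the factor 3 becomes 18 in terms of \<open>l2\<close>, and the
  constants of the stage estimates are calibrated to this 18. The threshold 3 for \<mu> makes the
  coefficients summable with weight 1 + l^2, which dominates the symbol as s \<le> 1.\<close>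

abbreviation freqs :: "nat \<Rightarrow> int set" where
  "freqs N \<equiv> {- int N..int N}"

text \<open>Coefficient families live on all of \<open>int\<close>, but only their entries on
  \<open>freqs N\<close> count; equations between them are therefore asserted on
  \<open>freqs N\<close>.\<close>

definition tp :: "nat \<Rightarrow> (int \<Rightarrow> complex) \<Rightarrow> real \<Rightarrow> complex" where
  "tp N c x = (\<Sum>l\<in>freqs N. c l * cis (of_int l * x))"

text \<open>Normalised so that the characters are orthonormal; the factor 2 pi of
  \<open>L2norm\<close> enters in the passage from \<open>mean_square\<close>.\<close>

definition avg :: "(real \<Rightarrow> complex) \<Rightarrow> complex" where
  "avg f = 1 / (2 * of_real pi) * (LINT x:{-pi..pi}|lborel. f x)"

definition mean_square :: "(real \<Rightarrow> complex) \<Rightarrow> real" where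
  "mean_square f = Re (avg (\<lambda>x. f x * cnj (f x)))"

definition l2 :: "nat \<Rightarrow> (int \<Rightarrow> complex) \<Rightarrow> real" where
  "l2 N c = L2_set (\<lambda>l. cmod (c l)) (freqs N)"

definition l1 :: "nat \<Rightarrow> (int \<Rightarrow> complex) \<Rightarrow> real" where
  "l1 N c = (\<Sum>l\<in>freqs N. cmod (c l))"

definition cubic_coeff :: "nat \<Rightarrow> (int \<Rightarrow> complex) \<Rightarrow> int \<Rightarrow> complex" where
  "cubic_coeff N c = fourier_coeff (cubic (tp N c))"

lemma continuous_on_tp [continuous_intros]: "continuous_on A (tp N c)"
  unfolding tp_def cis_conv_exp by (intro continuous_intros)

lemma continuous_on_cubic [continuous_intros]:
  "continuous_on A f \<Longrightarrow> continuous_on A (cubic f)"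
  unfolding cubic_def by (intro continuous_intros) auto

lemma continuous_on_cis_mult [continuous_intros]: "continuous_on A (\<lambda>x. cis (a * x))"
  unfolding cis_conv_exp by (intro continuous_intros)

lemma set_integrable_continuous:
  fixes f :: "real \<Rightarrow> complex"
  assumes "continuous_on UNIV f"
  shows "set_integrable lborel {-pi..pi} f"
  using assms by (intro borel_integrable_atLeastAtMost') (rule continuous_on_subset, auto)

section \<open>Averages over one period\<close>

lemma avg_add:
  assumes "continuous_on UNIV f" "continuous_on UNIV g"
  shows "avg (\<lambda>x. f x + g x) = avg f + avg g"
  unfolding avg_def using assms by (simp add: set_integrable_continuous algebra_simps)

lemma avg_diff:
  assumes "continuous_on UNIV f" "continuous_on UNIV g"
  shows "avg (\<lambda>x. f x - g x) = avg f - avg g"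
  unfolding avg_def using assms by (simp add: set_integrable_continuous algebra_simps)

lemma avg_mult_right: "avg (\<lambda>x. a * f x) = a * avg f"
  unfolding avg_def by simp

lemma avg_mult_left: "avg (\<lambda>x. f x * a) = avg f * a"
  unfolding avg_def by simp

lemma avg_0 [simp]: "avg (\<lambda>x. 0) = 0"
  unfolding avg_def by simp

lemma avg_sum:
  assumes "finite A" "\<And>a. a \<in> A \<Longrightarrow> continuous_on UNIV (f a)"
  shows "avg (\<lambda>x. \<Sum>a\<in>A. f a x) = (\<Sum>a\<in>A. avg (f a))"
  using assms
proof (induction A rule: finite_induct)
  case (insert a A)
  have "continuous_on UNIV (\<lambda>x. \<Sum>a\<in>A. f a x)"
    using insert by (intro continuous_intros) auto
  then show ?case
    using insert by (simp add: avg_add)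
qed simp

lemma avg_const [simp]: "avg (\<lambda>x. a) = a"
  unfolding avg_def set_lebesgue_integral_def by (simp add: scaleR_conv_of_real)

lemma avg_cnj: "avg (\<lambda>x. cnj (f x)) = cnj (avg f)"
proof -
  have "(LINT x:{-pi..pi}|lborel. cnj (f x)) = cnj (LINT x:{-pi..pi}|lborel. f x)"
    unfolding set_lebesgue_integral_def
    by (simp flip: Bochner_Integration.integral_cnj)
  then show ?thesis unfolding avg_def by simp
qed

lemma avg_of_real: "avg (\<lambda>x. of_real (f x)) = of_real (1 / (2 * pi) * (LINT x:{-pi..pi}|lborel. f x))"
  unfolding avg_def by (simp add: set_integral_complex_of_real)

lemma set_integrable_continuous_real:
  fixes f :: "real \<Rightarrow> real"
  assumes "continuous_on UNIV f"
  shows "set_integrable lborel {-pi..pi} f"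
  using assms by (intro borel_integrable_atLeastAtMost') (rule continuous_on_subset, auto)

lemma avg_mono:
  assumes "continuous_on UNIV f" "continuous_on UNIV g"
    and "\<And>x. x \<in> {-pi..pi} \<Longrightarrow> f x \<le> g x"
  shows "Re (avg (\<lambda>x. of_real (f x))) \<le> Re (avg (\<lambda>x. of_real (g x)))"
  unfolding avg_of_real using assms
  by (auto intro!: divide_right_mono set_integral_mono set_integrable_continuous_real)

lemma norm_avg_le:
  assumes "continuous_on UNIV f" and "\<And>x. x \<in> {-pi..pi} \<Longrightarrow> cmod (f x) \<le> B"
  shows "cmod (avg f) \<le> B"
proof -
  have "cmod (avg f) \<le> 1 / (2 * pi) * (LINT x:{-pi..pi}|lborel. cmod (f x))"
    unfolding avg_def norm_mult
    using set_integral_norm_bound[OF set_integrable_continuous[OF assms(1)]]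
    by (intro mult_mono) (auto simp: norm_divide norm_mult)
  also have "\<dots> = Re (avg (\<lambda>x. of_real (cmod (f x))))"
    by (simp add: avg_of_real)
  also have "\<dots> \<le> Re (avg (\<lambda>x. of_real B))"
    using assms by (intro avg_mono continuous_intros) auto
  finally show ?thesis by simp
qed

section \<open>Fourier coefficients and orthogonality of the characters\<close>

lemma fourier_coeff_eq_avg: "fourier_coeff f l = avg (\<lambda>x. f x * cis (- (of_int l * x)))"
  unfolding fourier_coeff_def avg_def ..

lemma avg_cis: "avg (\<lambda>x. cis (of_int l * x)) = (if l = 0 then 1 else 0)"
proof (cases "l = 0")
  case False
  have "((\<lambda>z. exp (\<i> * (of_int l * z)) / (\<i> * of_int l)) has_field_derivative
      exp (\<i> * (of_int l * z))) (at z)" for z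
    using False by (auto intro!: derivative_eq_intros) (metis i_squared minus_mult_minus mult.commute mult.left_commute mult_1 mult_minus_left)
  from has_vector_derivative_real_field[OF this]
  have "((\<lambda>x. cis (of_int l * x)) has_integral
      (cis (of_int l * pi) / (\<i> * of_int l) - cis (of_int l * (- pi)) / (\<i> * of_int l))) {-pi..pi}"
    using False unfolding cis_conv_exp
    by (intro fundamental_theorem_of_calculus)
       auto
  moreover have "cis (of_int l * pi) = cis (of_int l * (- pi))"
    using sin_zero_iff_int2[of "of_int l * pi"] by (auto simp: cis.ctr)
  ultimately have "integral {-pi..pi} (\<lambda>x. cis (of_int l * x)) = 0"
    by (simp add: integral_unique)
  moreover have "set_integrable lborel {-pi..pi} (\<lambda>x. cis (of_int l * x))"
    by (intro set_integrable_continuous continuous_intros)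
  ultimately show ?thesis
    using False unfolding avg_def by (simp add: set_borel_integral_eq_integral)
qed simp

lemma fourier_coeff_cis: "fourier_coeff (\<lambda>x. cis (of_int m * x)) l = (if m = l then 1 else 0)"
proof -
  have "(\<lambda>x. cis (of_int m * x) * cis (- (of_int l * x))) = (\<lambda>x. cis (of_int (m - l) * x))"
    by (simp add: cis_mult algebra_simps)
  then show ?thesis
    unfolding fourier_coeff_eq_avg by (simp only: avg_cis) auto
qed

lemma fourier_coeff_add:
  assumes "continuous_on UNIV f" "continuous_on UNIV g"
  shows "fourier_coeff (\<lambda>x. f x + g x) l = fourier_coeff f l + fourier_coeff g l"
  unfolding fourier_coeff_eq_avg distrib_right minus_mult_left of_int_minus[symmetric] using assms
  by (intro avg_add continuous_intros)

lemma fourier_coeff_diff: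
  assumes "continuous_on UNIV f" "continuous_on UNIV g"
  shows "fourier_coeff (\<lambda>x. f x - g x) l = fourier_coeff f l - fourier_coeff g l"
  unfolding fourier_coeff_eq_avg left_diff_distrib minus_mult_left of_int_minus[symmetric] using assms
  by (intro avg_diff continuous_intros)

lemma fourier_coeff_mult: "fourier_coeff (\<lambda>x. a * f x) l = a * fourier_coeff f l"
  unfolding fourier_coeff_eq_avg by (simp add: avg_mult_right mult.assoc)

lemma fourier_coeff_sum:
  assumes "finite A" "\<And>a. a \<in> A \<Longrightarrow> continuous_on UNIV (f a)"
  shows "fourier_coeff (\<lambda>x. \<Sum>a\<in>A. f a x) l = (\<Sum>a\<in>A. fourier_coeff (f a) l)"
  unfolding fourier_coeff_eq_avg sum_distrib_right minus_mult_left of_int_minus[symmetric] using assms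
  by (intro avg_sum continuous_intros) auto

lemma fourier_coeff_tp: "fourier_coeff (tp N c) l = (if l \<in> freqs N then c l else 0)"
  unfolding tp_def
  by (subst fourier_coeff_sum) (auto intro!: continuous_intros simp: fourier_coeff_mult fourier_coeff_cis
      if_distrib cong: if_cong)

lemma norm_fourier_coeff_le:
  assumes "continuous_on UNIV f" and "\<And>x. x \<in> {-pi..pi} \<Longrightarrow> cmod (f x) \<le> B"
  shows "cmod (fourier_coeff f l) \<le> B"
  unfolding fourier_coeff_eq_avg minus_mult_left of_int_minus[symmetric] using assms
  by (intro norm_avg_le continuous_intros) (auto simp: norm_mult)

lemma tp_cong: "(\<And>l. l \<in> freqs N \<Longrightarrow> c l = d l) \<Longrightarrow> tp N c = tp N d"
  by (auto simp: tp_def intro!: sum.cong)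

lemma tp_eq_iff: "tp N c = tp N d \<longleftrightarrow> (\<forall>l\<in>freqs N. c l = d l)"
  by (metis fourier_coeff_tp tp_cong)

lemma trig_polys_iff: "f \<in> trig_polys N \<longleftrightarrow> f = tp N (fourier_coeff f)"
proof
  assume "f \<in> trig_polys N"
  then obtain c where "f = tp N c"
    by (auto simp: trig_polys_def tp_def fun_eq_iff)
  then show "f = tp N (fourier_coeff f)"
    by (simp add: tp_eq_iff fourier_coeff_tp)
qed (auto simp: trig_polys_def tp_def fun_eq_iff intro!: exI[of _ "fourier_coeff f"])

lemma tp_in_trig_polys [simp]: "tp N c \<in> trig_polys N"
  by (auto simp: trig_polys_def tp_def fun_eq_iff)

lemma fourier_proj_eq: "fourier_proj N f = tp N (fourier_coeff f)"
  by (simp add: fourier_proj_def tp_def fun_eq_iff)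

lemma tp_add: "tp N c x + tp N d x = tp N (\<lambda>l. c l + d l) x"
  by (simp add: tp_def sum.distrib algebra_simps)

lemma tp_diff: "tp N c x - tp N d x = tp N (\<lambda>l. c l - d l) x"
  by (simp add: tp_def sum_subtractf algebra_simps)

lemma tp_mult: "a * tp N c x = tp N (\<lambda>l. a * c l) x"
  by (simp add: tp_def sum_distrib_left algebra_simps)

lemma norm_tp_le: "cmod (tp N c x) \<le> l1 N c"
  unfolding tp_def l1_def by (rule order_trans[OF norm_sum]) (simp add: norm_mult)

section \<open>Norms of coefficient families\<close>

lemma l2_nonneg [simp]: "0 \<le> l2 N c" by (simp add: l2_def)
lemma l1_nonneg [simp]: "0 \<le> l1 N c" by (simp add: l1_def sum_nonneg)

lemma l2_sq: "(l2 N c)\<^sup>2 = (\<Sum>l\<in>freqs N. (cmod (c l))\<^sup>2)"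
  by (simp add: l2_def L2_set_def sum_nonneg)

lemma l2_mono: "(\<And>l. l \<in> freqs N \<Longrightarrow> cmod (c l) \<le> cmod (d l)) \<Longrightarrow> l2 N c \<le> l2 N d"
  unfolding l2_def by (intro L2_set_mono) auto

lemma l2_triangle: "l2 N (\<lambda>l. c l + d l) \<le> l2 N c + l2 N d"
  unfolding l2_def
  by (rule order_trans[OF L2_set_mono L2_set_triangle_ineq]) (auto intro: norm_triangle_ineq)

lemma l2_mult: "l2 N (\<lambda>l. a * c l) = cmod a * l2 N c"
  unfolding l2_def norm_mult by (simp add: L2_set_right_distrib)

lemma l2_minus_commute: "l2 N (\<lambda>l. c l - d l) = l2 N (\<lambda>l. d l - c l)"
  by (simp add: l2_def norm_minus_commute)

lemma l2_cong: "(\<And>l. l \<in> freqs N \<Longrightarrow> c l = d l) \<Longrightarrow> l2 N c = l2 N d"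
  unfolding l2_def by (intro L2_set_cong) auto

lemma l2_eq_0_iff: "l2 N c = 0 \<longleftrightarrow> (\<forall>l\<in>freqs N. c l = 0)"
  by (simp add: l2_def L2_set_eq_0_iff)

lemma l2_zero [simp]: "l2 N (\<lambda>l. 0) = 0"
  by (simp add: l2_eq_0_iff)

lemma norm_le_l2: "l \<in> freqs N \<Longrightarrow> cmod (c l) \<le> l2 N c"
  unfolding l2_def by (intro member_le_L2_set) auto

lemma l1_triangle: "l1 N (\<lambda>l. c l + d l) \<le> l1 N c + l1 N d"
  unfolding l1_def sum.distrib[symmetric] by (intro sum_mono norm_triangle_ineq)

lemma l1_mult: "l1 N (\<lambda>l. a * c l) = cmod a * l1 N c"
  by (simp add: l1_def norm_mult sum_distrib_left)

lemma l1_mono: "(\<And>l. l \<in> freqs N \<Longrightarrow> cmod (c l) \<le> cmod (d l)) \<Longrightarrow> l1 N c \<le> l1 N d"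
  unfolding l1_def by (intro sum_mono) auto

lemma l1_cong: "(\<And>l. l \<in> freqs N \<Longrightarrow> c l = d l) \<Longrightarrow> l1 N c = l1 N d"
  unfolding l1_def by (intro sum.cong) auto

lemma l1_le_l2: "l1 N c \<le> sqrt (2 * real N + 1) * l2 N c"
  using L2_set_mult_ineq[of "\<lambda>l. 1" "\<lambda>l. cmod (c l)" "freqs N"]
  unfolding l1_def l2_def by (simp add: L2_set_constant algebra_simps)

lemma l1_le_l2': "1 \<le> N \<Longrightarrow> l1 N c \<le> sqrt (3 * real N) * l2 N c"
  by (rule order_trans[OF l1_le_l2]) (auto intro!: mult_right_mono)

section \<open>Mean squares and Bessel's inequality\<close>

lemma avg_mult_cnj_tp:
  assumes "continuous_on UNIV f"
  shows "avg (\<lambda>x. f x * cnj (tp N c x)) = (\<Sum>l\<in>freqs N. fourier_coeff f l * cnj (c l))"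
proof -
  have "(\<lambda>x. f x * cnj (tp N c x)) =
      (\<lambda>x. \<Sum>l\<in>freqs N. (f x * cis (of_int (- l) * x)) * cnj (c l))"
    by (simp add: tp_def fun_eq_iff sum_distrib_left cis_cnj algebra_simps)
  then show ?thesis
    using assms unfolding fourier_coeff_eq_avg minus_mult_left of_int_minus[symmetric]
    by (simp only:) (subst avg_sum, auto intro!: continuous_intros simp: avg_mult_left)
qed

lemma mean_square_nonneg: "0 \<le> mean_square f"
proof -
  have "mean_square f = 1 / (2 * pi) * (LINT x:{-pi..pi}|lborel. (cmod (f x))\<^sup>2)"
    unfolding mean_square_def complex_norm_square[symmetric] avg_of_real by simp
  also have "\<dots> \<ge> 0"
    unfolding set_lebesgue_integral_def by (simp add: integral_nonneg_AE)
  finally show ?thesis .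
qed

lemma L2norm_sq: "(L2norm f)\<^sup>2 = 2 * pi * mean_square f"
proof -
  have "mean_square f = 1 / (2 * pi) * (LINT x:{-pi..pi}|lborel. (cmod (f x))\<^sup>2)"
    unfolding mean_square_def complex_norm_square[symmetric] avg_of_real by simp
  moreover have "(LINT x:{-pi..pi}|lborel. (cmod (f x))\<^sup>2) \<ge> 0"
    unfolding set_lebesgue_integral_def by (simp add: integral_nonneg_AE)
  ultimately show ?thesis
    unfolding L2norm_def by simp
qed

lemma L2norm_eq: "L2norm f = sqrt (2 * pi * mean_square f)"
proof -
  have "0 \<le> L2norm f"
    unfolding L2norm_def set_lebesgue_integral_def by (simp add: integral_nonneg_AE)
  then show ?thesis
    by (simp flip: L2norm_sq)
qed

lemma mean_square_mono:
  assumes "continuous_on UNIV f" "continuous_on UNIV g"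
    and "\<And>x. x \<in> {-pi..pi} \<Longrightarrow> cmod (f x) \<le> cmod (g x)"
  shows "mean_square f \<le> mean_square g"
  unfolding mean_square_def complex_norm_square[symmetric] using assms
  by (intro avg_mono continuous_intros) (auto intro!: power_mono)

lemma mean_square_mult: "mean_square (\<lambda>x. a * f x) = (cmod a)\<^sup>2 * mean_square f"
proof -
  have "(\<lambda>x. a * f x * cnj (a * f x)) = (\<lambda>x. of_real ((cmod a)\<^sup>2) * (f x * cnj (f x)))"
    by (simp add: fun_eq_iff complex_norm_square del: of_real_power)
  then show ?thesis
    unfolding mean_square_def by (simp add: avg_mult_right del: of_real_power)
qed

text \<open>Completing the square in each coefficient. With \<open>c\<close> the Fourier
  coefficients of \<open>f\<close> this gives Bessel's inequality and the truncation remainder; with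
  other \<open>c\<close> it splits an approximation error into the tail of \<open>f\<close> and an
  \<open>l2\<close> distance of low modes.\<close>

lemma mean_square_minus_tp:
  assumes "continuous_on UNIV f"
  shows "mean_square (\<lambda>x. f x - tp N c x) =
    mean_square f - (l2 N (fourier_coeff f))\<^sup>2 + (l2 N (\<lambda>l. fourier_coeff f l - c l))\<^sup>2"
proof -
  have avg4: "avg (\<lambda>x. f1 x - f2 x - f3 x + f4 x) = avg f1 - avg f2 - avg f3 + avg f4"
    if "continuous_on UNIV f1" "continuous_on UNIV f2" "continuous_on UNIV f3" "continuous_on UNIV f4"
    for f1 f2 f3 f4
    using that by (simp add: avg_add avg_diff continuous_intros)
  have "(\<lambda>x. (f x - tp N c x) * cnj (f x - tp N c x)) =
      (\<lambda>x. f x * cnj (f x) - f x * cnj (tp N c x) - cnj (f x * cnj (tp N c x)) + tp N c x * cnj (tp N c x))"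
    by (simp add: fun_eq_iff algebra_simps)
  then have "avg (\<lambda>x. (f x - tp N c x) * cnj (f x - tp N c x)) =
      avg (\<lambda>x. f x * cnj (f x)) - avg (\<lambda>x. f x * cnj (tp N c x)) - cnj (avg (\<lambda>x. f x * cnj (tp N c x)))
        + avg (\<lambda>x. tp N c x * cnj (tp N c x))"
    using assms
    by (simp only: avg_cnj[symmetric]) (intro avg4 continuous_intros)
  also have "\<dots> = avg (\<lambda>x. f x * cnj (f x)) - (\<Sum>l\<in>freqs N. fourier_coeff f l * cnj (c l))
      - cnj (\<Sum>l\<in>freqs N. fourier_coeff f l * cnj (c l)) + (\<Sum>l\<in>freqs N. c l * cnj (c l))"
    using assms by (simp add: avg_mult_cnj_tp continuous_intros fourier_coeff_tp)
  finally have eq: "avg (\<lambda>x. (f x - tp N c x) * cnj (f x - tp N c x)) =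
      avg (\<lambda>x. f x * cnj (f x)) - (\<Sum>l\<in>freqs N. fourier_coeff f l * cnj (c l))
      - cnj (\<Sum>l\<in>freqs N. fourier_coeff f l * cnj (c l)) + (\<Sum>l\<in>freqs N. c l * cnj (c l))" .
  have "mean_square (\<lambda>x. f x - tp N c x) = mean_square f
      + (\<Sum>l\<in>freqs N. Re (- (fourier_coeff f l * cnj (c l)) - cnj (fourier_coeff f l * cnj (c l)) + c l * cnj (c l)))"
    unfolding mean_square_def eq
    by (simp add: sum_subtractf sum.distrib sum_negf sum_distrib_left algebra_simps)
  also have "(\<Sum>l\<in>freqs N. Re (- (fourier_coeff f l * cnj (c l)) - cnj (fourier_coeff f l * cnj (c l)) + c l * cnj (c l)))
     = (\<Sum>l\<in>freqs N. (cmod (fourier_coeff f l - c l))\<^sup>2 - (cmod (fourier_coeff f l))\<^sup>2)"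
    by (intro sum.cong refl, unfold cmod_power2) (simp add: algebra_simps power2_eq_square)
  finally show ?thesis
    by (simp add: l2_sq sum_subtractf)
qed

lemma mean_square_tp: "mean_square (tp N c) = (l2 N c)\<^sup>2"
  unfolding mean_square_def avg_mult_cnj_tp[OF continuous_on_tp] l2_sq
  by (auto simp: fourier_coeff_tp complex_norm_square[symmetric] simp del: of_real_power
      intro!: sum.cong)

lemma L2norm_tp: "L2norm (tp N c) = sqrt (2 * pi) * l2 N c"
  by (simp add: L2norm_eq mean_square_tp real_sqrt_mult)

lemma bessel: "continuous_on UNIV f \<Longrightarrow> (l2 N (fourier_coeff f))\<^sup>2 \<le> mean_square f"
  using mean_square_minus_tp[of f N "fourier_coeff f"] mean_square_nonneg
    [of "\<lambda>x. f x - tp N (fourier_coeff f) x"]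
  by (simp add: l2_sq)

section \<open>Estimates for the cubic term\<close>

lemma norm_cubic_diff:
  assumes "cmod a \<le> R" "cmod b \<le> R"
  shows "cmod (of_real ((cmod a)\<^sup>2) * a - of_real ((cmod b)\<^sup>2) * b) \<le> 3 * R\<^sup>2 * cmod (a - b)"
proof -
  \<comment> \<open>The second summand contains a difference of moduli, so the reverse triangle
    inequality applies; the constant is 3 = 1 + 2.\<close>
  have "of_real ((cmod a)\<^sup>2) * a - of_real ((cmod b)\<^sup>2) * b =
    of_real ((cmod a)\<^sup>2) * (a - b) + of_real ((cmod a + cmod b) * (cmod a - cmod b)) * b"
    by (simp add: algebra_simps power2_eq_square)
  also have "cmod \<dots> \<le> (cmod a)\<^sup>2 * cmod (a - b) + (cmod a + cmod b) * \<bar>cmod a - cmod b\<bar> * cmod b"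
    by (rule order_trans[OF norm_triangle_ineq])
       (simp add: norm_mult abs_mult norm_power del: of_real_mult of_real_diff of_real_add of_real_power)
  also have "\<dots> \<le> R\<^sup>2 * cmod (a - b) + (R + R) * cmod (a - b) * R"
    using assms norm_triangle_ineq3[of a b] order_trans[OF norm_ge_zero assms(1)]
    by (intro add_mono mult_mono power_mono) auto
  finally show ?thesis by (simp add: power2_eq_square algebra_simps)
qed

text \<open>Bessel's inequality reduces the projected difference to a pointwise bound. The
  right-hand side is the full mean square because one of the functions will be the exact solution,
  which has modes beyond \<open>N\<close>.\<close>

lemma l2_cubic_diff:
  assumes "continuous_on UNIV f" "continuous_on UNIV g"
    and "\<And>x. x \<in> {-pi..pi} \<Longrightarrow> cmod (f x) \<le> R" "\<And>x. x \<in> {-pi..pi} \<Longrightarrow> cmod (g x) \<le> R"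
  shows "(l2 N (\<lambda>l. fourier_coeff (cubic f) l - fourier_coeff (cubic g) l))\<^sup>2
    \<le> (3 * R\<^sup>2)\<^sup>2 * mean_square (\<lambda>x. f x - g x)"
proof -
  have "(l2 N (fourier_coeff (\<lambda>x. cubic f x - cubic g x)))\<^sup>2 \<le> mean_square (\<lambda>x. cubic f x - cubic g x)"
    using assms by (intro bessel continuous_intros)
  also have "\<dots> \<le> mean_square (\<lambda>x. of_real (3 * R\<^sup>2) * (f x - g x))"
    using assms norm_cubic_diff[of _ R]
    by (intro mean_square_mono continuous_intros) (auto simp: cubic_def norm_mult norm_power)
  also have "\<dots> = (3 * R\<^sup>2)\<^sup>2 * mean_square (\<lambda>x. f x - g x)"
    by (simp add: mean_square_mult norm_mult norm_power)
  also have "fourier_coeff (\<lambda>x. cubic f x - cubic g x) =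
      (\<lambda>l. fourier_coeff (cubic f) l - fourier_coeff (cubic g) l)"
    using assms by (intro ext fourier_coeff_diff continuous_intros)
  finally show ?thesis .
qed

lemma l2_cubic_coeff_diff:
  assumes "l1 N c \<le> R" "l1 N d \<le> R"
  shows "l2 N (\<lambda>l. cubic_coeff N c l - cubic_coeff N d l) \<le> 3 * R\<^sup>2 * l2 N (\<lambda>l. c l - d l)"
proof -
  have "(l2 N (\<lambda>l. cubic_coeff N c l - cubic_coeff N d l))\<^sup>2
     \<le> (3 * R\<^sup>2)\<^sup>2 * mean_square (\<lambda>x. tp N c x - tp N d x)"
    unfolding cubic_coeff_def
    by (intro l2_cubic_diff continuous_intros order_trans[OF norm_tp_le] assms)
  also have "\<dots> = (3 * R\<^sup>2 * l2 N (\<lambda>l. c l - d l))\<^sup>2"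
    by (simp add: tp_diff mean_square_tp[unfolded tp_def[abs_def]] power_mult_distrib
         mean_square_tp)
  finally show ?thesis
    by (rule power2_le_imp_le) simp
qed

text \<open>Against an element of the span the projection is invisible, so the sum is the average of
  the fourth power of the modulus.\<close>

lemma cubic_pairing_real:
  "Im (\<Sum>l\<in>freqs N. cubic_coeff N c l * cnj (c l)) = 0"
proof -
  have "(\<Sum>l\<in>freqs N. cubic_coeff N c l * cnj (c l)) = avg (\<lambda>x. cubic (tp N c) x * cnj (tp N c x))"
    by (simp add: avg_mult_cnj_tp continuous_intros cubic_coeff_def)
  also have "(\<lambda>x. cubic (tp N c) x * cnj (tp N c x)) = (\<lambda>x. of_real ((cmod (tp N c x))\<^sup>2 * (cmod (tp N c x))\<^sup>2))"
    by (simp add: cubic_def fun_eq_iff mult.assoc complex_norm_square[symmetric] del: of_real_power)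
       (simp flip: of_real_mult power_add)
  finally show ?thesis
    by (simp only: avg_of_real) simp
qed

text \<open>Expanding the cube, the \<open>l\<close>-th coefficient is the sum of \<open>c i * cnj (c j) * c m\<close> over
  \<open>i - j + m = l\<close>, and each triple contributes to at most one \<open>l\<close>.\<close>

lemma l1_cubic_coeff: "l1 N (cubic_coeff N c) \<le> (l1 N c) ^ 3"
proof -
  let ?I = "freqs N"
  have prod3: "sum f ?I * sum g ?I * sum h ?I = (\<Sum>i\<in>?I. \<Sum>j\<in>?I. \<Sum>m\<in>?I. f i * g j * h m)"
    for f g h :: "int \<Rightarrow> 'a :: comm_semiring_0"
  proof -
    have "sum f ?I * sum g ?I * sum h ?I = (\<Sum>i\<in>?I. f i * (sum g ?I * sum h ?I))"
      by (simp only: mult.assoc) (rule sum_distrib_right)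
    also have "\<dots> = (\<Sum>i\<in>?I. \<Sum>j\<in>?I. \<Sum>m\<in>?I. f i * g j * h m)"
      by (subst sum_product) (simp only: sum_distrib_left mult.assoc)
    finally show ?thesis .
  qed
  have "cubic (tp N c) x = (\<Sum>i\<in>?I. \<Sum>j\<in>?I. \<Sum>m\<in>?I.
      (c i * cnj (c j) * c m) * cis (of_int (i - j + m) * x))" for x
  proof -
    have "cubic (tp N c) x = tp N c x * cnj (tp N c x) * tp N c x"
      by (simp add: cubic_def complex_norm_square del: of_real_power)
    also have "\<dots> = (\<Sum>i\<in>?I. \<Sum>j\<in>?I. \<Sum>m\<in>?I.
      (c i * cis (of_int i * x)) * cnj (c j * cis (of_int j * x)) * (c m * cis (of_int m * x)))"
      unfolding tp_def cnj_sum by (rule prod3)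
    also have "\<dots> = (\<Sum>i\<in>?I. \<Sum>j\<in>?I. \<Sum>m\<in>?I.
      (c i * cnj (c j) * c m) * (cis (of_int i * x) * cis (- (of_int j * x)) * cis (of_int m * x)))"
      by (intro sum.cong refl) (simp add: cis_cnj algebra_simps)
    finally show ?thesis
      by (simp add: cis_mult algebra_simps)
  qed
  then have eq: "cubic (tp N c) = (\<lambda>x. \<Sum>i\<in>?I. \<Sum>j\<in>?I. \<Sum>m\<in>?I.
      (c i * cnj (c j) * c m) * cis (of_int (i - j + m) * x))" by blast
  have "cubic_coeff N c l = (\<Sum>i\<in>?I. \<Sum>j\<in>?I. \<Sum>m\<in>?I.
      (c i * cnj (c j) * c m) * (if i - j + m = l then 1 else 0))" for l
    unfolding cubic_coeff_def eq
    by (simp only: fourier_coeff_sum fourier_coeff_mult fourier_coeff_cis continuous_intros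
        finite_atLeastAtMost_int continuous_on_sum continuous_on_mult_left continuous_on_cis_mult)
  then have "cmod (cubic_coeff N c l) \<le> (\<Sum>i\<in>?I. \<Sum>j\<in>?I. \<Sum>m\<in>?I.
      (cmod (c i) * cmod (c j) * cmod (c m)) * (if i - j + m = l then 1 else 0))" for l
    by (auto intro!: sum_norm_le simp: norm_mult)
  then have "l1 N (cubic_coeff N c) \<le> (\<Sum>l\<in>?I. \<Sum>i\<in>?I. \<Sum>j\<in>?I. \<Sum>m\<in>?I.
      (cmod (c i) * cmod (c j) * cmod (c m)) * (if i - j + m = l then 1 else 0))"
    unfolding l1_def by (intro sum_mono)
  also have "\<dots> = (\<Sum>i\<in>?I. \<Sum>l\<in>?I. \<Sum>j\<in>?I. \<Sum>m\<in>?I.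
      (cmod (c i) * cmod (c j) * cmod (c m)) * (if i - j + m = l then 1 else 0))"
    by (rule sum.swap)
  also have "\<dots> = (\<Sum>i\<in>?I. \<Sum>j\<in>?I. \<Sum>l\<in>?I. \<Sum>m\<in>?I.
      (cmod (c i) * cmod (c j) * cmod (c m)) * (if i - j + m = l then 1 else 0))"
    by (intro sum.cong refl sum.swap)
  also have "\<dots> = (\<Sum>i\<in>?I. \<Sum>j\<in>?I. \<Sum>m\<in>?I. \<Sum>l\<in>?I.
      (cmod (c i) * cmod (c j) * cmod (c m)) * (if i - j + m = l then 1 else 0))"
    by (intro sum.cong refl sum.swap)
  also have "\<dots> \<le> (\<Sum>i\<in>?I. \<Sum>j\<in>?I. \<Sum>m\<in>?I. cmod (c i) * cmod (c j) * cmod (c m))"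
    by (intro sum_mono) (simp add: sum_distrib_left[symmetric] sum.delta)
  also have "\<dots> = l1 N c * l1 N c * l1 N c"
    unfolding l1_def by (rule prod3[symmetric])
  finally show ?thesis by (simp add: power3_eq_cube)
qed

subsection \<open>The implicit midpoint step\<close>

definition field_coeff :: "real \<Rightarrow> nat \<Rightarrow> (int \<Rightarrow> complex) \<Rightarrow> int \<Rightarrow> complex" where
  "field_coeff s N c l = - \<i> * of_real (\<bar>of_int l\<bar> powr (2 * s)) * c l + \<i> * cubic_coeff N c l"

definition midpoint_step ::
  "real \<Rightarrow> nat \<Rightarrow> real \<Rightarrow> (int \<Rightarrow> complex) \<Rightarrow> (int \<Rightarrow> complex) \<Rightarrow> bool" where
  "midpoint_step s N \<tau> v v' \<longleftrightarrow>
     (\<forall>l\<in>freqs N. v' l = v l + of_real \<tau> * field_coeff s N (\<lambda>l. (v' l + v l) / 2) l)"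

lemma frac_laplacian_tp:
  "frac_laplacian s (tp N c) = tp N (\<lambda>l. of_real (\<bar>of_int l\<bar> powr (2 * s)) * c l)"
proof
  fix x
  have "frac_laplacian s (tp N c) x =
    (\<Sum>\<^sub>\<infinity>l\<in>freqs N. of_real (\<bar>of_int l\<bar> powr (2 * s)) * c l * cis (of_int l * x))"
    unfolding frac_laplacian_def by (rule infsum_cong_neutral) (auto simp: fourier_coeff_tp)
  then show "frac_laplacian s (tp N c) x = tp N (\<lambda>l. of_real (\<bar>of_int l\<bar> powr (2 * s)) * c l) x"
    by (simp add: tp_def)
qed

lemma rhs_F_tp: "rhs_F s N (tp N c) = tp N (field_coeff s N c)"
proof
  fix x
  show "rhs_F s N (tp N c) x = tp N (field_coeff s N c) x"
    unfolding rhs_F_def frac_laplacian_tp fourier_proj_eq tp_mult tp_add field_coeff_def cubic_coeff_def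
    by (simp add: algebra_simps)
qed

lemma midpoint_step_iff:
  "midpoint_step s N \<tau> v v' \<longleftrightarrow>
   (\<forall>x. tp N v' x = tp N v x + of_real \<tau> * rhs_F s N (\<lambda>y. (tp N v' y + tp N v y) / 2) x)"
proof -
  have "(\<lambda>y. (tp N v' y + tp N v y) / 2) = tp N (\<lambda>l. (v' l + v l) / 2)"
    using tp_mult[of "1/2" N "\<lambda>l. v' l + v l"] by (simp add: tp_add fun_eq_iff)
  then have "(\<forall>x. tp N v' x = tp N v x + of_real \<tau> * rhs_F s N (\<lambda>y. (tp N v' y + tp N v y) / 2) x)
    \<longleftrightarrow> tp N v' = tp N (\<lambda>l. v l + of_real \<tau> * field_coeff s N (\<lambda>l. (v' l + v l) / 2) l)"
    by (simp add: rhs_F_tp tp_add tp_mult fun_eq_iff)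
  then show ?thesis
    by (simp add: midpoint_step_def tp_eq_iff)
qed

lemma l2_cauchy_schwarz: "cmod (\<Sum>l\<in>freqs N. c l * cnj (d l)) \<le> l2 N c * l2 N d"
proof -
  have "cmod (\<Sum>l\<in>freqs N. c l * cnj (d l)) \<le> (\<Sum>l\<in>freqs N. \<bar>cmod (c l)\<bar> * \<bar>cmod (d l)\<bar>)"
    by (rule order_trans[OF norm_sum]) (simp add: norm_mult)
  also have "\<dots> \<le> l2 N c * l2 N d"
    unfolding l2_def by (rule L2_set_mult_ineq)
  finally show ?thesis .
qed

text \<open>Both terms of the field are \<i> times something whose pairing with \<open>c\<close> is
  real. This is the common source of \<open>l2\<close> conservation for the semidiscrete flow and
  for the midpoint rule.\<close>

lemma field_coeff_skew: "(\<Sum>l\<in>freqs N. Re (field_coeff s N c l * cnj (c l))) = 0"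
proof -
  have "Re (field_coeff s N c l * cnj (c l)) = - Im (cubic_coeff N c l * cnj (c l))" for l
    by (simp add: field_coeff_def algebra_simps)
  then show ?thesis
    by (simp only: sum_negf Im_sum[symmetric] cubic_pairing_real minus_zero)
qed

text \<open>The symbol is real, so the linear term vanishes from the real part of the pairing. The
  bound is thus free of \<open>\<bar>l\<bar> powr (2 * s)\<close>, although the field itself has no
  Lipschitz constant uniform in \<open>N\<close>.\<close>

lemma field_coeff_diff_pairing:
  assumes "l1 N c \<le> R" "l1 N d \<le> R"
  shows "\<bar>\<Sum>l\<in>freqs N. Re ((field_coeff s N c l - field_coeff s N d l) * cnj (c l - d l))\<bar>
    \<le> 3 * R\<^sup>2 * (l2 N (\<lambda>l. c l - d l))\<^sup>2"
proof -
  let ?G = "\<lambda>l. cubic_coeff N c l - cubic_coeff N d l"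
  have "Re ((field_coeff s N c l - field_coeff s N d l) * cnj (c l - d l))
    = - Im (?G l * cnj (c l - d l))" for l
    by (simp add: field_coeff_def algebra_simps)
  then have "\<bar>\<Sum>l\<in>freqs N. Re ((field_coeff s N c l - field_coeff s N d l) * cnj (c l - d l))\<bar>
    = \<bar>Im (\<Sum>l\<in>freqs N. ?G l * cnj (c l - d l))\<bar>"
    by (simp only: sum_negf Im_sum abs_minus_cancel)
  also have "\<dots> \<le> l2 N ?G * l2 N (\<lambda>l. c l - d l)"
    by (rule order_trans[OF abs_Im_le_cmod l2_cauchy_schwarz])
  also have "\<dots> \<le> 3 * R\<^sup>2 * l2 N (\<lambda>l. c l - d l) * l2 N (\<lambda>l. c l - d l)"
    using assms by (intro mult_right_mono l2_cubic_coeff_diff) auto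
  finally show ?thesis by (simp add: power2_eq_square mult.assoc)
qed

text \<open>Increment times sum: for a midpoint step these are the field at the midpoint and twice
  the midpoint.\<close>

lemma l2_sq_diff: "(l2 N a)\<^sup>2 - (l2 N b)\<^sup>2 = (\<Sum>l\<in>freqs N. Re ((a l - b l) * cnj (a l + b l)))"
  unfolding l2_sq sum_subtractf[symmetric]
  by (intro sum.cong refl, unfold cmod_power2) (simp add: power2_eq_square algebra_simps)

lemma midpoint_step_l2:
  assumes "midpoint_step s N \<tau> v v'"
  shows "l2 N v' = l2 N v"
proof -
  define w where "w = (\<lambda>l. (v' l + v l) / 2)"
  have "(l2 N v')\<^sup>2 - (l2 N v)\<^sup>2 = (\<Sum>l\<in>freqs N. 2 * \<tau> * Re (field_coeff s N w l * cnj (w l)))"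
    unfolding l2_sq_diff
  proof (intro sum.cong refl)
    fix l assume "l \<in> freqs N"
    then have "v' l - v l = of_real \<tau> * field_coeff s N w l" and "v' l + v l = of_real 2 * w l"
      using assms by (auto simp: midpoint_step_def w_def)
    then show "Re ((v' l - v l) * cnj (v' l + v l)) = 2 * \<tau> * Re (field_coeff s N w l * cnj (w l))"
      by (simp add: algebra_simps)
  qed
  also have "\<dots> = 0"
    by (simp only: sum_distrib_left[symmetric] field_coeff_skew)
  finally show ?thesis by simp
qed

text \<open>The difference of squares is \<open>2 * \<tau>\<close> times the pairing of the field
  difference with the difference of the midpoints, whose \<open>l2\<close> norm is at most
  \<open>(a + b) / 2\<close>. Cancelling one factor \<open>a + b\<close> leaves an estimate linear
  in the errors.\<close>

lemma midpoint_step_diff: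
  assumes v: "midpoint_step s N \<tau> v v'" and u: "midpoint_step s N \<tau> u u'"
    and R: "l1 N (\<lambda>l. (v' l + v l) / 2) \<le> R" "l1 N (\<lambda>l. (u' l + u l) / 2) \<le> R"
  defines "a \<equiv> l2 N (\<lambda>l. v' l - u' l)" and "b \<equiv> l2 N (\<lambda>l. v l - u l)"
  shows "a \<le> b + \<bar>\<tau>\<bar> * (3 * R\<^sup>2) / 2 * (a + b)"
proof (cases "a + b = 0")
  case False
  define w z where "w = (\<lambda>l. (v' l + v l) / 2)" and "z = (\<lambda>l. (u' l + u l) / 2)"
  have ab: "0 \<le> a" "0 \<le> b" by (auto simp: a_def b_def)
  have "(l2 N (\<lambda>l. w l - z l)) = l2 N (\<lambda>l. (1/2) * ((v' l - u' l) + (v l - u l)))"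
    by (intro l2_cong) (simp add: w_def z_def field_simps)
  also have "\<dots> \<le> (1/2) * (a + b)"
    unfolding l2_mult a_def b_def using l2_triangle[of N "\<lambda>l. v' l - u' l" "\<lambda>l. v l - u l"] by simp
  finally have e: "l2 N (\<lambda>l. w l - z l) \<le> (a + b) / 2" by simp
  have "a\<^sup>2 - b\<^sup>2 = (\<Sum>l\<in>freqs N. 2 * \<tau> * Re ((field_coeff s N w l - field_coeff s N z l) * cnj (w l - z l)))"
    unfolding l2_sq_diff a_def b_def
  proof (intro sum.cong refl)
    fix l assume l: "l \<in> freqs N"
    have "v' l - v l = of_real \<tau> * field_coeff s N w l" "u' l - u l = of_real \<tau> * field_coeff s N z l"
      using v u l by (auto simp: midpoint_step_def w_def z_def)
    then have "v' l - u' l - (v l - u l) = of_real \<tau> * (field_coeff s N w l - field_coeff s N z l)"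
      by (simp add: algebra_simps)
    moreover have "v' l - u' l + (v l - u l) = of_real 2 * (w l - z l)"
      by (simp add: w_def z_def field_simps)
    ultimately show "Re ((v' l - u' l - (v l - u l)) * cnj (v' l - u' l + (v l - u l))) =
       2 * \<tau> * Re ((field_coeff s N w l - field_coeff s N z l) * cnj (w l - z l))"
      by (simp only:) (simp add: algebra_simps)
  qed
  also have "\<dots> \<le> 2 * \<bar>\<tau>\<bar> * \<bar>\<Sum>l\<in>freqs N. Re ((field_coeff s N w l - field_coeff s N z l) * cnj (w l - z l))\<bar>"
    unfolding sum_distrib_left[symmetric]
    by (rule order_trans[OF abs_ge_self]) (simp only: abs_mult abs_numeral order_refl)
  also have "\<dots> \<le> 2 * \<bar>\<tau>\<bar> * (3 * R\<^sup>2 * ((a + b) / 2)\<^sup>2)"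
  proof (intro mult_left_mono)
    have "\<bar>\<Sum>l\<in>freqs N. Re ((field_coeff s N w l - field_coeff s N z l) * cnj (w l - z l))\<bar>
      \<le> 3 * R\<^sup>2 * (l2 N (\<lambda>l. w l - z l))\<^sup>2"
      unfolding w_def z_def by (intro field_coeff_diff_pairing R)
    also have "\<dots> \<le> 3 * R\<^sup>2 * ((a + b) / 2)\<^sup>2"
      using e by (intro mult_left_mono power_mono) auto
    finally show "\<bar>\<Sum>l\<in>freqs N. Re ((field_coeff s N w l - field_coeff s N z l) * cnj (w l - z l))\<bar>
      \<le> 3 * R\<^sup>2 * ((a + b) / 2)\<^sup>2" .
  qed auto
  finally have "(a - b) * (a + b) \<le> (\<bar>\<tau>\<bar> * (3 * R\<^sup>2) / 2 * (a + b)) * (a + b)"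
    by (simp add: power2_eq_square field_simps)
  moreover have "0 < a + b" using False ab by simp
  ultimately have "a - b \<le> \<bar>\<tau>\<bar> * (3 * R\<^sup>2) / 2 * (a + b)"
    by (rule mult_right_le_imp_le)
  then show ?thesis by simp
next
  case True
  moreover have "0 \<le> a" "0 \<le> b" by (auto simp: a_def b_def)
  ultimately show ?thesis by simp
qed

lemma l1_sq_le: "1 \<le> N \<Longrightarrow> (l1 N c)\<^sup>2 \<le> 3 * real N * (l2 N c)\<^sup>2"
  using power_mono[OF l1_le_l2', of N c 2] by (simp add: power_mult_distrib)

lemma midpoint_l2:
  assumes "midpoint_step s N \<tau> v v'"
  shows "l2 N (\<lambda>l. (v' l + v l) / 2) \<le> l2 N v"
proof -
  have "l2 N (\<lambda>l. (v' l + v l) / 2) = l2 N (\<lambda>l. (1/2) * (v' l + v l))" by simp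
  also have "\<dots> \<le> (1/2) * (l2 N v' + l2 N v)"
    unfolding l2_mult using l2_triangle[of N v' v] by simp
  finally show ?thesis using midpoint_step_l2[OF assms] by simp
qed

lemma midpoint_l1:
  assumes step: "midpoint_step s N \<tau> v v'" and N: "1 \<le> N"
    and cfl: "18 * (\<bar>\<tau>\<bar> * real N) * (l2 N v)\<^sup>2 \<le> 1"
  shows "l1 N (\<lambda>l. (v' l + v l) / 2) \<le> 2 * l1 N v" and "l1 N v' \<le> 5 * l1 N v"
proof -
  define w where "w = (\<lambda>l. (v' l + v l) / 2)"
  have "cmod (w l) \<le> cmod (v l + \<i> * of_real (\<tau> / 2) * cubic_coeff N w l)" if l: "l \<in> freqs N" for l
  proof -
    define a where "a = \<tau> / 2 * \<bar>of_int l\<bar> powr (2 * s)"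
    have "v' l = v l + of_real \<tau> * field_coeff s N w l"
      using step l by (auto simp: midpoint_step_def w_def)
    then have "w l = v l + of_real (\<tau> / 2) * field_coeff s N w l"
      by (simp add: w_def field_simps)
    then have "(1 + \<i> * of_real a) * w l = v l + \<i> * of_real (\<tau> / 2) * cubic_coeff N w l"
      by (simp add: field_coeff_def a_def algebra_simps)
    moreover have "cmod (w l) * 1 \<le> cmod (w l) * cmod (1 + \<i> * of_real a)"
      by (intro mult_left_mono) (auto simp: cmod_def)
    ultimately show ?thesis
      by (metis mult.commute mult.right_neutral norm_mult)
  qed
  then have "l1 N w \<le> l1 N (\<lambda>l. v l + \<i> * of_real (\<tau> / 2) * cubic_coeff N w l)"
    by (rule l1_mono)
  also have "\<dots> \<le> l1 N v + \<bar>\<tau> / 2\<bar> * l1 N (cubic_coeff N w)"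
    by (rule order_trans[OF l1_triangle]) (simp only: l1_mult, simp add: norm_mult)
  also have "\<dots> \<le> l1 N v + \<bar>\<tau> / 2\<bar> * (l1 N w) ^ 3"
    by (intro add_left_mono mult_left_mono l1_cubic_coeff) auto
  \<comment> \<open>Two of the three factors are bounded by the inverse inequality and
    \<open>midpoint_l2\<close>: 3 / 2 times 1 / 18 is 1 / 12. Solving for \<open>l1 N w\<close>
    gives the factor 12 / 11, rounded up to 2.\<close>
  also have "\<bar>\<tau> / 2\<bar> * (l1 N w) ^ 3 \<le> (1 / 12) * l1 N w"
  proof -
    have "(l1 N w)\<^sup>2 \<le> 3 * real N * (l2 N w)\<^sup>2" using N by (rule l1_sq_le)
    also have "\<dots> \<le> 3 * real N * (l2 N v)\<^sup>2"
      using midpoint_l2[OF step] by (intro mult_left_mono power_mono) (auto simp: w_def)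
    finally have "\<bar>\<tau>\<bar> * (l1 N w)\<^sup>2 \<le> \<bar>\<tau>\<bar> * (3 * real N * (l2 N v)\<^sup>2)"
      by (intro mult_left_mono) auto
    then have "\<bar>\<tau> / 2\<bar> * (l1 N w)\<^sup>2 \<le> 1 / 12" using cfl by (simp add: algebra_simps)
    then have "(\<bar>\<tau> / 2\<bar> * (l1 N w)\<^sup>2) * l1 N w \<le> 1 / 12 * l1 N w"
      by (intro mult_right_mono) auto
    then show ?thesis by (simp add: power3_eq_cube power2_eq_square mult.assoc)
  qed
  finally show w: "l1 N (\<lambda>l. (v' l + v l) / 2) \<le> 2 * l1 N v"
    using l1_nonneg[of N v] l1_nonneg[of N w] unfolding w_def by linarith
  have "l1 N v' = l1 N (\<lambda>l. 2 * w l + (-1) * v l)"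
    by (intro l1_cong) (simp add: w_def field_simps)
  also have "\<dots> \<le> 2 * l1 N w + l1 N v"
    using l1_triangle[of N "\<lambda>l. 2 * w l" "\<lambda>l. (-1) * v l"] unfolding l1_mult by simp
  finally show "l1 N v' \<le> 5 * l1 N v" using w by (simp add: w_def)
qed

text \<open>The a priori bound \<open>midpoint_l2\<close> holds for every solution, so uniqueness is
  global and not confined to a ball; the distance \<open>a\<close> of two solutions satisfies
  \<open>a \<le> a / 4\<close>.\<close>

lemma midpoint_step_unique:
  assumes v: "midpoint_step s N \<tau> v v'" and u: "midpoint_step s N \<tau> v u'" and N: "1 \<le> N"
    and cfl: "18 * (\<bar>\<tau>\<bar> * real N) * (l2 N v)\<^sup>2 \<le> 1"
    and l: "l \<in> freqs N"
  shows "v' l = u' l"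
proof -
  let ?R = "sqrt (3 * real N) * l2 N v"
  define a where "a = l2 N (\<lambda>l. v' l - u' l)"
  have R: "l1 N (\<lambda>l. (z l + v l) / 2) \<le> ?R" if "midpoint_step s N \<tau> v z" for z
    using midpoint_l2[OF that] by (intro order_trans[OF l1_le_l2'[OF N]] mult_left_mono) auto
  have "a \<le> 0 + \<bar>\<tau>\<bar> * (3 * ?R\<^sup>2) / 2 * (a + 0)"
    using midpoint_step_diff[OF v u R[OF v] R[OF u]] by (simp add: a_def l2_def L2_set_0')
  also have "\<dots> = (\<bar>\<tau>\<bar> * real N * (l2 N v)\<^sup>2) * (9 / 2 * a)"
    by (simp add: power_mult_distrib)
  also have "\<dots> \<le> (1 / 18) * (9 / 2 * a)"
    using cfl by (intro mult_right_mono) (auto simp: a_def)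
  finally have "a = 0" using l2_nonneg[of N "\<lambda>l. v' l - u' l"] by (simp add: a_def)
  then show ?thesis using l by (auto simp: a_def l2_eq_0_iff)
qed

text \<open>The difference estimate with one argument zero would give \<open>3 * R\<^sup>2\<close>;
  the smaller constant is what lets the fixed point map for a stage preserve a ball.\<close>

lemma l2_cubic_coeff:
  assumes "l1 N c \<le> R"
  shows "l2 N (cubic_coeff N c) \<le> R\<^sup>2 * l2 N c"
proof -
  have "(l2 N (cubic_coeff N c))\<^sup>2 \<le> mean_square (cubic (tp N c))"
    unfolding cubic_coeff_def by (intro bessel continuous_intros)
  also have "\<dots> \<le> mean_square (\<lambda>x. of_real (R\<^sup>2) * tp N c x)"
  proof (intro mean_square_mono continuous_intros)
    fix x
    have "cmod (tp N c x) \<le> R" using norm_tp_le[of N c x] assms by simp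
    then show "cmod (cubic (tp N c) x) \<le> cmod (of_real (R\<^sup>2) * tp N c x)"
      by (auto simp: cubic_def norm_mult norm_power intro!: mult_right_mono power_mono)
  qed
  also have "\<dots> = (R\<^sup>2 * l2 N c)\<^sup>2"
    by (simp add: mean_square_mult mean_square_tp power_mult_distrib norm_power)
  finally show ?thesis by (rule power2_le_imp_le) simp
qed

text \<open>\<open>l2 N\<close> is only a seminorm on families over \<open>int\<close>, so the
  Picard iterates from zero are followed coefficient by coefficient, and the fixed point equation
  holds on \<open>freqs N\<close>.\<close>

lemma l2_contraction_fixed_point:
  fixes \<Phi> :: "(int \<Rightarrow> complex) \<Rightarrow> int \<Rightarrow> complex"
  assumes r: "0 \<le> r" and q: "0 \<le> q" "q < 1"
    and self: "\<And>c. l2 N c \<le> r \<Longrightarrow> l2 N (\<Phi> c) \<le> r"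
    and contr: "\<And>c d. l2 N c \<le> r \<Longrightarrow> l2 N d \<le> r \<Longrightarrow>
      l2 N (\<lambda>l. \<Phi> c l - \<Phi> d l) \<le> q * l2 N (\<lambda>l. c l - d l)"
  shows "\<exists>c. l2 N c \<le> r \<and> (\<forall>l\<in>freqs N. \<Phi> c l = c l)"
proof -
  define X where "X n = (\<Phi> ^^ n) (\<lambda>_. 0)" for n
  have XS: "X (Suc n) = \<Phi> (X n)" for n by (simp add: X_def)
  have ball: "l2 N (X n) \<le> r" for n
  proof (induction n)
    case 0 show ?case using r by (simp add: X_def l2_def L2_set_0')
  qed (simp add: XS self)
  define D where "D = l2 N (\<lambda>l. X 1 l - X 0 l)"
  have diff: "l2 N (\<lambda>l. X (Suc n) l - X n l) \<le> q ^ n * D" for n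
  proof (induction n)
    case (Suc n)
    have "l2 N (\<lambda>l. X (Suc (Suc n)) l - X (Suc n) l) \<le> q * l2 N (\<lambda>l. X (Suc n) l - X n l)"
      unfolding XS[of "Suc n"] XS[of n] by (intro contr ball[unfolded XS] self ball)
    also have "\<dots> \<le> q * (q ^ n * D)" using Suc q by (intro mult_left_mono)
    finally show ?case by simp
  qed (simp add: D_def)
  have "convergent (\<lambda>n. X n l)" if "l \<in> freqs N" for l
  proof -
    have "summable (\<lambda>n. X (Suc n) l - X n l)"
    proof (rule summable_comparison_test')
      show "summable (\<lambda>n. q ^ n * D)" using q by (intro summable_mult2 summable_geometric) simp
      show "norm (X (Suc n) l - X n l) \<le> q ^ n * D" for n
        using norm_le_l2[OF that, of "\<lambda>l. X (Suc n) l - X n l"] diff[of n] by simp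
    qed
    then have "(\<lambda>n. (\<Sum>i<n. X (Suc i) l - X i l) + X 0 l) \<longlonglongrightarrow> (\<Sum>i. X (Suc i) l - X i l) + X 0 l"
      by (intro tendsto_intros summable_LIMSEQ)
    then show ?thesis
      by (auto simp: sum_lessThan_telescope[of "\<lambda>n. X n l"] convergent_def)
  qed
  then obtain c where c: "(\<lambda>n. X n l) \<longlonglongrightarrow> c l" if "l \<in> freqs N" for l
    unfolding convergent_def by metis
  have l2_lim: "(\<lambda>n. l2 N (\<lambda>l. X n l - d l)) \<longlonglongrightarrow> l2 N (\<lambda>l. c l - d l)" for d
    unfolding l2_def L2_set_def by (intro tendsto_intros c)
  have cr: "l2 N c \<le> r"
    using ball LIMSEQ_le_const2[OF l2_lim[of "\<lambda>_. 0"]] by auto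
  have "\<Phi> c l = c l" if l: "l \<in> freqs N" for l
  proof -
    have "(\<lambda>n. q * l2 N (\<lambda>l. X n l - c l)) \<longlonglongrightarrow> q * l2 N (\<lambda>l. c l - c l)"
      by (intro tendsto_intros l2_lim)
    then have lim: "(\<lambda>n. q * l2 N (\<lambda>l. X n l - c l)) \<longlonglongrightarrow> 0"
      by (simp add: l2_def L2_set_0')
    have "norm (X (Suc n) l - \<Phi> c l) \<le> q * l2 N (\<lambda>l. X n l - c l)" for n
      unfolding XS using norm_le_l2[OF l, of "\<lambda>l. \<Phi> (X n) l - \<Phi> c l"] contr[OF ball cr, of n] by simp
    then have "(\<lambda>n. X (Suc n) l - \<Phi> c l) \<longlonglongrightarrow> 0"
      by (intro Lim_null_comparison[OF _ lim] always_eventually allI)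
    then have "(\<lambda>n. X (Suc n) l) \<longlonglongrightarrow> \<Phi> c l"
      by (simp add: LIM_zero_iff)
    then show ?thesis
      using LIMSEQ_unique[OF LIMSEQ_Suc[OF c[OF l]]] by simp
  qed
  with cr show ?thesis by blast
qed

text \<open>The unknown is the midpoint \<open>w\<close>: dividing its equation by
  \<open>1 + \<i> * of_real (a l)\<close> leaves a map whose Lipschitz constant comes from the cubic
  term alone.\<close>

lemma midpoint_step_exists:
  assumes N: "1 \<le> N" and cfl: "18 * (\<bar>\<tau>\<bar> * real N) * (l2 N v)\<^sup>2 \<le> 1"
  shows "\<exists>v'. midpoint_step s N \<tau> v v'"
proof -
  \<comment> \<open>Larger than the norm of \<open>v\<close>, to leave room for the cubic term. Then
    3 * (5/4)^2 / 18 = 25/96 in \<open>small\<close>; the ball is mapped into itself because 4/5 +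
    25/192 < 1, and the contraction factor 25/96 * 3/2 is below 1/2.\<close>
  define r where "r = 5 / 4 * l2 N v"
  define a where "a l = \<tau> / 2 * \<bar>of_int l\<bar> powr (2 * s)" for l :: int
  define m where "m l = 1 / (1 + \<i> * of_real (a l))" for l
  have m: "cmod (m l) \<le> 1" for l
  proof -
    have "1 \<le> cmod (1 + \<i> * of_real (a l))" by (simp add: cmod_def)
    then show ?thesis by (auto simp: m_def norm_divide divide_le_eq_1)
  qed
  have am: "1 + \<i> * of_real (a l) \<noteq> 0" for l
    by (auto simp: complex_eq_iff)
  define \<Phi> where "\<Phi> w l = m l * (v l + \<i> * of_real (\<tau> / 2) * cubic_coeff N w l)" for w l
  have small: "\<bar>\<tau>\<bar> * (3 * real N * r\<^sup>2) \<le> 25 / 96"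
    using cfl by (simp add: r_def power_mult_distrib power2_eq_square field_simps)
  have l1r: "l1 N c \<le> sqrt (3 * real N) * r" if "l2 N c \<le> r" for c
    using that by (intro order_trans[OF l1_le_l2'[OF N]] mult_left_mono) auto
  have "\<exists>w. l2 N w \<le> r \<and> (\<forall>l\<in>freqs N. \<Phi> w l = w l)"
  proof (rule l2_contraction_fixed_point)
    show "0 \<le> r" "0 \<le> (1/2::real)" "(1/2::real) < 1" by (auto simp: r_def)
    fix c d assume c: "l2 N c \<le> r"
    have "l2 N (\<Phi> c) \<le> l2 N (\<lambda>l. v l + \<i> * of_real (\<tau> / 2) * cubic_coeff N c l)"
      unfolding \<Phi>_def by (intro l2_mono) (auto simp: norm_mult intro!: mult_left_le_one_le m)
    also have "\<dots> \<le> l2 N v + \<bar>\<tau> / 2\<bar> * l2 N (cubic_coeff N c)"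
      by (rule order_trans[OF l2_triangle]) (simp only: l2_mult, simp add: norm_mult)
    also have "\<dots> \<le> l2 N v + \<bar>\<tau> / 2\<bar> * ((sqrt (3 * real N) * r)\<^sup>2 * l2 N c)"
      using c by (intro add_left_mono mult_left_mono l2_cubic_coeff l1r) auto
    also have "\<dots> \<le> l2 N v + \<bar>\<tau> / 2\<bar> * ((sqrt (3 * real N) * r)\<^sup>2 * r)"
      using c by (intro add_left_mono mult_left_mono) auto
    also have "\<dots> = l2 N v + (\<bar>\<tau>\<bar> * (3 * real N * r\<^sup>2)) * (1 / 2 * r)"
      by (simp add: power_mult_distrib)
    also have "\<dots> \<le> l2 N v + 25 / 96 * (1 / 2 * r)"
      using small by (intro add_left_mono mult_right_mono) (auto simp: r_def)
    also have "\<dots> \<le> r"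
      using l2_nonneg[of N v] unfolding r_def by linarith
    finally show "l2 N (\<Phi> c) \<le> r" .
    assume d: "l2 N d \<le> r"
    have "l2 N (\<lambda>l. \<Phi> c l - \<Phi> d l) =
       l2 N (\<lambda>l. m l * (\<i> * of_real (\<tau> / 2) * (cubic_coeff N c l - cubic_coeff N d l)))"
      by (intro l2_cong) (simp add: \<Phi>_def algebra_simps)
    also have "\<dots> \<le> l2 N (\<lambda>l. \<i> * of_real (\<tau> / 2) * (cubic_coeff N c l - cubic_coeff N d l))"
      by (intro l2_mono) (auto simp: norm_mult intro!: mult_left_le_one_le m)
    also have "\<dots> = \<bar>\<tau> / 2\<bar> * l2 N (\<lambda>l. cubic_coeff N c l - cubic_coeff N d l)"
      by (simp only: l2_mult) (simp add: norm_mult)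
    also have "\<dots> \<le> \<bar>\<tau> / 2\<bar> * (3 * (sqrt (3 * real N) * r)\<^sup>2 * l2 N (\<lambda>l. c l - d l))"
      using c d by (intro mult_left_mono l2_cubic_coeff_diff l1r) auto
    also have "\<dots> = (\<bar>\<tau>\<bar> * (3 * real N * r\<^sup>2)) * (3 / 2 * l2 N (\<lambda>l. c l - d l))"
      by (simp add: power_mult_distrib)
    also have "\<dots> \<le> 25 / 96 * (3 / 2 * l2 N (\<lambda>l. c l - d l))"
      using small by (intro mult_right_mono) auto
    finally show "l2 N (\<lambda>l. \<Phi> c l - \<Phi> d l) \<le> 1 / 2 * l2 N (\<lambda>l. c l - d l)"
      using l2_nonneg[of N "\<lambda>l. c l - d l"] by linarith
  qed
  then obtain w where w: "\<And>l. l \<in> freqs N \<Longrightarrow> \<Phi> w l = w l" by blast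
  have "midpoint_step s N \<tau> v (\<lambda>l. 2 * w l - v l)"
    unfolding midpoint_step_def
  proof
    fix l assume l: "l \<in> freqs N"
    have "(1 + \<i> * of_real (a l)) * m l = 1"
      using am[of l] by (simp add: m_def)
    then have "(1 + \<i> * of_real (a l)) * \<Phi> w l = v l + \<i> * of_real (\<tau> / 2) * cubic_coeff N w l"
      unfolding \<Phi>_def mult.assoc[symmetric] by simp
    then have "(1 + \<i> * of_real (a l)) * w l = v l + \<i> * of_real (\<tau> / 2) * cubic_coeff N w l"
      by (simp only: w[OF l])
    then have "2 * ((1 + \<i> * of_real (a l)) * w l) = 2 * (v l + \<i> * of_real (\<tau> / 2) * cubic_coeff N w l)"
      by simp
    then have "2 * w l - v l = v l + of_real \<tau> * field_coeff s N w l"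
      by (simp add: field_coeff_def a_def algebra_simps)
    then show "2 * w l - v l = v l + of_real \<tau> * field_coeff s N (\<lambda>l. (2 * w l - v l + v l) / 2) l"
      by simp
  qed
  then show ?thesis by blast
qed

subsection \<open>The semidiscrete equation\<close>

lemma sum_cis_roots_of_unity:
  fixes m :: int and n :: nat
  assumes "\<bar>m\<bar> < int n"
  shows "(\<Sum>j<n. cis (of_int m * (2 * pi * real j / real n))) = (if m = 0 then of_nat n else 0)"
proof (cases "m = 0")
  case False
  define z where "z = cis (of_int m * (2 * pi) / real n)"
  have n: "0 < n" using assms by auto
  have "z \<noteq> 1"
  proof
    assume "z = 1"
    then obtain i :: int where "of_int m * (2 * pi) / real n = of_int i * (2 * pi)"
      using sin_cos_eq_iff[of "of_int m * (2 * pi) / real n" 0]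
      by (auto simp: z_def complex_eq_iff mult.commute)
    then have "of_int m = (of_int i * real n)" using n by (simp add: field_simps)
    then have m: "m = i * int n" by (metis of_int_eq_iff of_int_mult of_int_of_nat_eq)
    with False have "1 \<le> \<bar>i\<bar>" by (cases "i = 0") auto
    then have "1 * int n \<le> \<bar>i\<bar> * int n" by (intro mult_right_mono) auto
    with assms m show False by (simp add: abs_mult)
  qed
  moreover have "z ^ n = 1"
    using n cis_multiple_2pi[of "of_int m"] by (simp add: z_def Complex.DeMoivre mult.commute)
  ultimately have "(\<Sum>j<n. z ^ j) = 0"
    by (simp add: geometric_sum)
  moreover have "cis (of_int m * (2 * pi * real j / real n)) = z ^ j" for j
    by (simp add: z_def Complex.DeMoivre field_simps)
  ultimately show ?thesis using False by simp
qed simp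

text \<open>Two frequencies of \<open>freqs N\<close> differ by at most \<open>2 * N\<close>, less
  than the number of equispaced nodes, so there is no aliasing.\<close>

lemma tp_discrete_inversion:
  fixes N :: nat
  defines "n \<equiv> 2 * N + 1"
  assumes l: "l \<in> freqs N"
  shows "(\<Sum>j<n. tp N c (2 * pi * real j / real n) * cis (- of_int l * (2 * pi * real j / real n))) = of_nat n * c l"
proof -
  have shift: "c m * cis (of_int m * y) * cis (- of_int l * y) = c m * cis (of_int (m - l) * y)" for m y
    by (simp add: cis_mult algebra_simps)
  have "(\<Sum>j<n. tp N c (2 * pi * real j / real n) * cis (- of_int l * (2 * pi * real j / real n)))
    = (\<Sum>j<n. \<Sum>m\<in>freqs N. c m * cis (of_int (m - l) * (2 * pi * real j / real n)))"
    unfolding tp_def sum_distrib_right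
    by (simp only: shift)
  also have "\<dots> = (\<Sum>m\<in>freqs N. c m * (\<Sum>j<n. cis (of_int (m - l) * (2 * pi * real j / real n))))"
    by (subst sum.swap) (simp only: sum_distrib_left)
  also have "\<dots> = (\<Sum>m\<in>freqs N. c m * (if m - l = 0 then of_nat n else 0))"
    using l by (intro sum.cong refl, subst sum_cis_roots_of_unity) (auto simp: n_def)
  also have "\<dots> = of_nat n * c l"
    using l by (simp add: if_distrib cong: if_cong)
  finally show ?thesis .
qed

text \<open>By discrete inversion, the coefficients of a trigonometric polynomial are fixed linear
  combinations of finitely many point values, so pointwise differentiability suffices.\<close>

lemma trig_poly_coeff_has_vector_derivative:
  assumes v: "\<And>r. r \<in> S \<Longrightarrow> v r \<in> trig_polys N"
    and d: "\<And>x. ((\<lambda>r. v r x) has_vector_derivative tp N d x) (at t within S)"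
    and t: "t \<in> S" and l: "l \<in> freqs N"
  shows "((\<lambda>r. fourier_coeff (v r) l) has_vector_derivative d l) (at t within S)"
proof -
  define n where "n = 2 * N + 1"
  define x where "x j = 2 * pi * real j / real n" for j
  have "n \<noteq> 0" by (simp add: n_def)
  then have n: "of_nat n \<noteq> (0::complex)" by simp
  have "((\<lambda>r. \<Sum>j<n. v r (x j) * cis (- of_int l * x j)) has_vector_derivative
      (\<Sum>j<n. tp N d (x j) * cis (- of_int l * x j))) (at t within S)"
    by (intro has_vector_derivative_sum has_vector_derivative_mult_left d)
  then have "((\<lambda>r. (1 / of_nat n) * (\<Sum>j<n. v r (x j) * cis (- of_int l * x j))) has_vector_derivative
      (1 / of_nat n) * (\<Sum>j<n. tp N d (x j) * cis (- of_int l * x j))) (at t within S)"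
    by (rule has_vector_derivative_mult_right)
  moreover have "(1 / of_nat n) * (\<Sum>j<n. tp N d (x j) * cis (- of_int l * x j)) = d l"
    using tp_discrete_inversion[OF l, of d] n by (simp add: n_def x_def)
  moreover have "fourier_coeff (v r) l = (1 / of_nat n) * (\<Sum>j<n. v r (x j) * cis (- of_int l * x j))"
    if "r \<in> S" for r
  proof -
    have "v r = tp N (fourier_coeff (v r))" using v[OF that] by (simp add: trig_polys_iff)
    then have "(\<Sum>j<n. v r (x j) * cis (- of_int l * x j)) = of_nat n * fourier_coeff (v r) l"
      using tp_discrete_inversion[OF l, of "fourier_coeff (v r)"] by (simp add: n_def x_def)
    then show ?thesis using n by simp
  qed
  ultimately show ?thesis
    using t by (auto intro: has_vector_derivative_transform)
qed

section \<open>Energy, Gronwall and continuation\<close>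

lemma l2_sq_has_real_derivative:
  assumes "\<And>l. l \<in> freqs N \<Longrightarrow> ((\<lambda>t. e t l) has_vector_derivative d l) (at t within S)"
  shows "((\<lambda>t. (l2 N (e t))\<^sup>2) has_real_derivative 2 * (\<Sum>l\<in>freqs N. Re (d l * cnj (e t l)))) (at t within S)"
proof -
  have "((\<lambda>t. (cmod (e t l))\<^sup>2) has_real_derivative 2 * Re (d l * cnj (e t l))) (at t within S)"
    if l: "l \<in> freqs N" for l
  proof -
    have "((\<lambda>t. Re (e t l)) has_real_derivative Re (d l)) (at t within S)"
      "((\<lambda>t. Im (e t l)) has_real_derivative Im (d l)) (at t within S)"
      using bounded_linear.has_vector_derivative[OF bounded_linear_Re assms[OF l]]
        bounded_linear.has_vector_derivative[OF bounded_linear_Im assms[OF l]]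
      by (simp_all add: has_real_derivative_iff_has_vector_derivative)
    then show ?thesis
      unfolding cmod_power2
      by (rule DERIV_cong[OF DERIV_add[OF DERIV_power DERIV_power]]) (simp add: algebra_simps)
  qed
  then show ?thesis
    unfolding l2_sq sum_distrib_left by (intro DERIV_sum) auto
qed

text \<open>The differential inequality is assumed up to \<tau>, while derivatives are taken within
  \<open>{0..T}\<close>: in a continuation argument the bounds behind the inequality are known only
  up to the current time.\<close>

lemma gronwall:
  fixes y :: "real \<Rightarrow> real"
  assumes \<tau>: "0 \<le> \<tau>" "\<tau> \<le> T"
    and y: "\<And>t. t \<in> {0..T} \<Longrightarrow> (y has_real_derivative y' t) (at t within {0..T})"
    and le: "\<And>t. t \<in> {0..\<tau>} \<Longrightarrow> y' t \<le> \<kappa> * y t"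
  shows "y \<tau> \<le> y 0 * exp (\<kappa> * \<tau>)"
proof -
  have "y 0 * exp (- \<kappa> * 0) \<ge> y \<tau> * exp (- \<kappa> * \<tau>)"
  proof (rule DERIV_nonpos_imp_decreasing_open[OF \<tau>(1), of "\<lambda>t. y t * exp (- \<kappa> * t)"])
    fix t assume t: "0 < t" "t < \<tau>"
    then have "(y has_real_derivative y' t) (at t)"
      using y[of t] \<tau> by (simp add: at_within_Icc_at)
    then have "((\<lambda>t. y t * exp (- \<kappa> * t)) has_real_derivative (y' t - \<kappa> * y t) * exp (- \<kappa> * t)) (at t)"
      by (auto intro!: derivative_eq_intros simp: algebra_simps)
    moreover have "(y' t - \<kappa> * y t) * exp (- \<kappa> * t) \<le> 0"
      using le[of t] t by (intro mult_nonpos_nonneg) auto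
    ultimately show "\<exists>z. ((\<lambda>t. y t * exp (- \<kappa> * t)) has_real_derivative z) (at t) \<and> z \<le> 0"
      by blast
  next
    have "continuous_on {0..T} y"
      unfolding continuous_on_eq_continuous_within using y DERIV_continuous by blast
    then show "continuous_on {0..\<tau>} (\<lambda>t. y t * exp (- \<kappa> * t))"
      using \<tau> by (intro continuous_intros) (auto elim: continuous_on_subset)
  qed
  then show ?thesis by (simp add: exp_minus field_simps)
qed

text \<open>At the first time where \<open>\<phi>\<close> reaches \<open>R\<close>, the intermediate
  value theorem gives the weak bound up to and including that time, and \<open>step\<close> upgrades
  it to a strict one, a contradiction.\<close>

lemma continuity_bootstrap:
  fixes \<phi> :: "real \<Rightarrow> real"
  assumes cont: "continuous_on {0..T} \<phi>" and init: "\<phi> 0 < R"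
    and step: "\<And>t. t \<in> {0..T} \<Longrightarrow> (\<And>r. r \<in> {0..t} \<Longrightarrow> \<phi> r \<le> R) \<Longrightarrow> \<phi> t < R"
    and t: "t \<in> {0..T}"
  shows "\<phi> t < R"
proof (rule ccontr)
  assume "\<not> \<phi> t < R"
  define A where "A = {r \<in> {0..T}. R \<le> \<phi> r}"
  have "A \<noteq> {}" using t \<open>\<not> \<phi> t < R\<close> by (auto simp: A_def)
  have "closed A"
    unfolding A_def using continuous_on_closed_Collect_le[OF continuous_on_const cont] by simp
  have bdd: "bdd_below A" by (auto simp: A_def bdd_below_def)
  define r0 where "r0 = Inf A"
  have r0: "r0 \<in> A"
    unfolding r0_def using \<open>A \<noteq> {}\<close> bdd \<open>closed A\<close> by (rule closed_contains_Inf)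
  have below: "\<phi> r < R" if "r \<in> {0..<r0}" for r
  proof (rule ccontr)
    assume "\<not> \<phi> r < R"
    then have "r \<in> A" using that r0 by (auto simp: A_def)
    then have "r0 \<le> r" unfolding r0_def using bdd by (intro cInf_lower)
    with that show False by simp
  qed
  have "r0 > 0" using r0 init by (cases "r0 = 0") (auto simp: A_def)
  have "\<phi> r0 \<le> R"
  proof (rule ccontr)
    assume gt: "\<not> \<phi> r0 \<le> R"
    have "continuous_on {0..r0} \<phi>" using r0 by (intro continuous_on_subset[OF cont]) (auto simp: A_def)
    then obtain r where "0 \<le> r" "r \<le> r0" "\<phi> r = R"
      using IVT'[of \<phi> 0 R r0] init gt r0 by (auto simp: A_def)
    with below[of r] gt show False by (cases "r = r0") auto
  qed
  then have "\<phi> r \<le> R" if "r \<in> {0..r0}" for r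
    using below[of r] that by (cases "r = r0") auto
  then have "\<phi> r0 < R" using r0 by (intro step) (auto simp: A_def)
  with r0 show False by (simp add: A_def)
qed

lemma semidiscrete_coeff_ode:
  assumes v: "semidiscrete_solution s N T u0 v" and t: "t \<in> {0..T}" and l: "l \<in> freqs N"
  shows "((\<lambda>r. fourier_coeff (v r) l) has_vector_derivative
    field_coeff s N (fourier_coeff (v t)) l) (at t within {0..T})"
proof -
  have "v t = tp N (fourier_coeff (v t))"
    using v t by (simp add: semidiscrete_solution_def trig_polys_iff)
  then have "rhs_F s N (v t) = tp N (field_coeff s N (fourier_coeff (v t)))"
    by (metis rhs_F_tp)
  moreover have "((\<lambda>r. v r x) has_vector_derivative rhs_F s N (v t) x) (at t within {0..T})" for x
    using v t unfolding semidiscrete_solution_def by blast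
  ultimately show ?thesis
    using v t l by (intro trig_poly_coeff_has_vector_derivative) (auto simp: semidiscrete_solution_def)
qed

lemma semidiscrete_l2_le:
  assumes v: "semidiscrete_solution s N T u0 v" and t: "t \<in> {0..T}"
  shows "l2 N (fourier_coeff (v t)) \<le> l2 N (fourier_coeff u0)"
proof -
  define c where "c t = fourier_coeff (v t)" for t
  \<comment> \<open>Gronwall with rate 0: \<open>field_coeff_skew\<close> makes the derivative
    vanish.\<close>
  have "(l2 N (c t))\<^sup>2 \<le> (l2 N (c 0))\<^sup>2 * exp (0 * t)"
  proof (rule gronwall[where T = T])
    show "((\<lambda>t. (l2 N (c t))\<^sup>2) has_real_derivative
        2 * (\<Sum>l\<in>freqs N. Re (field_coeff s N (c r) l * cnj (c r l)))) (at r within {0..T})"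
      if "r \<in> {0..T}" for r
      using semidiscrete_coeff_ode[OF v that]
      by (intro l2_sq_has_real_derivative) (auto simp: c_def)
  qed (use t in \<open>auto simp only: field_coeff_skew atLeastAtMost_iff\<close>)
  moreover have "l2 N (c 0) = l2 N (fourier_coeff u0)"
    using v by (intro l2_cong) (auto simp: c_def semidiscrete_solution_def fourier_proj_eq fourier_coeff_tp)
  ultimately show ?thesis
    by (simp add: c_def power2_le_iff_abs_le)
qed

subsection \<open>Fourier analysis in Sobolev spaces\<close>

lemma tp_extend:
  assumes "N \<le> M"
  shows "tp N c = tp M (\<lambda>l. if l \<in> freqs N then c l else 0)"
proof
  fix x
  show "tp N c x = tp M (\<lambda>l. if l \<in> freqs N then c l else 0) x"
    unfolding tp_def using assms by (intro sum.mono_neutral_cong_left) auto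
qed

text \<open>The union over all degrees is an algebra; a single \<open>trig_polys N\<close> with
  \<open>N \<ge> 1\<close> is not closed under products.\<close>

definition all_trig_polys :: "(real \<Rightarrow> complex) set" where
  "all_trig_polys = (\<Union>N. trig_polys N)"

lemma tp_in_all [simp]: "tp N c \<in> all_trig_polys"
  unfolding all_trig_polys_def using tp_in_trig_polys by blast

lemma all_trig_polysE:
  assumes "f \<in> all_trig_polys"
  obtains N c where "f = tp N c"
  using assms by (auto simp: all_trig_polys_def trig_polys_iff)

lemma all_trig_polys_add:
  assumes "f \<in> all_trig_polys" "g \<in> all_trig_polys"
  shows "(\<lambda>x. f x + g x) \<in> all_trig_polys"
proof -
  obtain N c M d where f: "f = tp N c" "g = tp M d"
    using assms by (elim all_trig_polysE)
  then have "(\<lambda>x. f x + g x) = tp (max N M)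
     (\<lambda>l. (if l \<in> freqs N then c l else 0) + (if l \<in> freqs M then d l else 0))"
    by (simp only: tp_extend[of N "max N M"] tp_extend[of M "max N M"] max.cobounded1 max.cobounded2 tp_add)
  then show ?thesis by (metis tp_in_all)
qed

lemma all_trig_polys_mult_left: "f \<in> all_trig_polys \<Longrightarrow> (\<lambda>x. a * f x) \<in> all_trig_polys"
  by (erule all_trig_polysE) (simp add: tp_mult)

lemma all_trig_polys_cis: "(\<lambda>x. cis (of_int l * x)) \<in> all_trig_polys"
proof -
  have "(\<lambda>x. cis (of_int l * x)) = tp (nat \<bar>l\<bar>) (\<lambda>m. if m = l then 1 else 0)"
    by (rule ext) (auto simp: tp_def if_distrib[of "\<lambda>a. a * _"] cong: if_cong)
  then show ?thesis by simp
qed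

lemma all_trig_polys_const: "(\<lambda>x. a) \<in> all_trig_polys"
  using all_trig_polys_mult_left[OF all_trig_polys_cis[of 0], of a] by simp

lemma all_trig_polys_sum:
  assumes "finite A" "\<And>a. a \<in> A \<Longrightarrow> f a \<in> all_trig_polys"
  shows "(\<lambda>x. \<Sum>a\<in>A. f a x) \<in> all_trig_polys"
  using assms by (induction A rule: finite_induct) (auto intro: all_trig_polys_const all_trig_polys_add)

lemma all_trig_polys_mult:
  assumes "f \<in> all_trig_polys" "g \<in> all_trig_polys"
  shows "(\<lambda>x. f x * g x) \<in> all_trig_polys"
proof -
  obtain N c M d where f: "f = tp N c" "g = tp M d"
    using assms by (elim all_trig_polysE)
  have "(\<lambda>x. f x * g x) = (\<lambda>x. \<Sum>i\<in>freqs N. \<Sum>j\<in>freqs M. c i * d j * cis (of_int (i + j) * x))"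
  proof
    fix x
    have "f x * g x = (\<Sum>i\<in>freqs N. \<Sum>j\<in>freqs M. (c i * cis (of_int i * x)) * (d j * cis (of_int j * x)))"
      by (simp add: f tp_def sum_product)
    also have "\<dots> = (\<Sum>i\<in>freqs N. \<Sum>j\<in>freqs M. c i * d j * cis (of_int (i + j) * x))"
      by (intro sum.cong refl) (simp add: distrib_right cis_mult[symmetric])
    finally show "f x * g x = (\<Sum>i\<in>freqs N. \<Sum>j\<in>freqs M. c i * d j * cis (of_int (i + j) * x))" .
  qed
  then show ?thesis
    by (simp only:) (intro all_trig_polys_sum all_trig_polys_mult_left all_trig_polys_cis finite_atLeastAtMost_int)
qed

text \<open>A real linear form at \<open>cis x\<close> is a combination of \<open>cos x\<close> and
  \<open>sin x\<close>, hence of two characters; sums and products stay inside the algebra.\<close>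

lemma real_polynomial_function_cis:
  assumes "real_polynomial_function g"
  shows "(\<lambda>x. of_real (g (cis x))) \<in> all_trig_polys"
  using assms
proof (induction rule: real_polynomial_function.induct)
  case (linear f)
  have "f (cis x) = cos x * f 1 + sin x * f \<i>" for x
  proof -
    have "cis x = cos x *\<^sub>R 1 + sin x *\<^sub>R \<i>" by (simp add: complex_eq_iff)
    then show ?thesis
      using linear by (simp add: linear_simps bounded_linear.linear)
  qed
  moreover have "complex_of_real (cos x) = (cis (of_int 1 * x) + cis (of_int (-1) * x)) / 2"
    "complex_of_real (sin x) = - (\<i> / 2) * (cis (of_int 1 * x) - cis (of_int (-1) * x))" for x
    by (auto simp: complex_eq_iff Re_divide Im_divide)
  ultimately have "complex_of_real (f (cis x)) =
     (of_real (f 1) / 2 - \<i> / 2 * of_real (f \<i>)) * cis (of_int 1 * x) +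
     (of_real (f 1) / 2 + \<i> / 2 * of_real (f \<i>)) * cis (of_int (-1) * x)" for x
    by (simp only: of_real_add of_real_mult) (simp add: algebra_simps add_divide_distrib diff_divide_distrib)
  then show ?case
    by (simp only:) (intro all_trig_polys_add all_trig_polys_mult_left all_trig_polys_cis)
next
  case (const c)
  then show ?case by (rule all_trig_polys_const)
next
  case (add f g)
  then show ?case by (simp add: all_trig_polys_add)
next
  case (mult f g)
  then show ?case by (simp add: all_trig_polys_mult)
qed

lemma periodic_2pi_cis_eq:
  assumes "periodic_2pi f" "cis x = cis y"
  shows "f x = f y"
proof -
  have "sin x = sin y \<and> cos x = cos y"
    using assms(2) by (simp add: complex_eq_iff)
  then obtain n :: int where n: "x = y + 2 * pi * n"
    by (auto simp: sin_cos_eq_iff)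
  have "f (y + 2 * pi * real m) = f y" for m y
  proof (induction m)
    case (Suc m)
    have "f (y + 2 * pi * real (Suc m)) = f ((y + 2 * pi * real m) + 2 * pi)"
      by (simp add: algebra_simps)
    also have "\<dots> = f y" using assms(1) Suc by (simp only: periodic_2pi_def)
    finally show ?case .
  qed simp
  note shift = this
  show ?thesis
  proof (cases "0 \<le> n")
    case True
    then show ?thesis using shift[of y "nat n"] n by simp
  next
    case False
    then have "y = x + 2 * pi * real (nat (- n))" using n by simp
    then show ?thesis using shift[of x "nat (- n)"] by simp
  qed
qed

text \<open>A periodic function is a function \<open>F\<close> on the unit circle, where
  Stone-Weierstrass applies.\<close>

lemma periodic_trig_approx:
  assumes cont: "continuous_on UNIV f" and per: "periodic_2pi f" and e: "0 < e"
  obtains N c where "\<And>x. cmod (f x - tp N c x) < e"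
proof -
  define F where "F z = f (Arg z)" for z
  have F2: "F z = f (Arg2pi z)" if "z \<noteq> 0" for z
    unfolding F_def
  proof (rule periodic_2pi_cis_eq[OF per])
    have "of_real (cmod z) * cis (Arg z) = of_real (cmod z) * cis (Arg2pi z)"
      using Arg_eq[OF that] Arg2pi[of z] by (simp add: is_Arg_def cis_conv_exp)
    then show "cis (Arg z) = cis (Arg2pi z)" using that by simp
  qed
  have isf: "isCont f x" for x
    using cont by (simp add: continuous_on_eq_continuous_at)
  \<comment> \<open>\<open>Arg\<close> jumps across the negative real axis and \<open>Arg2pi\<close>
    across the positive one. By periodicity \<open>F\<close> is given by either, so each point of
    the circle has a branch that is continuous there.\<close>
  have "continuous_on (sphere 0 1) F"
  proof (rule continuous_at_imp_continuous_on, rule ballI)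
    fix z :: complex assume z: "z \<in> sphere 0 1"
    show "isCont F z"
    proof (cases "z \<in> \<real>\<^sub>\<le>\<^sub>0")
      case False
      show ?thesis unfolding F_def
        by (rule isCont_o2[OF continuous_at_Arg[OF False] isf])
    next
      case True
      with z have "z \<notin> \<real>\<^sub>\<ge>\<^sub>0"
        by (auto simp: complex_nonpos_Reals_iff complex_nonneg_Reals_iff cmod_def)
      from isCont_o2[OF continuous_at_Arg2pi[OF this] isf]
      have "isCont (\<lambda>z. f (Arg2pi z)) z" .
      moreover have "z \<noteq> 0" using z by auto
      then have "eventually (\<lambda>w. f (Arg2pi w) = F w) (nhds z)"
        by (rule t1_space_nhds[THEN eventually_mono]) (simp add: F2)
      ultimately show ?thesis by (simp add: isCont_cong)
    qed
  qed
  from Stone_Weierstrass_polynomial_function[OF compact_sphere this e]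
  obtain g where g: "polynomial_function g" "\<forall>z\<in>sphere 0 1. norm (F z - g z) < e" by metis
  have "real_polynomial_function (Re \<circ> g)" "real_polynomial_function (Im \<circ> g)"
    using g(1) bounded_linear_Re bounded_linear_Im by (auto simp: polynomial_function_def)
  then have "(\<lambda>x. of_real (Re (g (cis x)))) \<in> all_trig_polys" "(\<lambda>x. of_real (Im (g (cis x)))) \<in> all_trig_polys"
    using real_polynomial_function_cis by fastforce+
  then have "(\<lambda>x. of_real (Re (g (cis x))) + \<i> * of_real (Im (g (cis x)))) \<in> all_trig_polys"
    by (intro all_trig_polys_add all_trig_polys_mult_left)
  then obtain N c where Nc: "(\<lambda>x. of_real (Re (g (cis x))) + \<i> * of_real (Im (g (cis x)))) = tp N c"
    by (elim all_trig_polysE)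
  have "g (cis x) = tp N c x" for x
    using fun_cong[OF Nc, of x] by (simp add: complex_eq[symmetric])
  moreover have "F (cis x) = f x" for x
    unfolding F_def by (rule periodic_2pi_cis_eq[OF per]) (simp add: cis_Arg sgn_div_norm)
  moreover have "norm (F (cis x) - g (cis x)) < e" for x
    using g(2) by (auto simp: dist_norm)
  ultimately show thesis
    using that[of N c] by simp
qed

section \<open>Parseval's identity and its consequences\<close>

lemma mean_square_le:
  assumes "continuous_on UNIV f" "\<And>x. x \<in> {-pi..pi} \<Longrightarrow> cmod (f x) \<le> B"
  shows "mean_square f \<le> B\<^sup>2"
proof -
  have "0 \<le> B" using assms(2)[of 0] norm_ge_zero[of "f 0"] by (simp del: norm_ge_zero)
  then have "mean_square f \<le> mean_square (\<lambda>x. of_real B)"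
    using assms by (intro mean_square_mono continuous_intros) auto
  also have "\<dots> = B\<^sup>2" by (simp add: mean_square_def power2_eq_square)
  finally show ?thesis .
qed

lemma mean_square_remainder:
  assumes "continuous_on UNIV f"
  shows "mean_square (\<lambda>x. f x - tp N (fourier_coeff f) x) = mean_square f - (l2 N (fourier_coeff f))\<^sup>2"
  using mean_square_minus_tp[OF assms, of N "fourier_coeff f"] by (simp add: l2_sq)

lemma l2_mono_freqs: "N \<le> M \<Longrightarrow> (l2 N c)\<^sup>2 \<le> (l2 M c)\<^sup>2"
  unfolding l2_sq by (intro sum_mono2) auto

text \<open>Truncation is the best mean-square approximation of its degree, so one uniform
  approximant makes the remainder small at its own degree. The partial sums increase and are bounded
  by \<open>mean_square f\<close>, so it stays small afterwards.\<close>

lemma parseval_limit: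
  assumes cont: "continuous_on UNIV f" and per: "periodic_2pi f"
  shows "(\<lambda>N. (l2 N (fourier_coeff f))\<^sup>2) \<longlonglongrightarrow> mean_square f"
proof (rule LIMSEQ_I)
  fix e :: real assume e: "0 < e"
  obtain N c where Nc: "\<And>x. cmod (f x - tp N c x) < sqrt (e / 2)"
    using periodic_trig_approx[OF cont per, of "sqrt (e / 2)"] e by auto
  have "mean_square (\<lambda>x. f x - tp N c x) \<le> (sqrt (e / 2))\<^sup>2"
    using Nc cont by (intro mean_square_le continuous_intros) (auto intro: less_imp_le)
  then have "mean_square f - (l2 N (fourier_coeff f))\<^sup>2 + (l2 N (\<lambda>l. fourier_coeff f l - c l))\<^sup>2 \<le> e / 2"
    using e by (simp add: mean_square_minus_tp[OF cont])
  then have "mean_square f - (l2 N (fourier_coeff f))\<^sup>2 < e"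
    using e zero_le_power2[of "l2 N (\<lambda>l. fourier_coeff f l - c l)"] by linarith
  then have "norm ((l2 M (fourier_coeff f))\<^sup>2 - mean_square f) < e" if "N \<le> M" for M
    unfolding real_norm_def abs_less_iff
    using l2_mono_freqs[OF that, of "fourier_coeff f"] bessel[OF cont, of M] e by linarith
  then show "\<exists>no. \<forall>n\<ge>no. norm ((l2 n (fourier_coeff f))\<^sup>2 - mean_square f) < e" by blast
qed

lemma mean_square_eq_0:
  assumes cont: "continuous_on UNIV f" and 0: "mean_square f \<le> 0" and x: "x \<in> {-pi..pi}"
  shows "f x = 0"
proof -
  have c: "continuous_on UNIV (\<lambda>x. (cmod (f x))\<^sup>2)" using cont by (intro continuous_intros)
  have "mean_square f = 1 / (2 * pi) * (LINT x:{-pi..pi}|lborel. (cmod (f x))\<^sup>2)"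
    unfolding mean_square_def complex_norm_square[symmetric] avg_of_real by simp
  then have "(LINT x:{-pi..pi}|lborel. (cmod (f x))\<^sup>2) = 0"
    using 0 mean_square_nonneg[of f] by simp
  then have "integral {-pi..pi} (\<lambda>x. (cmod (f x))\<^sup>2) = 0"
    using set_borel_integral_eq_integral(2)[OF set_integrable_continuous_real[OF c]] by simp
  then show ?thesis
    using x integral_eq_0_iff[of "-pi" pi "\<lambda>x. (cmod (f x))\<^sup>2"] continuous_on_subset[OF c] by auto
qed

text \<open>The truncation \<open>max 0 (|f| - B)\<close> is pointwise dominated by \<open>|f - P\<^sub>N f|\<close>, whose mean square
  tends to zero.\<close>

lemma norm_le_of_l1_le:
  assumes cont: "continuous_on UNIV f" and per: "periodic_2pi f"
    and B: "\<And>N. l1 N (fourier_coeff f) \<le> B" and x: "x \<in> {-pi..pi}"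
  shows "cmod (f x) \<le> B"
proof -
  define h where "h x = complex_of_real (max 0 (cmod (f x) - B))" for x
  have h: "continuous_on UNIV h" unfolding h_def using cont by (intro continuous_intros)
  have "mean_square h \<le> mean_square f - (l2 N (fourier_coeff f))\<^sup>2" for N
    unfolding mean_square_remainder[OF cont, symmetric]
  proof (intro mean_square_mono h continuous_intros cont)
    fix x
    have "cmod (f x) - B \<le> cmod (f x) - cmod (tp N (fourier_coeff f) x)"
      using norm_tp_le[of N "fourier_coeff f" x] B[of N] by simp
    also have "\<dots> \<le> cmod (f x - tp N (fourier_coeff f) x)" by (rule norm_triangle_ineq2)
    finally show "cmod (h x) \<le> cmod (f x - tp N (fourier_coeff f) x)" by (simp add: h_def)
  qed
  moreover have "(\<lambda>N. mean_square f - (l2 N (fourier_coeff f))\<^sup>2) \<longlonglongrightarrow> mean_square f - mean_square f"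
    by (intro tendsto_intros parseval_limit cont per)
  ultimately have "mean_square h \<le> 0"
    by (auto intro: LIMSEQ_le_const)
  from mean_square_eq_0[OF h this x] show ?thesis by (auto simp: h_def)
qed

section \<open>Sums of Fourier coefficients in Sobolev spaces\<close>

lemma sum_inverse_square_le: "(\<Sum>l\<in>freqs N. 1 / (1 + (of_int l)\<^sup>2)) \<le> (5 :: real) - 4 / (real N + 1)"
proof (induction N)
  case (Suc N)
  have eq: "freqs (Suc N) = insert (- int (Suc N)) (insert (int (Suc N)) (freqs N))" by auto
  have "(\<Sum>l\<in>freqs (Suc N). 1 / (1 + (of_int l)\<^sup>2)) =
      2 / (1 + (real N + 1)\<^sup>2) + (\<Sum>l\<in>freqs N. 1 / (1 + (of_int l)\<^sup>2) :: real)"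
    unfolding eq by (subst sum.insert, simp, simp, subst sum.insert) (auto simp: power2_eq_square algebra_simps)
  \<comment> \<open>This fraction is the telescoping difference 4 / (N + 1) - 4 / (N + 2). Only the
    bound 5 is wanted later, but it is not inductive by itself.\<close>
  also have "\<dots> \<le> 4 / ((real N + 1) * (real N + 2)) + (5 - 4 / (real N + 1))"
    using Suc by (intro add_mono) (auto simp: divide_simps power2_eq_square algebra_simps)
  also have "\<dots> = 5 - 4 / (real (Suc N) + 1)"
    by (simp add: divide_simps) (simp add: algebra_simps)
  finally show ?case .
qed simp

lemma finite_subset_freqs:
  assumes "finite (F :: int set)"
  obtains N where "F \<subseteq> freqs N"
proof -
  have "F \<subseteq> freqs (nat (Max (insert 0 (abs ` F))))"
  proof
    fix l assume "l \<in> F"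
    then have "\<bar>l\<bar> \<le> Max (insert 0 (abs ` F))" using assms by (intro Max_ge) auto
    then show "l \<in> freqs (nat (Max (insert 0 (abs ` F))))" by auto
  qed
  then show thesis by (rule that)
qed

lemma sobolev_sum_le:
  assumes f: "f \<in> sobolev_space \<mu>" and B: "sobolev_norm \<mu> f \<le> B" and F: "finite F"
  shows "(\<Sum>l\<in>F. sobolev_weight \<mu> f l) \<le> B\<^sup>2"
proof -
  have "0 \<le> sobolev_weight \<mu> f l" for l by (simp add: sobolev_weight_def)
  then have "(\<Sum>l\<in>F. sobolev_weight \<mu> f l) \<le> (\<Sum>\<^sub>\<infinity>l\<in>UNIV. sobolev_weight \<mu> f l)"
    using f F by (intro finite_sum_le_infsum) (auto simp: sobolev_space_def)
  also have "\<dots> = (sobolev_norm \<mu> f)\<^sup>2"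
    by (simp add: sobolev_norm_def infsum_nonneg sobolev_weight_def)
  also have "\<dots> \<le> B\<^sup>2"
    using B by (intro power_mono) (auto simp: sobolev_norm_def infsum_nonneg sobolev_weight_def)
  finally show ?thesis .
qed

text \<open>Cauchy-Schwarz after writing the weight \<open>w\<close> as its power -1/2 times its
  power 3/2: the squares of the first sum to at most 5, and those of the second, with the
  coefficients, are dominated by Sobolev weights once \<open>3 \<le> \<mu>\<close>.\<close>

lemma sobolev_weighted_l1:
  assumes f: "f \<in> sobolev_space \<mu>" and B: "sobolev_norm \<mu> f \<le> B" and F: "finite F" and \<mu>: "3 \<le> \<mu>"
  shows "(\<Sum>l\<in>F. (1 + (of_int l)\<^sup>2) * cmod (fourier_coeff f l)) \<le> 3 * B"
proof -
  obtain N where N: "F \<subseteq> freqs N" using finite_subset_freqs[OF F] .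
  have B0: "0 \<le> B" using B by (rule order_trans[rotated]) (simp add: sobolev_norm_def infsum_nonneg sobolev_weight_def)
  define w where "w l = 1 + (real_of_int l)\<^sup>2" for l
  have w: "1 \<le> w l" for l by (simp add: w_def)
  then have w0: "\<bar>w l\<bar> = w l" "w l \<noteq> 0" for l
    using order.strict_trans2[OF zero_less_one w[of l]] by auto
  have "(\<Sum>l\<in>F. w l * cmod (fourier_coeff f l)) =
     (\<Sum>l\<in>F. \<bar>1 / sqrt (w l)\<bar> * \<bar>w l * sqrt (w l) * cmod (fourier_coeff f l)\<bar>)"
    by (intro sum.cong) (auto simp: abs_mult w0)
  also have "\<dots> \<le> L2_set (\<lambda>l. 1 / sqrt (w l)) F * L2_set (\<lambda>l. w l * sqrt (w l) * cmod (fourier_coeff f l)) F"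
    by (rule L2_set_mult_ineq)
  also have "\<dots> \<le> 3 * B"
  proof (intro mult_mono)
    have "(1 / sqrt (w l))\<^sup>2 = 1 / (1 + (of_int l)\<^sup>2)" for l
      using order_trans[OF zero_le_one w[of l]] by (simp add: power_divide w_def)
    then have "(\<Sum>l\<in>F. (1 / sqrt (w l))\<^sup>2) \<le> (\<Sum>l\<in>freqs N. 1 / (1 + (of_int l)\<^sup>2))"
      using N by (auto intro: sum_mono2)
    also have "\<dots> \<le> 5 - 4 / (real N + 1)" by (rule sum_inverse_square_le)
    also have "\<dots> \<le> 3\<^sup>2" by (rule order_trans[of _ 5]) auto
    finally show "L2_set (\<lambda>l. 1 / sqrt (w l)) F \<le> 3"
      unfolding L2_set_def by (intro real_le_lsqrt sum_nonneg) auto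
  next
    have "(\<Sum>l\<in>F. (w l * sqrt (w l) * cmod (fourier_coeff f l))\<^sup>2) \<le> (\<Sum>l\<in>F. sobolev_weight \<mu> f l)"
    proof (rule sum_mono)
      fix l
      have "(w l * sqrt (w l) * cmod (fourier_coeff f l))\<^sup>2 = w l ^ 3 * (cmod (fourier_coeff f l))\<^sup>2"
        using w[of l] by (simp add: power_mult_distrib power3_eq_cube power2_eq_square)
      also have "w l ^ 3 = w l powr 3" using w[of l] by (simp add: powr_numeral)
      also have "\<dots> \<le> w l powr \<mu>" using w \<mu> by (intro powr_mono) auto
      finally show "(w l * sqrt (w l) * cmod (fourier_coeff f l))\<^sup>2 \<le> sobolev_weight \<mu> f l"
        by (simp add: sobolev_weight_def w_def mult_right_mono)
    qed
    also have "\<dots> \<le> B\<^sup>2" by (rule sobolev_sum_le[OF f B F])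
    finally show "L2_set (\<lambda>l. w l * sqrt (w l) * cmod (fourier_coeff f l)) F \<le> B"
      unfolding L2_set_def using B0 by (intro real_le_lsqrt sum_nonneg) auto
  qed auto
  finally show ?thesis by (simp add: w_def)
qed

text \<open>Beyond \<open>N\<close> the Sobolev weight is at least
  \<open>real N powr (2 * \<mu>)\<close>. The tail is estimated for modes up to \<open>M\<close> and
  then passed to the limit by Parseval.\<close>

lemma sobolev_remainder:
  assumes f: "f \<in> sobolev_space \<mu>" and B: "sobolev_norm \<mu> f \<le> B"
    and cont: "continuous_on UNIV f" and \<mu>: "0 \<le> \<mu>" and N: "1 \<le> N"
  shows "mean_square f - (l2 N (fourier_coeff f))\<^sup>2 \<le> (B * real N powr - \<mu>)\<^sup>2"
proof -
  have per: "periodic_2pi f" using f by (simp add: sobolev_space_def)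
  have "(l2 M (fourier_coeff f))\<^sup>2 - (l2 N (fourier_coeff f))\<^sup>2 \<le> (B * real N powr - \<mu>)\<^sup>2" if M: "N \<le> M" for M
  proof -
    have "(l2 M (fourier_coeff f))\<^sup>2 - (l2 N (fourier_coeff f))\<^sup>2 =
        (\<Sum>l\<in>freqs M - freqs N. (cmod (fourier_coeff f l))\<^sup>2)"
      unfolding l2_sq using M by (subst sum_diff) auto
    also have "\<dots> \<le> (\<Sum>l\<in>freqs M - freqs N. (real N powr - \<mu>)\<^sup>2 * sobolev_weight \<mu> f l)"
    proof (rule sum_mono)
      fix l assume l: "l \<in> freqs M - freqs N"
      then have "real N \<le> \<bar>real_of_int l\<bar>" by auto
      then have "(real N)\<^sup>2 \<le> 1 + (real_of_int l)\<^sup>2"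
        using power_mono[of "real N" "\<bar>real_of_int l\<bar>" 2] by simp
      then have "(real N)\<^sup>2 powr \<mu> \<le> (1 + (real_of_int l)\<^sup>2) powr \<mu>"
        using \<mu> by (intro powr_mono2) auto
      moreover have "(real N)\<^sup>2 powr \<mu> = (real N powr \<mu>)\<^sup>2"
        using N by (simp add: power2_eq_square powr_mult)
      ultimately have "(real N powr - \<mu>)\<^sup>2 * (real N powr \<mu>)\<^sup>2 \<le> (real N powr - \<mu>)\<^sup>2 * (1 + (real_of_int l)\<^sup>2) powr \<mu>"
        by (intro mult_left_mono) auto
      moreover have "(real N powr - \<mu>)\<^sup>2 * (real N powr \<mu>)\<^sup>2 = 1"
        using N by (simp add: power_mult_distrib[symmetric] powr_add[symmetric])
      ultimately have "1 * (cmod (fourier_coeff f l))\<^sup>2 \<le>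
          ((real N powr - \<mu>)\<^sup>2 * (1 + (real_of_int l)\<^sup>2) powr \<mu>) * (cmod (fourier_coeff f l))\<^sup>2"
        by (intro mult_right_mono) auto
      then show "(cmod (fourier_coeff f l))\<^sup>2 \<le> (real N powr - \<mu>)\<^sup>2 * sobolev_weight \<mu> f l"
        by (simp add: sobolev_weight_def mult.assoc)
    qed
    also have "\<dots> \<le> (real N powr - \<mu>)\<^sup>2 * B\<^sup>2"
      unfolding sum_distrib_left[symmetric] by (intro mult_left_mono sobolev_sum_le f B) auto
    finally show ?thesis by (simp add: power_mult_distrib mult.commute)
  qed
  moreover have "(\<lambda>M. (l2 M (fourier_coeff f))\<^sup>2 - (l2 N (fourier_coeff f))\<^sup>2) \<longlonglongrightarrow>
      mean_square f - (l2 N (fourier_coeff f))\<^sup>2"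
    by (intro tendsto_intros parseval_limit cont per)
  ultimately show ?thesis by (blast intro: LIMSEQ_le_const2)
qed

subsection \<open>Error of the spatial discretization\<close>

lemma sobolev_norm_nonneg: "0 \<le> sobolev_norm \<mu> f"
  by (simp add: sobolev_norm_def infsum_nonneg sobolev_weight_def)

lemma sobolev_l1:
  assumes f: "f \<in> sobolev_space \<mu>" and B: "sobolev_norm \<mu> f \<le> B" and \<mu>: "3 \<le> \<mu>"
  shows "l1 N (fourier_coeff f) \<le> 3 * B"
proof -
  have "l1 N (fourier_coeff f) \<le> (\<Sum>l\<in>freqs N. (1 + (of_int l)\<^sup>2) * cmod (fourier_coeff f l))"
    unfolding l1_def by (intro sum_mono) (simp add: mult_le_cancel_right1 mult_right_le_one_le distrib_right)
  also have "\<dots> \<le> 3 * B" by (intro sobolev_weighted_l1[OF f B _ \<mu>]) simp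
  finally show ?thesis .
qed

lemma sobolev_bound:
  assumes "f \<in> sobolev_space \<mu>" "sobolev_norm \<mu> f \<le> B" "3 \<le> \<mu>" "continuous_on UNIV f" "x \<in> {-pi..pi}"
  shows "cmod (f x) \<le> 3 * B"
  using assms by (intro norm_le_of_l1_le sobolev_l1) (auto simp: sobolev_space_def)

section \<open>The fractional Laplacian on Sobolev functions\<close>

lemma symbol_le:
  assumes "0 < s" "s \<le> 1"
  shows "\<bar>of_int l\<bar> powr (2 * s) \<le> 1 + (real_of_int l)\<^sup>2"
proof (cases "l = 0")
  case False
  then have "1 \<le> \<bar>real_of_int l\<bar>" by auto
  then have "\<bar>real_of_int l\<bar> powr (2 * s) \<le> \<bar>real_of_int l\<bar> powr 2"
    using assms by (intro powr_mono) auto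
  also have "\<dots> = (real_of_int l)\<^sup>2" using False by (simp add: powr_numeral)
  finally show ?thesis by simp
qed simp

context
  fixes s \<mu> B :: real and f :: "real \<Rightarrow> complex"
  assumes s: "0 < s" "s \<le> 1" and \<mu>: "3 \<le> \<mu>"
    and f: "f \<in> sobolev_space \<mu>" and B: "sobolev_norm \<mu> f \<le> B"
begin

definition "lap_term l x = complex_of_real (\<bar>of_int l\<bar> powr (2 * s)) * fourier_coeff f l * cis (of_int l * x)"

lemma norm_lap_term: "cmod (lap_term l x) \<le> (1 + (of_int l)\<^sup>2) * cmod (fourier_coeff f l)"
  using symbol_le[OF s, of l] by (auto simp: lap_term_def norm_mult intro!: mult_right_mono)

text \<open>Uniform convergence transfers continuity and Fourier coefficients from finite partial
  sums to the series.\<close>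

lemma frac_laplacian_uniform_limit:
  "uniform_limit UNIV (\<lambda>X x. \<Sum>l\<in>X. lap_term l x) (frac_laplacian s f) (finite_subsets_at_top UNIV)"
proof -
  have "(\<lambda>l. (1 + (real_of_int l)\<^sup>2) * cmod (fourier_coeff f l)) summable_on UNIV"
    using sobolev_weighted_l1[OF f B _ \<mu>]
    by (intro nonneg_bdd_above_summable_on bdd_aboveI2[where M = "3 * B"]) auto
  from Weierstrass_m_test_general[where Y = UNIV, OF norm_lap_term this]
  show ?thesis by (simp add: frac_laplacian_def[abs_def] lap_term_def[abs_def])
qed

lemma continuous_on_lap_term: "continuous_on A (lap_term l)"
  unfolding lap_term_def[abs_def] by (intro continuous_intros)

lemma continuous_on_frac_laplacian: "continuous_on UNIV (frac_laplacian s f)"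
  by (rule uniform_limit_theorem[OF _ frac_laplacian_uniform_limit])
     (auto intro!: always_eventually continuous_on_sum continuous_on_lap_term)

lemma norm_frac_laplacian_le: "cmod (frac_laplacian s f x) \<le> 3 * B"
proof (rule tendsto_upperbound)
  show "((\<lambda>X. cmod (\<Sum>l\<in>X. lap_term l x)) \<longlongrightarrow> cmod (frac_laplacian s f x)) (finite_subsets_at_top UNIV)"
    by (intro tendsto_norm tendsto_uniform_limitI[OF frac_laplacian_uniform_limit]) simp
  have "cmod (\<Sum>l\<in>X. lap_term l x) \<le> 3 * B" if "finite X" for X
    by (rule order_trans[OF sum_norm_le[OF norm_lap_term] sobolev_weighted_l1[OF f B that \<mu>]])
  then show "eventually (\<lambda>X. cmod (\<Sum>l\<in>X. lap_term l x) \<le> 3 * B) (finite_subsets_at_top UNIV)"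
    by (intro eventually_finite_subsets_at_top_weakI)
qed simp

text \<open>A uniform error \<open>e\<close> changes a coefficient by at most \<open>e\<close>, and
  every finite partial sum over a set containing \<open>l\<close> already has the claimed
  coefficient.\<close>

lemma fourier_coeff_frac_laplacian:
  "fourier_coeff (frac_laplacian s f) l = of_real (\<bar>of_int l\<bar> powr (2 * s)) * fourier_coeff f l"
    (is "_ = ?c")
proof -
  have "cmod (fourier_coeff (frac_laplacian s f) l - ?c) \<le> 0 + e" if e: "0 < e" for e
  proof -
    have "eventually (\<lambda>X. \<forall>x\<in>UNIV. dist (\<Sum>m\<in>X. lap_term m x) (frac_laplacian s f x) < e)
        (finite_subsets_at_top UNIV)"
      using frac_laplacian_uniform_limit e by (rule uniform_limitD)
    moreover have "eventually (\<lambda>X. finite X \<and> l \<in> X) (finite_subsets_at_top UNIV)"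
      unfolding eventually_finite_subsets_at_top by (intro exI[of _ "{l}"]) auto
    ultimately have "eventually (\<lambda>X. (\<forall>x\<in>UNIV. dist (\<Sum>m\<in>X. lap_term m x) (frac_laplacian s f x) < e)
        \<and> finite X \<and> l \<in> X) (finite_subsets_at_top UNIV)"
      by (rule eventually_conj)
    then obtain X where X: "\<And>x. cmod (frac_laplacian s f x - (\<Sum>m\<in>X. lap_term m x)) < e" "finite X" "l \<in> X"
      using eventually_happens'[of "finite_subsets_at_top UNIV"] by (auto simp: dist_norm norm_minus_commute)
    have cX: "continuous_on UNIV (\<lambda>x. \<Sum>m\<in>X. lap_term m x)"
      by (intro continuous_on_sum continuous_on_lap_term)
    have "fourier_coeff (lap_term m) l = (if m = l then ?c else 0)" for m
      by (simp add: lap_term_def[abs_def] fourier_coeff_mult fourier_coeff_cis)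
    then have "fourier_coeff (\<lambda>x. \<Sum>m\<in>X. lap_term m x) l = ?c"
      using X by (subst fourier_coeff_sum) (auto intro: continuous_on_lap_term)
    then have "fourier_coeff (frac_laplacian s f) l - ?c =
        fourier_coeff (\<lambda>x. frac_laplacian s f x - (\<Sum>m\<in>X. lap_term m x)) l"
      using cX by (simp add: fourier_coeff_diff continuous_on_frac_laplacian)
    also have "cmod \<dots> \<le> e"
      using X(1) by (intro norm_fourier_coeff_le continuous_on_diff continuous_on_frac_laplacian cX)
        (auto intro: less_imp_le)
    finally show ?thesis by simp
  qed
  then have "cmod (fourier_coeff (frac_laplacian s f) l - ?c) \<le> 0"
    by (rule field_le_epsilon)
  then show ?thesis by simp
qed

end

section \<open>The evolution equation for Fourier coefficients\<close>

lemma fourier_coeff_has_vector_derivative: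
  fixes u ut :: "real \<Rightarrow> real \<Rightarrow> complex"
  assumes t: "t \<in> {0..T}"
    and cont: "\<And>r. r \<in> {0..T} \<Longrightarrow> continuous_on UNIV (u r)" "continuous_on UNIV (ut t)"
    and der: "\<And>r x. r \<in> {0..T} \<Longrightarrow> ((\<lambda>r. u r x) has_vector_derivative ut r x) (at r within {0..T})"
    and bd: "\<And>r x. r \<in> {0..T} \<Longrightarrow> x \<in> {-pi..pi} \<Longrightarrow> cmod (ut r x) \<le> B"
  shows "((\<lambda>r. fourier_coeff (u r) l) has_vector_derivative fourier_coeff (ut t) l) (at t within {0..T})"
proof -
  \<comment> \<open>The time derivative exists only pointwise in \<open>x\<close>, so this remainder
    quotient is integrated by dominated convergence along sequences. Its coefficients are the
    remainder quotients of the coefficients of \<open>u\<close>.\<close>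
  define Q where "Q r x = (u r x - (u t x + (r - t) *\<^sub>R ut t x)) /\<^sub>R norm (r - t)" for r x
  have cQ: "continuous_on UNIV (Q r)" if "r \<in> {0..T}" for r
    unfolding Q_def using that t by (intro continuous_intros cont)
  have Q0: "((\<lambda>r. Q r x) \<longlongrightarrow> 0) (at t within {0..T})" for x
    using der[OF t, of x] unfolding has_vector_derivative_def has_derivative_within Q_def
    by (simp add: inverse_eq_divide)
  have Qb: "cmod (Q r x) \<le> 2 * B" if r: "r \<in> {0..T} - {t}" and x: "x \<in> {-pi..pi}" for r x
  proof -
    \<comment> \<open>The mean value inequality turns the bound on \<open>ut\<close> into a
      dominating constant for \<open>Q\<close>.\<close>
    have "norm (u r x - u t x) \<le> B * norm (r - t)"
    proof (rule differentiable_bound[of "{0..T}" _ "\<lambda>r h. h *\<^sub>R ut r x"])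
      show "onorm (\<lambda>h. h *\<^sub>R ut r x) \<le> B" if "r \<in> {0..T}" for r
      proof (rule onorm_bound)
        show "0 \<le> B" by (rule order_trans[OF norm_ge_zero bd[OF that x]])
        show "norm (h *\<^sub>R ut r x) \<le> B * norm h" for h
          using mult_right_mono[OF bd[OF that x], of "\<bar>h\<bar>"] by (simp add: mult.commute)
      qed
    qed (use der r t in \<open>auto simp: has_vector_derivative_def\<close>)
    moreover have "norm ((r - t) *\<^sub>R ut t x) \<le> B * norm (r - t)"
      using mult_right_mono[OF bd[OF t x], of "\<bar>r - t\<bar>"] by (simp add: mult.commute)
    ultimately have "norm (u r x - (u t x + (r - t) *\<^sub>R ut t x)) \<le> 2 * B * norm (r - t)"
      using norm_triangle_ineq4[of "u r x - u t x" "(r - t) *\<^sub>R ut t x"] by (simp add: algebra_simps)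
    then show ?thesis
      using r by (simp add: Q_def divide_simps)
  qed
  have "((\<lambda>r. fourier_coeff (Q r) l) \<longlongrightarrow> 0) (at t within {0..T})"
    unfolding tendsto_at_iff_sequentially
  proof (intro allI impI)
    fix X :: "nat \<Rightarrow> real" assume X: "\<forall>i. X i \<in> {0..T} - {t}" "X \<longlonglongrightarrow> t"
    have "(\<lambda>i. LINT x|lborel. indicator {-pi..pi} x *\<^sub>R (Q (X i) x * cis (- (of_int l * x))))
        \<longlonglongrightarrow> (LINT x|(lborel :: real measure). (0::complex))"
    proof (rule integral_dominated_convergence[where w = "\<lambda>x. indicator {-pi..pi} x *\<^sub>R (2 * B)"])
      show "integrable lborel (\<lambda>x. indicator {-pi..pi} x *\<^sub>R (2 * B))"
        using set_integrable_continuous_real[OF continuous_on_const[of UNIV "2 * B"]] by (simp add: set_integrable_def)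
      show "(\<lambda>x. indicator {-pi..pi} x *\<^sub>R (Q (X i) x * cis (- (of_int l * x)))) \<in> borel_measurable lborel" for i
      proof -
        have "continuous_on UNIV (\<lambda>x. Q (X i) x * cis (of_int (- l) * x))"
          using X by (intro continuous_intros cQ) auto
        from set_integrable_continuous[OF this] show ?thesis
          by (auto simp: set_integrable_def dest: borel_measurable_integrable)
      qed
      show "AE x in lborel. (\<lambda>i. indicator {-pi..pi} x *\<^sub>R (Q (X i) x * cis (- (of_int l * x)))) \<longlonglongrightarrow> 0"
      proof (rule AE_I2)
        fix x
        have "(\<lambda>i. Q (X i) x) \<longlonglongrightarrow> 0"
          using Q0[of x] X unfolding tendsto_at_iff_sequentially by (auto simp: o_def)
        then have "(\<lambda>i. indicator {-pi..pi} x *\<^sub>R (Q (X i) x * cis (- (of_int l * x))))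
            \<longlonglongrightarrow> indicator {-pi..pi} x *\<^sub>R (0 * cis (- (of_int l * x)))"
          by (intro tendsto_intros)
        then show "(\<lambda>i. indicator {-pi..pi} x *\<^sub>R (Q (X i) x * cis (- (of_int l * x)))) \<longlonglongrightarrow> 0" by simp
      qed
      show "AE x in lborel. norm (indicator {-pi..pi} x *\<^sub>R (Q (X i) x * cis (- (of_int l * x))))
          \<le> indicator {-pi..pi} x *\<^sub>R (2 * B)" for i
        using X Qb by (intro AE_I2) (auto simp: indicator_def norm_mult)
    qed simp
    then have "(\<lambda>i. 1 / (2 * of_real pi) * (LINT x|lborel. indicator {-pi..pi} x *\<^sub>R (Q (X i) x * cis (- (of_int l * x)))))
        \<longlonglongrightarrow> 1 / (2 * of_real pi) * 0"
      by (intro tendsto_intros) simp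
    then show "((\<lambda>r. fourier_coeff (Q r) l) \<circ> X) \<longlonglongrightarrow> 0"
      by (simp add: fourier_coeff_def set_lebesgue_integral_def o_def)
  qed
  moreover have "fourier_coeff (Q r) l =
      (fourier_coeff (u r) l - (fourier_coeff (u t) l + (r - t) *\<^sub>R fourier_coeff (ut t) l)) /\<^sub>R norm (r - t)"
    if "r \<in> {0..T}" for r
  proof -
    have c: "continuous_on UNIV (u r)" "continuous_on UNIV (u t)"
      "continuous_on UNIV (\<lambda>x. of_real (r - t) * ut t x)"
      "continuous_on UNIV (\<lambda>x. u t x + of_real (r - t) * ut t x)"
      using that t by (intro continuous_intros cont; simp)+
    have "Q r = (\<lambda>x. of_real (1 / norm (r - t)) * (u r x - (u t x + of_real (r - t) * ut t x)))"
      by (simp add: Q_def scaleR_conv_of_real fun_eq_iff divide_inverse)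
    then have "fourier_coeff (Q r) l = of_real (1 / norm (r - t)) *
       (fourier_coeff (u r) l - (fourier_coeff (u t) l + of_real (r - t) * fourier_coeff (ut t) l))"
      by (simp only: fourier_coeff_mult fourier_coeff_diff[OF c(1,4)] fourier_coeff_add[OF c(2,3)])
    then show ?thesis by (simp add: scaleR_conv_of_real divide_inverse)
  qed
  ultimately have "((\<lambda>r. (fourier_coeff (u r) l - (fourier_coeff (u t) l + (r - t) *\<^sub>R fourier_coeff (ut t) l))
      /\<^sub>R norm (r - t)) \<longlongrightarrow> 0) (at t within {0..T})"
    by (rule Lim_transform_within[OF _ zero_less_one]) auto
  then show ?thesis
    unfolding has_vector_derivative_def has_derivative_within
    by (simp add: inverse_eq_divide bounded_linear_scaleR_left)
qed

text \<open>Through the equation the Sobolev bound controls the time derivative uniformly on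
  \<open>{0..T}\<close> and one period, which is the domination needed to differentiate the
  coefficients.\<close>

lemma nls_coeff_ode:
  assumes s: "0 < s" "s \<le> 1" and \<mu>: "3 \<le> \<mu>"
    and u: "nls_solution s T u0 u"
    and H: "\<And>t. t \<in> {0..T} \<Longrightarrow> u t \<in> sobolev_space \<mu>"
    and B: "\<And>t. t \<in> {0..T} \<Longrightarrow> sobolev_norm \<mu> (u t) \<le> B"
    and t: "t \<in> {0..T}"
  shows "((\<lambda>r. fourier_coeff (u r) l) has_vector_derivative
     - \<i> * of_real (\<bar>of_int l\<bar> powr (2 * s)) * fourier_coeff (u t) l + \<i> * fourier_coeff (cubic (u t)) l)
     (at t within {0..T})"
proof -
  define ut where "ut r x = - \<i> * frac_laplacian s (u r) x + \<i> * cubic (u r) x" for r x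
  have cont: "continuous_on UNIV (u r)" if "r \<in> {0..T}" for r
    using u that by (simp add: nls_solution_def)
  have lap: "continuous_on UNIV (frac_laplacian s (u r))" if "r \<in> {0..T}" for r
    by (rule continuous_on_frac_laplacian[OF s \<mu> H[OF that] B[OF that]])
  have "((\<lambda>r. fourier_coeff (u r) l) has_vector_derivative fourier_coeff (ut t) l) (at t within {0..T})"
  proof (rule fourier_coeff_has_vector_derivative[OF t])
    show "continuous_on UNIV (ut t)"
      unfolding ut_def[abs_def] using t by (intro continuous_intros lap cont)
    fix r assume r: "r \<in> {0..T}"
    show "continuous_on UNIV (u r)" by (rule cont[OF r])
    show "((\<lambda>r. u r x) has_vector_derivative ut r x) (at r within {0..T})" for x
    proof -
      obtain d where d: "((\<lambda>r. u r x) has_vector_derivative d) (at r within {0..T})"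
        "\<i> * d - frac_laplacian s (u r) x + cubic (u r) x = 0"
        using u r unfolding nls_solution_def by blast
      have "d = - \<i> * (\<i> * d)" by simp
      also have "\<i> * d = frac_laplacian s (u r) x - cubic (u r) x"
        using d(2) by (simp add: algebra_simps add_eq_0_iff)
      finally have "d = ut r x" by (simp add: ut_def algebra_simps)
      with d(1) show ?thesis by simp
    qed
    fix x assume x: "x \<in> {-pi..pi}"
    have "cmod (ut r x) \<le> cmod (frac_laplacian s (u r) x) + cmod (cubic (u r) x)"
      unfolding ut_def by (rule order_trans[OF norm_triangle_ineq]) (simp add: norm_mult)
    also have "\<dots> \<le> 3 * B + (3 * B)\<^sup>2 * (3 * B)"
    proof (intro add_mono)
      show "cmod (frac_laplacian s (u r) x) \<le> 3 * B"
        by (rule norm_frac_laplacian_le[OF s \<mu> H[OF r] B[OF r]])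
      have "cmod (u r x) \<le> 3 * B"
        by (rule sobolev_bound[OF H[OF r] B[OF r] \<mu> cont[OF r] x])
      then show "cmod (cubic (u r) x) \<le> (3 * B)\<^sup>2 * (3 * B)"
        unfolding cubic_def norm_mult norm_of_real abs_power2
        by (intro mult_mono power_mono) auto
    qed
    finally show "cmod (ut r x) \<le> 3 * B + (3 * B)\<^sup>2 * (3 * B)" .
  qed
  moreover have "fourier_coeff (ut t) l =
      - \<i> * of_real (\<bar>of_int l\<bar> powr (2 * s)) * fourier_coeff (u t) l + \<i> * fourier_coeff (cubic (u t)) l"
    unfolding ut_def[abs_def] using t
    by (subst fourier_coeff_add)
       (auto intro!: continuous_intros lap cont
         simp: fourier_coeff_mult[of "-\<i>", simplified] fourier_coeff_mult
           fourier_coeff_frac_laplacian[OF s \<mu> H B])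
  ultimately show ?thesis by simp
qed

section \<open>Convergence of the semidiscrete solution\<close>

locale bounded_nls =
  fixes s \<mu> T B :: real and u0 :: "real \<Rightarrow> complex" and u :: "real \<Rightarrow> real \<Rightarrow> complex"
  assumes s: "0 < s" "s \<le> 1" and \<mu>: "3 \<le> \<mu>"
    and T: "0 < T"
    and u: "nls_solution s T u0 u"
    and H: "\<And>t. t \<in> {0..T} \<Longrightarrow> u t \<in> sobolev_space \<mu>"
    and B: "\<And>t. t \<in> {0..T} \<Longrightarrow> sobolev_norm \<mu> (u t) \<le> B"
begin

lemma B_nonneg: "0 \<le> B"
  using order_trans[OF sobolev_norm_nonneg B[of 0]] T by simp

lemma cont: "t \<in> {0..T} \<Longrightarrow> continuous_on UNIV (u t)"
  using u by (simp add: nls_solution_def)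

lemma init: "u 0 = u0"
  using u by (simp add: nls_solution_def)

lemma l1_u: "t \<in> {0..T} \<Longrightarrow> l1 N (fourier_coeff (u t)) \<le> 3 * B"
  by (rule sobolev_l1[OF H B \<mu>])

lemma bound_u: "t \<in> {0..T} \<Longrightarrow> x \<in> {-pi..pi} \<Longrightarrow> cmod (u t x) \<le> 3 * B"
  by (rule sobolev_bound[OF H B \<mu> cont])

lemma l2_u0: "l2 N (fourier_coeff u0) \<le> 3 * B"
proof -
  have "(l2 N (fourier_coeff (u 0)))\<^sup>2 \<le> mean_square (u 0)"
    using T by (intro bessel cont) auto
  also have "\<dots> \<le> (3 * B)\<^sup>2"
    using T by (intro mean_square_le cont bound_u) auto
  finally show ?thesis
    unfolding init by (rule power2_le_imp_le) (use B_nonneg in simp)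
qed

text \<open>Only a bound on \<open>v\<close> up to time \<open>t\<close> is assumed, so that the
  continuation argument establishing this bound can use the estimate.\<close>

lemma semidiscrete_error:
  assumes v: "semidiscrete_solution s N T u0 v" and N: "1 \<le> N"
    and R: "3 * B \<le> R" and t: "t \<in> {0..T}"
    and vR: "\<And>r. r \<in> {0..t} \<Longrightarrow> l1 N (fourier_coeff (v r)) \<le> R"
  shows "mean_square (\<lambda>x. u t x - v t x) \<le> (B * real N powr - \<mu> * exp (3 * R\<^sup>2 * T))\<^sup>2"
    and "l2 N (\<lambda>l. fourier_coeff (u t) l - fourier_coeff (v t) l) \<le> B * real N powr - \<mu> * exp (3 * R\<^sup>2 * T)"
proof -
  define c where "c r = fourier_coeff (u r)" for r
  define d where "d r = fourier_coeff (v r)" for r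
  define e where "e r l = c r l - d r l" for r l
  define \<delta> where "\<delta> = (B * real N powr - \<mu>)\<^sup>2"
  define K where "K = 3 * R\<^sup>2"
  define g where "g r l = fourier_coeff (cubic (u r)) l - cubic_coeff N (d r) l" for r l
  define e' where "e' r l = - \<i> * of_real (\<bar>of_int l\<bar> powr (2 * s)) * e r l + \<i> * g r l" for r l
  \<comment> \<open>The cubic difference involves \<open>u\<close> itself, not its truncation, and
    is measured by the full mean square of \<open>u - v\<close>. Adding the squared tail bound
    \<delta> makes \<open>y\<close> dominate it, so the inequality closes without a forcing term;
    initially only \<delta> is left.\<close>
  define y where "y r = (l2 N (e r))\<^sup>2 + \<delta>" for r
  have K: "0 \<le> K" and \<delta>: "0 \<le> \<delta>" by (auto simp: K_def \<delta>_def)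
  have vd: "v r = tp N (d r)" if "r \<in> {0..T}" for r
    using v that by (simp add: semidiscrete_solution_def trig_polys_iff d_def)
  have der: "(y has_real_derivative 2 * (\<Sum>l\<in>freqs N. Re (e' r l * cnj (e r l)))) (at r within {0..T})"
    if r: "r \<in> {0..T}" for r
  proof -
    have "((\<lambda>r. e r l) has_vector_derivative e' r l) (at r within {0..T})" if l: "l \<in> freqs N" for l
      using has_vector_derivative_diff[OF nls_coeff_ode[OF s \<mu> u H B r, of l]
          semidiscrete_coeff_ode[OF v r l]]
      by (simp add: e_def[abs_def] c_def d_def e'_def g_def field_coeff_def algebra_simps)
    then show ?thesis
      unfolding y_def[abs_def] using DERIV_add[OF l2_sq_has_real_derivative DERIV_const] by fastforce
  qed
  have ms: "mean_square (\<lambda>x. u r x - v r x) \<le> y r" if r: "r \<in> {0..T}" for r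
    using sobolev_remainder[OF H[OF r] B[OF r] cont[OF r] _ N] mean_square_minus_tp[OF cont[OF r], of N "d r"] \<mu>
    by (simp add: vd[OF r] y_def \<delta>_def e_def[abs_def] c_def)
  have y0: "y 0 = \<delta>"
  proof -
    have "e 0 l = 0" if "l \<in> freqs N" for l
      using v that by (simp add: e_def c_def d_def init semidiscrete_solution_def fourier_proj_eq fourier_coeff_tp)
    then show ?thesis by (simp add: y_def l2_eq_0_iff)
  qed
  have "y t \<le> y 0 * exp ((2 * K) * t)"
  proof (rule gronwall[OF _ _ der])
    fix r assume "r \<in> {0..t}"
    then have r: "r \<in> {0..T}" and rt: "r \<in> {0..t}" using t by auto
    have "(l2 N (g r))\<^sup>2 \<le> K\<^sup>2 * mean_square (\<lambda>x. u r x - v r x)"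
      unfolding g_def cubic_coeff_def vd[OF r] K_def
    proof (intro l2_cubic_diff cont r continuous_on_tp)
      show "cmod (u r x) \<le> R" if "x \<in> {-pi..pi}" for x using bound_u[OF r that] R by simp
      show "cmod (tp N (d r) x) \<le> R" for x
        using norm_tp_le[of N "d r" x] vR[OF rt] by (simp add: d_def)
    qed
    also have "\<dots> \<le> K\<^sup>2 * y r" by (intro mult_left_mono ms r) auto
    finally have "(l2 N (g r))\<^sup>2 \<le> (K * sqrt (y r))\<^sup>2"
      using \<delta> by (simp add: power_mult_distrib y_def)
    then have g: "l2 N (g r) \<le> K * sqrt (y r)"
      by (rule power2_le_imp_le) (use K \<delta> in \<open>simp add: y_def\<close>)
    have "Re (e' r l * cnj (e r l)) = - Im (g r l * cnj (e r l))" for l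
      by (simp add: e'_def algebra_simps)
    then have "(\<Sum>l\<in>freqs N. Re (e' r l * cnj (e r l))) = - Im (\<Sum>l\<in>freqs N. g r l * cnj (e r l))"
      by (simp only: sum_negf Im_sum)
    also have "\<dots> \<le> cmod (\<Sum>l\<in>freqs N. g r l * cnj (e r l))"
      using abs_Im_le_cmod[of "\<Sum>l\<in>freqs N. g r l * cnj (e r l)"] by linarith
    also have "\<dots> \<le> l2 N (g r) * l2 N (e r)" by (rule l2_cauchy_schwarz)
    also have "\<dots> \<le> (K * sqrt (y r)) * sqrt (y r)"
      using g K \<delta> by (intro mult_mono) (auto simp: y_def intro!: real_le_rsqrt)
    also have "\<dots> = K * y r" using \<delta> by (simp add: y_def)
    finally show "2 * (\<Sum>l\<in>freqs N. Re (e' r l * cnj (e r l))) \<le> 2 * K * y r" by simp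
  qed (use t in auto)
  also have "\<dots> \<le> \<delta> * exp ((2 * K) * T)"
    using t K \<delta> by (auto simp: y0 intro!: mult_left_mono)
  also have "\<dots> = (B * real N powr - \<mu> * exp (3 * R\<^sup>2 * T))\<^sup>2"
    by (simp add: \<delta>_def K_def power_mult_distrib exp_double[symmetric] mult.assoc)
  finally have y: "y t \<le> (B * real N powr - \<mu> * exp (3 * R\<^sup>2 * T))\<^sup>2" .
  with ms[OF t] show "mean_square (\<lambda>x. u t x - v t x) \<le> (B * real N powr - \<mu> * exp (3 * R\<^sup>2 * T))\<^sup>2"
    by linarith
  have "(l2 N (e t))\<^sup>2 \<le> (B * real N powr - \<mu> * exp (3 * R\<^sup>2 * T))\<^sup>2"
    using y \<delta> by (simp add: y_def)
  then show "l2 N (\<lambda>l. fourier_coeff (u t) l - fourier_coeff (v t) l) \<le> B * real N powr - \<mu> * exp (3 * R\<^sup>2 * T)"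
    unfolding e_def[abs_def] c_def d_def by (rule power2_le_imp_le) (use B_nonneg in simp)
qed

text \<open>For large \<open>N\<close> the inverse inequality loses only \<open>N\<^bsup>1/2\<^esup>\<close>, which the rate \<open>N\<^bsup>-\<mu>\<^esup>\<close> absorbs, so the
  a priori bound propagates in time; for the remaining \<open>N\<close> conservation of the norm is enough.\<close>

lemma semidiscrete_l1_bound:
  obtains R where "3 * B \<le> R" "\<And>N v t. 1 \<le> N \<Longrightarrow> semidiscrete_solution s N T u0 v \<Longrightarrow> t \<in> {0..T}
    \<Longrightarrow> l1 N (fourier_coeff (v t)) \<le> R"
proof -
  define R0 where "R0 = 3 * B + 1"
  define A where "A = B * exp (3 * R0\<^sup>2 * T)"
  define R where "R = max R0 (sqrt (3 * (2 * A)) * (3 * B))"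
  have A: "0 \<le> A" using B_nonneg by (simp add: A_def)
  have bound: "l1 N (fourier_coeff (v t)) \<le> R"
    if N: "1 \<le> N" and v: "semidiscrete_solution s N T u0 v" and t: "t \<in> {0..T}" for N v t
  \<comment> \<open>Above this threshold the \<open>l1\<close> error is at most
    \<open>A * (2 / real N) < 1\<close>, the slack built into \<open>R0\<close>.\<close>
  proof (cases "real N \<le> 2 * A")
    case True
    have "l1 N (fourier_coeff (v t)) \<le> sqrt (3 * real N) * l2 N (fourier_coeff (v t))"
      by (rule l1_le_l2'[OF N])
    also have "\<dots> \<le> sqrt (3 * (2 * A)) * (3 * B)"
      using True A order_trans[OF semidiscrete_l2_le[OF v t] l2_u0] by (intro mult_mono) auto
    finally show ?thesis by (simp add: R_def)
  next
    case False
    have "l1 N (fourier_coeff (v t)) < R0"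
    proof (rule continuity_bootstrap[OF _ _ _ t])
      show "continuous_on {0..T} (\<lambda>t. l1 N (fourier_coeff (v t)))"
        unfolding l1_def
      proof (intro continuous_intros)
        fix l assume "l \<in> freqs N"
        then show "continuous_on {0..T} (\<lambda>t. fourier_coeff (v t) l)"
          unfolding continuous_on_eq_continuous_within
          using semidiscrete_coeff_ode[OF v] has_vector_derivative_continuous by blast
      qed
      have "l1 N (fourier_coeff (v 0)) = l1 N (fourier_coeff (u 0))"
        using v by (intro l1_cong) (auto simp: init semidiscrete_solution_def fourier_proj_eq fourier_coeff_tp)
      also have "\<dots> < R0" using l1_u[of 0 N] T by (simp add: R0_def)
      finally show "l1 N (fourier_coeff (v 0)) < R0" .
      fix r assume r: "r \<in> {0..T}" and le: "\<And>r'. r' \<in> {0..r} \<Longrightarrow> l1 N (fourier_coeff (v r')) \<le> R0"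
      let ?e = "\<lambda>l. fourier_coeff (v r) l - fourier_coeff (u r) l"
      have "l1 N ?e \<le> sqrt (3 * real N) * l2 N ?e" by (rule l1_le_l2'[OF N])
      also have "\<dots> \<le> sqrt (3 * real N) * (B * real N powr - \<mu> * exp (3 * R0\<^sup>2 * T))"
        unfolding l2_minus_commute[of N "fourier_coeff (v r)" "fourier_coeff (u r)"]
        by (intro mult_left_mono semidiscrete_error(2)[OF v N _ r le]) (auto simp: R0_def)
      also have "\<dots> = A * (sqrt (3 * real N) * real N powr - \<mu>)" by (simp add: A_def)
      also have "\<dots> \<le> A * (2 / real N)"
      proof (intro mult_left_mono A)
        have "real N powr - \<mu> \<le> real N powr - 2" using N \<mu> by (intro powr_mono) auto
        also have "\<dots> = 1 / (real N)\<^sup>2" using N by (simp add: powr_minus powr_numeral inverse_eq_divide)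
        finally have "sqrt (3 * real N) * real N powr - \<mu> \<le> (2 * real N) * (1 / (real N)\<^sup>2)"
          using N by (intro mult_mono real_le_lsqrt) (auto simp: power2_eq_square)
        then show "sqrt (3 * real N) * real N powr - \<mu> \<le> 2 / real N"
          using N by (simp add: power2_eq_square)
      qed
      also have "\<dots> < 1" using False N by (simp add: divide_simps)
      finally have "l1 N ?e < 1" .
      moreover have "l1 N (fourier_coeff (v r)) \<le> l1 N (fourier_coeff (u r)) + l1 N ?e"
        using l1_triangle[of N "fourier_coeff (u r)" ?e] by simp
      ultimately show "l1 N (fourier_coeff (v r)) < R0"
        using l1_u[OF r, of N] by (simp add: R0_def)
    qed
    then show ?thesis by (simp add: R_def)
  qed
  have "3 * B \<le> R" by (simp add: R_def R0_def)
  then show thesis by (rule that) (rule bound)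
qed

end

subsection \<open>The composition method\<close>

lemma is_stages_coeffD:
  assumes Y: "is_stages s p N k V Y" and j: "j \<in> {1..num_stages p}"
  shows "midpoint_step s N (k * coeff_b p j) (fourier_coeff (Y (j - 1))) (fourier_coeff (Y j))"
proof -
  have "tp N (fourier_coeff (Y i)) = Y i" if "i \<le> num_stages p" for i
  proof -
    have "Y i \<in> trig_polys N" using Y that by (simp add: is_stages_def)
    then show ?thesis by (rule trig_polys_iff[THEN iffD1, symmetric])
  qed
  then have eq: "tp N (fourier_coeff (Y j)) = Y j" "tp N (fourier_coeff (Y (j - 1))) = Y (j - 1)"
    using j by auto
  show ?thesis
    using Y j unfolding midpoint_step_iff eq is_stages_def by blast
qed

lemma is_stages_tpI:
  assumes "V = tp N (c 0)"
    and "\<And>j. j \<in> {1..num_stages p} \<Longrightarrow> midpoint_step s N (k * coeff_b p j) (c (j - 1)) (c j)"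
  shows "is_stages s p N k V (\<lambda>j. tp N (c j))"
  unfolding is_stages_def using assms(1) assms(2)[unfolded midpoint_step_iff] tp_in_trig_polys by blast

lemma is_stages_trig_poly: "is_stages s p N k V Y \<Longrightarrow> j \<le> num_stages p \<Longrightarrow> Y j \<in> trig_polys N"
  by (simp add: is_stages_def)

lemma is_stages_0: "is_stages s p N k V Y \<Longrightarrow> Y 0 = V"
  by (simp add: is_stages_def)

lemma stages_l2:
  assumes Y: "is_stages s p N k V Y" and "j \<le> num_stages p"
  shows "l2 N (fourier_coeff (Y j)) = l2 N (fourier_coeff V)"
  using assms(2)
proof (induction j)
  case (Suc j)
  then show ?case
    using midpoint_step_l2[OF is_stages_coeffD[OF Y, of "Suc j"]] by simp
qed (simp add: is_stages_0[OF Y])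

lemma is_stages_coeff_Suc:
  assumes "is_stages s p N k V Y" "Suc j \<le> num_stages p"
  shows "midpoint_step s N (k * coeff_b p (Suc j)) (fourier_coeff (Y j)) (fourier_coeff (Y (Suc j)))"
  using is_stages_coeffD[OF assms(1), of "Suc j"] assms(2) by simp

lemma num_stages_pos: "1 \<le> num_stages p"
  by (simp add: num_stages_def)

definition max_coeff :: "nat \<Rightarrow> real" where
  "max_coeff p = (MAX j\<in>{1..num_stages p}. \<bar>coeff_b p j\<bar>)"

lemma coeff_b_le_max: "j \<in> {1..num_stages p} \<Longrightarrow> \<bar>coeff_b p j\<bar> \<le> max_coeff p"
  unfolding max_coeff_def by (intro Max_ge) auto

text \<open>The first entry is a product of factors \<gamma>, each positive because the subtracted
  power of 2 has exponent below 1. It is singled out because the middle factor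
  \<open>1 - 2 * \<gamma>\<close> is negative, and it makes \<open>max_coeff p\<close>
  positive.\<close>

lemma triple_jump_first_pos: "1 \<le> p \<Longrightarrow> triple_jump p \<noteq> [] \<and> 0 < triple_jump p ! 0"
proof (induction p rule: triple_jump.induct)
  case (3 m)
  have "2 powr (1 / (2 * real (Suc m) + 1)) < 2 powr (1::real)"
    by (intro powr_less_mono) auto
  then have "0 < 1 / (2 - 2 powr (1 / (2 * real (Suc m) + 1)))" by simp
  then show ?case using 3 by (simp add: Let_def nth_append)
qed auto

lemma max_coeff_pos:
  assumes "1 \<le> p" shows "0 < max_coeff p"
proof -
  have "0 < \<bar>coeff_b p 1\<bar>" using triple_jump_first_pos[OF assms] by (simp add: coeff_b_def)
  also have "\<dots> \<le> max_coeff p" using num_stages_pos[of p] by (intro coeff_b_le_max) auto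
  finally show ?thesis .
qed

section \<open>Solvability and stability of one step\<close>

context
  fixes s k \<omega> :: real and p N :: nat
  assumes N: "1 \<le> N" and k: "0 < k"
    and cfl: "18 * (k * max_coeff p * real N) * \<omega>\<^sup>2 \<le> 1"
begin

text \<open>\<omega> bounds the \<open>l2\<close> norm of the starting value; stages conserve that
  norm, so one condition with the largest coefficient covers them all.\<close>

lemma stage_cfl:
  assumes j: "j \<in> {1..num_stages p}" and v: "l2 N v \<le> \<omega>"
  shows "18 * (\<bar>k * coeff_b p j\<bar> * real N) * (l2 N v)\<^sup>2 \<le> 1"
proof -
  have "\<bar>k * coeff_b p j\<bar> \<le> k * max_coeff p"
    using coeff_b_le_max[OF j] k by (simp add: abs_mult)
  moreover have "(l2 N v)\<^sup>2 \<le> \<omega>\<^sup>2" using v by (intro power_mono) auto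
  ultimately have "18 * (\<bar>k * coeff_b p j\<bar> * real N) * (l2 N v)\<^sup>2 \<le> 18 * (k * max_coeff p * real N) * \<omega>\<^sup>2"
    by (intro mult_mono mult_left_mono mult_right_mono) (auto intro!: mult_nonneg_nonneg order_trans[OF abs_ge_zero])
  with cfl show ?thesis by linarith
qed

text \<open>The factor depends on the number of stages only, so it is harmless within a step;
  iterated over all steps it would blow up as \<open>k\<close> tends to 0.\<close>

lemma stages_l1:
  assumes Y: "is_stages s p N k V Y" and V: "l2 N (fourier_coeff V) \<le> \<omega>" and "j \<le> num_stages p"
  shows "l1 N (fourier_coeff (Y j)) \<le> 5 ^ j * l1 N (fourier_coeff V)"
  using assms(3)
proof (induction j)
  case (Suc j)
  have "l1 N (fourier_coeff (Y (Suc j))) \<le> 5 * l1 N (fourier_coeff (Y j))"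
    using Suc V stages_l2[OF Y, of j]
    by (intro midpoint_l1(2)[OF is_stages_coeff_Suc[OF Y] N] stage_cfl) auto
  also have "\<dots> \<le> 5 ^ Suc j * l1 N (fourier_coeff V)" using Suc by simp
  finally show ?case .
qed (simp add: is_stages_0[OF Y])

lemma stages_unique:
  assumes Y: "is_stages s p N k V Y" and Y': "is_stages s p N k V Y'"
    and V: "l2 N (fourier_coeff V) \<le> \<omega>" and "j \<le> num_stages p"
  shows "Y j = Y' j"
  using assms(4)
proof (induction j)
  case (Suc j)
  then have eq: "Y j = Y' j" by simp
  have "fourier_coeff (Y (Suc j)) l = fourier_coeff (Y' (Suc j)) l" if l: "l \<in> freqs N" for l
    using Suc V stages_l2[OF Y, of j]
    by (intro midpoint_step_unique[OF is_stages_coeff_Suc[OF Y Suc.prems]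
          is_stages_coeff_Suc[OF Y' Suc.prems, folded eq] N _ l] stage_cfl) auto
  then have "tp N (fourier_coeff (Y (Suc j))) = tp N (fourier_coeff (Y' (Suc j)))"
    by (rule tp_cong)
  then show ?case
    using is_stages_trig_poly[OF Y Suc.prems] is_stages_trig_poly[OF Y' Suc.prems]
    by (metis trig_polys_iff)
qed (simp add: is_stages_0[OF Y] is_stages_0[OF Y'])

lemma stages_exist:
  assumes V: "V \<in> trig_polys N" "l2 N (fourier_coeff V) \<le> \<omega>"
  shows "\<exists>Y. is_stages s p N k V Y"
proof -
  \<comment> \<open>The recursion runs past the last stage, where the chosen value may be arbitrary;
    \<open>step\<close> speaks of genuine stages only.\<close>
  define c where "c = rec_nat (fourier_coeff V) (\<lambda>j v. SOME v'. midpoint_step s N (k * coeff_b p (Suc j)) v v')"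
  have c0: "c 0 = fourier_coeff V" by (simp add: c_def)
  have cS: "c (Suc j) = (SOME v'. midpoint_step s N (k * coeff_b p (Suc j)) (c j) v')" for j
    by (simp add: c_def)
  have step: "midpoint_step s N (k * coeff_b p (Suc j)) (c j) (c (Suc j))"
    if "Suc j \<le> num_stages p" "l2 N (c j) \<le> \<omega>" for j
  proof -
    have "\<exists>v'. midpoint_step s N (k * coeff_b p (Suc j)) (c j) v'"
      using that by (intro midpoint_step_exists N stage_cfl) auto
    then show ?thesis unfolding cS by (rule someI_ex)
  qed
  have l2c: "l2 N (c j) \<le> \<omega>" if "j \<le> num_stages p" for j
    using that
  proof (induction j)
    case (Suc j)
    then show ?case using midpoint_step_l2[OF step[of j]] by simp
  qed (simp add: c0 V)
  have "is_stages s p N k V (\<lambda>j. tp N (c j))"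
  proof (rule is_stages_tpI)
    show "V = tp N (c 0)" unfolding c0 using V(1) by (rule trig_polys_iff[THEN iffD1])
    fix j assume "j \<in> {1..num_stages p}"
    then show "midpoint_step s N (k * coeff_b p j) (c (j - 1)) (c j)"
      using step[of "j - 1"] l2c[of "j - 1"] by auto
  qed
  then show ?thesis by blast
qed

text \<open>The radius \<open>2 * 5 ^ num_stages p * R\<close> bounds every midpoint of the step in
  \<open>l1\<close>. For \<open>R\<close> independent of \<open>N\<close>, \<open>h\<close> is of
  order \<open>k\<close>, and errors grow by the exponential of a multiple of
  \<open>k\<close>.\<close>

lemma stages_stability:
  fixes R :: real
  defines "h \<equiv> k * max_coeff p * (3 * (2 * 5 ^ num_stages p * R)\<^sup>2) / 2"
  assumes Y: "is_stages s p N k V Y" and Z: "is_stages s p N k W Z"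
    and V: "l2 N (fourier_coeff V) \<le> \<omega>" and W: "l2 N (fourier_coeff W) \<le> \<omega>"
    and R: "l1 N (fourier_coeff V) \<le> R" "l1 N (fourier_coeff W) \<le> R"
    and h: "h \<le> 1 / 2" and "j \<le> num_stages p"
  shows "l2 N (\<lambda>l. fourier_coeff (Y j) l - fourier_coeff (Z j) l)
    \<le> exp (4 * h * real j) * l2 N (\<lambda>l. fourier_coeff V l - fourier_coeff W l)"
  using assms(9)
proof (induction j)
  case (Suc j)
  let ?\<rho> = "2 * 5 ^ num_stages p * R"
  let ?\<tau> = "k * coeff_b p (Suc j)"
  define a where "a = l2 N (\<lambda>l. fourier_coeff (Y (Suc j)) l - fourier_coeff (Z (Suc j)) l)"
  define b where "b = l2 N (\<lambda>l. fourier_coeff (Y j) l - fourier_coeff (Z j) l)"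
  have ab: "0 \<le> a" "0 \<le> b" by (auto simp: a_def b_def)
  have mid: "l1 N (\<lambda>l. (fourier_coeff (X (Suc j)) l + fourier_coeff (X j) l) / 2) \<le> ?\<rho>"
    if X: "is_stages s p N k Q X" and Q: "l2 N (fourier_coeff Q) \<le> \<omega>" "l1 N (fourier_coeff Q) \<le> R" for X Q
  proof -
    have "l1 N (\<lambda>l. (fourier_coeff (X (Suc j)) l + fourier_coeff (X j) l) / 2) \<le> 2 * l1 N (fourier_coeff (X j))"
      using Suc Q stages_l2[OF X, of j]
      by (intro midpoint_l1(1)[OF is_stages_coeff_Suc[OF X] N] stage_cfl) auto
    also have "\<dots> \<le> 2 * (5 ^ j * l1 N (fourier_coeff Q))"
      using stages_l1[OF X Q(1), of j] Suc by simp
    also have "\<dots> \<le> 2 * (5 ^ num_stages p * R)"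
      using Suc Q by (intro mult_left_mono mult_mono power_increasing) auto
    finally show ?thesis by simp
  qed
  have "\<bar>?\<tau>\<bar> * (3 * ?\<rho>\<^sup>2) / 2 \<le> h"
    unfolding h_def using coeff_b_le_max[of "Suc j" p] Suc k
    by (intro divide_right_mono mult_right_mono) (auto simp: abs_mult)
  then have "\<bar>?\<tau>\<bar> * (3 * ?\<rho>\<^sup>2) / 2 * (a + b) \<le> h * (a + b)"
    using ab by (intro mult_right_mono) auto
  with midpoint_step_diff[OF is_stages_coeff_Suc[OF Y Suc.prems] is_stages_coeff_Suc[OF Z Suc.prems]
      mid[OF Y V R(1)] mid[OF Z W R(2)]]
  have "a \<le> b + h * (a + b)" by (simp add: a_def b_def)
  then have "a * (1 - h) \<le> b * (1 + h)" by (simp add: algebra_simps)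
  also have h0: "0 \<le> h"
    unfolding h_def using k order_trans[OF abs_ge_zero coeff_b_le_max[of "Suc j" p]] Suc.prems by (intro divide_nonneg_nonneg mult_nonneg_nonneg) auto
  \<comment> \<open>The amplification factor of a stage is \<open>(1 + h) / (1 - h)\<close>;
    bounding it by \<open>1 + 4 * h\<close> amounts to \<open>2 * h\<^sup>2 \<le> h\<close>, whence
    the condition \<open>h \<le> 1 / 2\<close>.\<close>
  have "1 + h \<le> (1 + 4 * h) * (1 - h)"
    using mult_left_mono[OF h h0] by (simp add: algebra_simps)
  then have "b * (1 + h) \<le> b * ((1 + 4 * h) * (1 - h))" using ab by (intro mult_left_mono)
  also have "\<dots> = (b * (1 + 4 * h)) * (1 - h)" by simp
  finally have "a \<le> b * (1 + 4 * h)"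
    using h by (elim mult_right_le_imp_le) simp
  also have "\<dots> \<le> b * exp (4 * h)" using ab exp_ge_add_one_self[of "4 * h"] by (intro mult_left_mono) auto
  also have "\<dots> \<le> (exp (4 * h * real j) * l2 N (\<lambda>l. fourier_coeff V l - fourier_coeff W l)) * exp (4 * h)"
    using Suc by (intro mult_right_mono) (auto simp: b_def)
  also have "\<dots> = exp (4 * h * real (Suc j)) * l2 N (\<lambda>l. fourier_coeff V l - fourier_coeff W l)"
    by (simp add: exp_add algebra_simps)
  finally show ?case by (simp add: a_def)
qed (simp add: is_stages_0[OF Y] is_stages_0[OF Z])

end

section \<open>The fully discrete scheme\<close>

lemma fourier_proj_in_trig_polys: "fourier_proj N u0 \<in> trig_polys N"
  by (simp add: fourier_proj_eq)

lemma l2_fourier_proj: "l2 N (fourier_coeff (fourier_proj N u0)) = l2 N (fourier_coeff u0)"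
  by (intro l2_cong) (simp add: fourier_proj_eq fourier_coeff_tp)

lemma fully_discrete_step:
  assumes "fully_discrete s p N k u0 m U Y" "n < m"
  shows "is_stages s p N k (U n) (Y n)" "U (Suc n) = Y n (num_stages p)"
  using assms by (auto simp: fully_discrete_def)

lemma fully_discrete_0: "fully_discrete s p N k u0 m U Y \<Longrightarrow> U 0 = fourier_proj N u0"
  by (simp add: fully_discrete_def)

lemma fully_discrete_l2:
  assumes "fully_discrete s p N k u0 m U Y" "n \<le> m"
  shows "l2 N (fourier_coeff (U n)) = l2 N (fourier_coeff u0)"
  using assms(2)
proof (induction n)
  case (Suc n)
  then show ?case
    using stages_l2[OF fully_discrete_step(1)[OF assms(1), of n], of "num_stages p"]
      fully_discrete_step(2)[OF assms(1), of n] by simp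
qed (simp add: fully_discrete_0[OF assms(1)] l2_fourier_proj)

lemma fully_discrete_trig_poly:
  assumes "fully_discrete s p N k u0 m U Y" "n \<le> m"
  shows "U n \<in> trig_polys N"
  using assms
proof (cases n)
  case (Suc i)
  then show ?thesis
    using assms fully_discrete_step[OF assms(1), of i] is_stages_trig_poly by fastforce
qed (simp add: fully_discrete_0 fourier_proj_in_trig_polys)

text \<open>Every \<open>U n\<close> has the \<open>l2\<close> norm of \<open>U 0\<close>, so the
  condition does not deteriorate and the scheme continues for any number of steps.\<close>

lemma cfl_uniquely_solvable:
  assumes N: "1 \<le> N" and k: "0 < k"
    and cfl: "18 * (k * max_coeff p * real N) * (l2 N (fourier_coeff u0))\<^sup>2 \<le> 1"
  shows "uniquely_solvable s p N k u0 m"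
  unfolding uniquely_solvable_def
proof (intro conjI allI impI)
  define stages where "stages V = (SOME Y. is_stages s p N k V Y)" for V
  define U where "U = rec_nat (fourier_proj N u0) (\<lambda>n V. stages V (num_stages p))"
  have U0: "U 0 = fourier_proj N u0" and US: "U (Suc n) = stages (U n) (num_stages p)" for n
    by (simp_all add: U_def)
  have stages: "is_stages s p N k V (stages V)"
    if "V \<in> trig_polys N" "l2 N (fourier_coeff V) \<le> l2 N (fourier_coeff u0)" for V
    unfolding stages_def using stages_exist[OF N k cfl that] by (rule someI_ex)
  have inv: "U n \<in> trig_polys N \<and> l2 N (fourier_coeff (U n)) = l2 N (fourier_coeff u0)" for n
  proof (induction n)
    case (Suc n)
    then have st: "is_stages s p N k (U n) (stages (U n))" by (intro stages) auto
    show ?case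
      unfolding US using is_stages_trig_poly[OF st] stages_l2[OF st] Suc by simp
  qed (simp add: U0 fourier_proj_in_trig_polys l2_fourier_proj)
  have "fully_discrete s p N k u0 m U (\<lambda>n. stages (U n))"
    unfolding fully_discrete_def using inv by (auto simp: U0 US intro!: stages)
  then show "\<exists>U Y. fully_discrete s p N k u0 m U Y" by blast
next
  fix U Y U' Y'
  assume "fully_discrete s p N k u0 m U Y \<and> fully_discrete s p N k u0 m U' Y'"
  then have fd: "fully_discrete s p N k u0 m U Y" and fd': "fully_discrete s p N k u0 m U' Y'" by auto
  have stages_eq: "Y n j = Y' n j" if "U n = U' n" "n < m" "j \<le> num_stages p" for n j
    using fully_discrete_step(1)[OF fd that(2)] fully_discrete_step(1)[OF fd' that(2)] that
      fully_discrete_l2[OF fd, of n]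
    by (intro stages_unique[OF N k cfl]) auto
  have U_eq: "U n = U' n" if "n \<le> m" for n
    using that
  proof (induction n)
    case (Suc n)
    then show ?case
      using stages_eq[of n "num_stages p"] fully_discrete_step(2)[OF fd, of n] fully_discrete_step(2)[OF fd', of n]
      by simp
  qed (simp add: fully_discrete_0[OF fd] fully_discrete_0[OF fd'])
  show "U n = U' n" if "n \<le> m" for n by (rule U_eq[OF that])
  show "Y n j = Y' n j" if "n < m" "j \<le> num_stages p" for n j
    using that by (intro stages_eq U_eq) auto
qed

text \<open>Each step propagates the old error by the stability estimate and adds one local error.
  \<open>boot\<close> isolates the circular part: the error bound at \<open>n\<close> yields the
  \<open>l1\<close> bound at \<open>n\<close>, which stability needs to reach \<open>Suc n\<close>.
  \<open>L\<close> makes \<open>k * L\<close> the exponent of one step, with 6 = 4 * 3 / 2.\<close>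

lemma fully_discrete_error:
  fixes R k T X :: real and p N M :: nat and U :: "nat \<Rightarrow> real \<Rightarrow> complex"
  defines "L \<equiv> 6 * max_coeff p * (2 * 5 ^ num_stages p * R)\<^sup>2 * real (num_stages p)"
    and "e \<equiv> \<lambda>n v. l2 N (\<lambda>l. fourier_coeff (U n) l - fourier_coeff (v (real n * k)) l)"
  assumes N: "1 \<le> N" and k: "0 < k" and T: "T = real M * k" and p: "1 \<le> p"
    and cfl: "18 * (k * max_coeff p * real N) * (l2 N (fourier_coeff u0))\<^sup>2 \<le> 1"
    and small: "k * max_coeff p * (3 * (2 * 5 ^ num_stages p * R)\<^sup>2) \<le> 1"
    and v: "semidiscrete_solution s N T u0 v"
    and fd: "fully_discrete s p N k u0 M U Y"
    and Z: "\<And>n. n < M \<Longrightarrow> is_stages s p N k (v (real n * k)) (Z n)"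
    and loc: "\<And>n. n < M \<Longrightarrow>
      l2 N (\<lambda>l. fourier_coeff (v (real (Suc n) * k)) l - fourier_coeff (Z n (num_stages p)) l) \<le> X"
    and R: "\<And>n. n \<le> M \<Longrightarrow> l1 N (fourier_coeff (v (real n * k))) \<le> R"
    and boot: "\<And>n. n \<le> M \<Longrightarrow> e n v \<le> exp (T * L) * real M * X \<Longrightarrow> l1 N (fourier_coeff (U n)) \<le> R"
    and n: "n \<le> M"
  shows "e n v \<le> exp (T * L) * real M * X"
\<comment> \<open>\<open>0 \<le> X\<close> is read off from a local error, so there must be at least
  one step.\<close>
proof (cases "M = 0")
  case True
  then show ?thesis
    using n v by (simp add: e_def l2_zero fully_discrete_0[OF fd] semidiscrete_solution_def)
next
  case False
  have X: "0 \<le> X" using False by (intro order_trans[OF l2_nonneg loc[of 0]]) simp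
  have L: "0 \<le> L" unfolding L_def using max_coeff_pos[OF p] by (intro mult_nonneg_nonneg) auto
  \<comment> \<open>The inductive bound grows with \<open>n\<close>; this puts it into the uniform
    form that \<open>boot\<close> accepts.\<close>
  have le: "exp (real n * k * L) * real n * X \<le> exp (T * L) * real M * X" if "n \<le> M" for n
    using that k L X unfolding T by (intro mult_mono mult_right_mono) (auto intro!: mult_right_mono)
  have "e n v \<le> exp (real n * k * L) * real n * X"
    using n
  proof (induction n)
    case 0
    show ?case
      using v by (simp add: e_def l2_zero fully_discrete_0[OF fd] semidiscrete_solution_def)
  next
    case (Suc n)
    let ?q = "num_stages p"
    have tn: "real n * k \<in> {0..T}" using Suc.prems k by (auto simp: T)
    have IH: "e n v \<le> exp (real n * k * L) * real n * X" using Suc by simp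
    have "l2 N (\<lambda>l. fourier_coeff (Y n ?q) l - fourier_coeff (Z n ?q) l)
       \<le> exp (4 * (k * max_coeff p * (3 * (2 * 5 ^ ?q * R)\<^sup>2) / 2) * real ?q) * e n v"
      unfolding e_def
    proof (rule stages_stability[OF N k cfl])
      show "is_stages s p N k (U n) (Y n)" "is_stages s p N k (v (real n * k)) (Z n)"
        using Suc.prems fully_discrete_step(1)[OF fd] Z by auto
      show "l2 N (fourier_coeff (U n)) \<le> l2 N (fourier_coeff u0)"
        using fully_discrete_l2[OF fd, of n] Suc.prems by simp
      show "l2 N (fourier_coeff (v (real n * k))) \<le> l2 N (fourier_coeff u0)"
        by (rule semidiscrete_l2_le[OF v tn])
      show "l1 N (fourier_coeff (U n)) \<le> R"
        using Suc.prems by (intro boot order_trans[OF IH le]) auto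
    qed (use R Suc.prems small in auto)
    also have "4 * (k * max_coeff p * (3 * (2 * 5 ^ ?q * R)\<^sup>2) / 2) * real ?q = k * L"
      by (simp add: L_def)
    finally have st: "l2 N (\<lambda>l. fourier_coeff (Y n ?q) l - fourier_coeff (Z n ?q) l) \<le> exp (k * L) * e n v" .
    have "e (Suc n) v = l2 N (\<lambda>l. (fourier_coeff (Y n ?q) l - fourier_coeff (Z n ?q) l)
         + (fourier_coeff (Z n ?q) l - fourier_coeff (v (real (Suc n) * k)) l))"
      using fully_discrete_step(2)[OF fd, of n] Suc.prems by (simp add: e_def)
    also have "\<dots> \<le> exp (k * L) * e n v + X"
      using loc[of n] Suc.prems st
        l2_minus_commute[of N "fourier_coeff (Z n ?q)" "fourier_coeff (v (real (Suc n) * k))"]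
      by (intro order_trans[OF l2_triangle] add_mono) auto
    also have "\<dots> \<le> exp (k * L) * (exp (real n * k * L) * real n * X) + exp (real (Suc n) * k * L) * X"
    proof (intro add_mono mult_left_mono IH)
      have "1 * X \<le> exp (real (Suc n) * k * L) * X"
        using X L k by (intro mult_right_mono) auto
      then show "X \<le> exp (real (Suc n) * k * L) * X" by simp
    qed simp
    also have "\<dots> = exp (real (Suc n) * k * L) * real (Suc n) * X"
      by (simp add: exp_add algebra_simps)
    finally show ?case .
  qed
  with le[OF n] show ?thesis by linarith
qed


section \<open>Total error and choice of constants\<close>

lemma mean_square_minus_commute: "mean_square (\<lambda>x. f x - g x) = mean_square (\<lambda>x. g x - f x)"
  using mean_square_mult[of "-1" "\<lambda>x. g x - f x"] by simp

text \<open>The error splits orthogonally into the tail of \<open>u\<close> and low modes; the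
  latter are compared through the semidiscrete solution.\<close>

lemma (in bounded_nls) total_error:
  assumes v: "semidiscrete_solution s N T u0 v" and N: "1 \<le> N"
    and R: "3 * B \<le> R" and vR: "\<And>r. r \<in> {0..T} \<Longrightarrow> l1 N (fourier_coeff (v r)) \<le> R"
    and t: "t \<in> {0..T}" and W: "W \<in> trig_polys N"
    and E: "l2 N (\<lambda>l. fourier_coeff W l - fourier_coeff (v t) l) \<le> E"
  shows "L2norm (\<lambda>x. W x - u t x) \<le>
    sqrt (2 * pi) * (E + B * (1 + exp (3 * R\<^sup>2 * T)) * real N powr - \<mu>)"
proof -
  define b where "b = B * real N powr - \<mu>"
  define x where "x = exp (3 * R\<^sup>2 * T)"
  define a where "a = l2 N (\<lambda>l. fourier_coeff (u t) l - fourier_coeff W l)"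
  have b: "0 \<le> b" using B_nonneg by (simp add: b_def)
  have "a = l2 N (\<lambda>l. (fourier_coeff (u t) l - fourier_coeff (v t) l) + (fourier_coeff (v t) l - fourier_coeff W l))"
    by (simp add: a_def)
  also have "\<dots> \<le> b * x + E"
    using semidiscrete_error(2)[OF v N R t vR] E t l2_minus_commute[of N "fourier_coeff W" "fourier_coeff (v t)"]
    by (intro order_trans[OF l2_triangle] add_mono) (auto simp: b_def x_def)
  finally have a: "a \<le> b * x + E" .
  have W': "W = tp N (fourier_coeff W)" using W by (rule trig_polys_iff[THEN iffD1])
  have "mean_square (\<lambda>x. u t x - W x) = mean_square (u t) - (l2 N (fourier_coeff (u t)))\<^sup>2 + a\<^sup>2"
    by (subst W') (simp add: mean_square_minus_tp[OF cont[OF t]] a_def)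
  also have "\<dots> \<le> b\<^sup>2 + a\<^sup>2"
    using sobolev_remainder[OF H[OF t] B[OF t] cont[OF t] _ N] \<mu> by (simp add: b_def)
  also have "\<dots> \<le> (b + a)\<^sup>2"
    using b by (simp add: power2_sum a_def)
  finally have "sqrt (mean_square (\<lambda>x. W x - u t x)) \<le> b + a"
    using b by (simp add: mean_square_minus_commute[of W] real_le_lsqrt a_def)
  then have "sqrt (2 * pi) * sqrt (mean_square (\<lambda>x. W x - u t x)) \<le> sqrt (2 * pi) * (E + b * (1 + x))"
    using a by (intro mult_left_mono) (auto simp: algebra_simps)
  then show ?thesis
    by (simp add: L2norm_eq real_sqrt_mult b_def x_def mult_ac)
qed

text \<open>Unless \<open>u0\<close> has no Fourier modes at all, the norm of \<open>P\<^sub>N u0\<close> is bounded below for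
  large \<open>N\<close>, so that the step-size condition bounds \<open>k N\<close>.\<close>

lemma cfl_alternative:
  assumes p: "1 \<le> p"
  shows "\<exists>C0\<ge>0. \<exists>B0. \<forall>N\<ge>1. \<forall>k>0.
      18 * (k * max_coeff p * real N) * (l2 N (fourier_coeff u0))\<^sup>2 \<le> 1 \<longrightarrow>
      sqrt (3 * real N) * l2 N (fourier_coeff u0) \<le> B0 \<or> k * real N \<le> C0"
proof (cases "\<forall>N. l2 N (fourier_coeff u0) = 0")
  case True
  then show ?thesis by (intro exI[of _ "0 :: real"] conjI) auto
next
  case False
  then obtain N1 where N1: "l2 N1 (fourier_coeff u0) \<noteq> 0" by blast
  define \<delta> where "\<delta> = 18 * max_coeff p * (l2 N1 (fourier_coeff u0))\<^sup>2"
  have \<delta>: "0 < \<delta>" using N1 max_coeff_pos[OF p] by (simp add: \<delta>_def)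
  show ?thesis
  proof (rule exI[of _ "1 / \<delta>"], intro exI[of _ "sqrt (3 * real N1) * l2 N1 (fourier_coeff u0)"] conjI allI impI)
    fix N and k :: real
    assume N: "1 \<le> N" and k: "0 < k"
      and cfl: "18 * (k * max_coeff p * real N) * (l2 N (fourier_coeff u0))\<^sup>2 \<le> 1"
    show "sqrt (3 * real N) * l2 N (fourier_coeff u0) \<le> sqrt (3 * real N1) * l2 N1 (fourier_coeff u0)
        \<or> k * real N \<le> 1 / \<delta>"
    proof (cases "N \<le> N1")
      case True
      then have "l2 N (fourier_coeff u0) \<le> l2 N1 (fourier_coeff u0)"
        using l2_mono_freqs[OF True] power2_le_imp_le l2_nonneg by blast
      then show ?thesis using True by (intro disjI1 mult_mono) auto
    next
      case False
      have "k * real N * \<delta> = 18 * (k * max_coeff p * real N) * (l2 N1 (fourier_coeff u0))\<^sup>2"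
        by (simp add: \<delta>_def)
      also have "\<dots> \<le> 18 * (k * max_coeff p * real N) * (l2 N (fourier_coeff u0))\<^sup>2"
        using False k max_coeff_pos[OF p] by (intro mult_left_mono l2_mono_freqs) auto
      also have "\<dots> \<le> 1" by (rule cfl)
      finally show ?thesis using \<delta> by (simp add: pos_le_divide_eq)
    qed
  qed (use \<delta> in simp)
qed

theorem theorem3p1:
  fixes s :: real and p \<alpha> :: nat
  assumes "0 < s" and "s \<le> 1" and "1 \<le> p" and "0 < \<alpha>"
  shows "\<exists>\<mu>0. \<forall>\<mu>\<ge>\<mu>0.
    \<forall>(T :: real) (u0 :: real \<Rightarrow> complex) (u :: real \<Rightarrow> real \<Rightarrow> complex)
     (uN :: nat \<Rightarrow> real \<Rightarrow> real \<Rightarrow> complex) (C1 :: real).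
      0 < T \<and> smooth_fun u0 \<and> periodic_2pi u0 \<and>
      nls_solution s T u0 u \<and> belongs_to_sobolev \<mu> T u \<and>
      (\<forall>N\<ge>1. semidiscrete_solution s N T u0 (uN N)) \<longrightarrow>
      (\<exists>k0>0. \<exists>C. \<forall>(N :: nat) (M :: nat) (k :: real)
          (Z :: nat \<Rightarrow> nat \<Rightarrow> real \<Rightarrow> complex).
        1 \<le> N \<and> 0 < k \<and> k \<le> k0 \<and> T = real M * k \<and>
        3 * (L2norm (fourier_proj N u0))\<^sup>2 * (k * real N) *
          (MAX j\<in>{1..num_stages p}. \<bar>coeff_b p j\<bar>) < 1 \<and>
        (\<forall>n<M. is_stages s p N k (uN N (real n * k)) (Z n)) \<and>
        (MAX n\<in>{0..M - 1}.
            L2norm (\<lambda>x. uN N (real (Suc n) * k) x - Z n (num_stages p) x))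
          \<le> C1 * k ^ (\<alpha> + 1) \<longrightarrow>
        (\<forall>m. uniquely_solvable s p N k u0 m) \<and>
        (\<forall>U Y. fully_discrete s p N k u0 M U Y \<longrightarrow>
           (MAX n\<in>{0..M}. L2norm (\<lambda>x. U n x - u (real n * k) x))
             \<le> C * (k ^ \<alpha> + real N powr (- \<mu>))))"
proof (rule exI[of _ 3], intro allI impI, elim conjE)
  fix \<mu> T C1 :: real and u0 u uN
  assume \<mu>: "3 \<le> \<mu>" and T: "0 < T" and u: "nls_solution s T u0 u"
    and bel: "belongs_to_sobolev \<mu> T u" and uN: "\<forall>N\<ge>1. semidiscrete_solution s N T u0 (uN N)"
  obtain B where "\<forall>t\<in>{0..T}. sobolev_norm \<mu> (u t) \<le> B"
    using bel by (auto simp: belongs_to_sobolev_def)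
  then interpret bounded_nls s \<mu> T B u0 u
    using assms \<mu> T u bel by unfold_locales (auto simp: belongs_to_sobolev_def)
  obtain A where A: "3 * B \<le> A" "\<And>N v t. 1 \<le> N \<Longrightarrow> semidiscrete_solution s N T u0 v \<Longrightarrow> t \<in> {0..T}
    \<Longrightarrow> l1 N (fourier_coeff (v t)) \<le> A"
    using semidiscrete_l1_bound by blast
  obtain C0 B0 where C0: "0 \<le> C0" and alt: "\<And>N k. 1 \<le> N \<Longrightarrow> 0 < k \<Longrightarrow>
      18 * (k * max_coeff p * real N) * (l2 N (fourier_coeff u0))\<^sup>2 \<le> 1 \<Longrightarrow>
      sqrt (3 * real N) * l2 N (fourier_coeff u0) \<le> B0 \<or> k * real N \<le> C0"
    using cfl_alternative[OF assms(3), of u0] by blast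
  define R where "R = max (A + 1) B0"
  define G where "G = max_coeff p * (3 * (2 * 5 ^ num_stages p * R)\<^sup>2)"
  define L where "L = 6 * max_coeff p * (2 * 5 ^ num_stages p * R)\<^sup>2 * real (num_stages p)"
  \<comment> \<open>Summing \<open>M\<close> local errors costs one power of \<open>k\<close>, since
    \<open>T = real M * k\<close>. The absolute value allows for a \<open>C1\<close> of any
    sign.\<close>
  define D where "D = exp (T * L) * T * \<bar>C1\<bar>"
  define E where "E = B * (1 + exp (3 * A\<^sup>2 * T))"
  \<comment> \<open>Three demands: \<open>k \<le> 1\<close> gives
    \<open>k ^ \<alpha> \<le> k\<close>; \<open>k * G \<le> 1\<close> is the smallness for
    \<open>fully_discrete_error\<close>; the last gives
    \<open>sqrt (3 * real N) * (D * k) \<le> 1\<close> when \<open>k * real N \<le> C0\<close>.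
    Adding 1 keeps the denominators positive.\<close>
  define k0 where "k0 = min 1 (min (1 / (G + 1)) (1 / (3 * C0 * D\<^sup>2 + 1)))"
  define C where "C = sqrt (2 * pi) * max D E"
  have G: "0 \<le> G" using max_coeff_pos[OF assms(3)] by (simp add: G_def)
  have D: "0 \<le> D" using T by (simp add: D_def)
  have E: "0 \<le> E" using B_nonneg by (simp add: E_def)
  have CD: "0 \<le> 3 * C0 * D\<^sup>2" using C0 by simp
  have k0: "0 < k0" using G CD by (simp add: k0_def add_nonneg_pos)
  have main: "(\<forall>m. uniquely_solvable s p N k u0 m) \<and>
        (\<forall>U Y. fully_discrete s p N k u0 M U Y \<longrightarrow>
           (MAX n\<in>{0..M}. L2norm (\<lambda>x. U n x - u (real n * k) x))
             \<le> C * (k ^ \<alpha> + real N powr (- \<mu>)))"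
    if N: "1 \<le> N" and k: "0 < k" "k \<le> k0" and Mk: "T = real M * k"
      and cfl0: "3 * (L2norm (fourier_proj N u0))\<^sup>2 * (k * real N) *
          (MAX j\<in>{1..num_stages p}. \<bar>coeff_b p j\<bar>) < 1"
      and Z: "\<forall>n<M. is_stages s p N k (uN N (real n * k)) (Z n)"
      and loc0: "(MAX n\<in>{0..M - 1}.
            L2norm (\<lambda>x. uN N (real (Suc n) * k) x - Z n (num_stages p) x))
          \<le> C1 * k ^ (\<alpha> + 1)"
    for N M :: nat and k :: real and Z :: "nat \<Rightarrow> nat \<Rightarrow> real \<Rightarrow> complex"
  proof -
    define v where "v = uN N"
    define \<omega> where "\<omega> = l2 N (fourier_coeff u0)"
    have v: "semidiscrete_solution s N T u0 v" using uN N by (simp add: v_def)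
    have tn: "real n * k \<in> {0..T}" if "n \<le> M" for n
      using that k by (simp add: Mk)
    have vt: "v t \<in> trig_polys N" if "t \<in> {0..T}" for t
      using v that by (simp add: semidiscrete_solution_def)
    have cfl: "18 * (k * max_coeff p * real N) * \<omega>\<^sup>2 \<le> 1"
    proof -
      have "(L2norm (fourier_proj N u0))\<^sup>2 = 2 * pi * \<omega>\<^sup>2"
        by (simp add: fourier_proj_eq L2norm_tp power_mult_distrib \<omega>_def)
      then have "(2 * pi) * (3 * (k * max_coeff p * real N) * \<omega>\<^sup>2) < 1"
        using cfl0 by (simp add: max_coeff_def mult_ac)
      moreover have "6 * (3 * (k * max_coeff p * real N) * \<omega>\<^sup>2) \<le> (2 * pi) * (3 * (k * max_coeff p * real N) * \<omega>\<^sup>2)"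
        using pi_gt3 k max_coeff_pos[OF assms(3)] by (intro mult_right_mono) auto
      ultimately have "6 * (3 * (k * max_coeff p * real N) * \<omega>\<^sup>2) \<le> 1" by linarith
      then show ?thesis by simp
    qed
    have kG: "k * G \<le> 1"
    proof -
      have "k * G \<le> 1 / (G + 1) * G" using k G by (intro mult_right_mono) (auto simp: k0_def)
      also have "\<dots> \<le> 1" using G by (simp add: divide_simps)
      finally show ?thesis .
    qed
    have k\<alpha>: "k ^ \<alpha> \<le> k"
      using power_decreasing[of 1 \<alpha> k] k assms(4) by (simp add: k0_def)
    define X where "X = \<bar>C1\<bar> * k ^ (\<alpha> + 1)"
    have MX: "exp (T * L) * real M * X = D * k ^ \<alpha>"
      by (simp add: X_def D_def Mk)
    have loc: "l2 N (\<lambda>l. fourier_coeff (v (real (Suc n) * k)) l - fourier_coeff (Z n (num_stages p)) l) \<le> X"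
      if n: "n < M" for n
    proof -
      let ?d = "\<lambda>l. fourier_coeff (v (real (Suc n) * k)) l - fourier_coeff (Z n (num_stages p)) l"
      have v_eq: "v (real (Suc n) * k) = tp N (fourier_coeff (v (real (Suc n) * k)))"
        using n by (intro trig_polys_iff[THEN iffD1] vt tn) simp
      have Z_eq: "Z n (num_stages p) = tp N (fourier_coeff (Z n (num_stages p)))"
        using n Z by (intro trig_polys_iff[THEN iffD1] is_stages_trig_poly) auto
      have d: "(\<lambda>x. v (real (Suc n) * k) x - Z n (num_stages p) x) = tp N ?d"
        by (rule ext, rule trans[OF arg_cong2[where f = "(-)", OF fun_cong[OF v_eq] fun_cong[OF Z_eq]] tp_diff])
      have "1 * l2 N ?d \<le> sqrt (2 * pi) * l2 N ?d"
        using pi_gt3 by (intro mult_right_mono) auto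
      also have "\<dots> = L2norm (\<lambda>x. v (real (Suc n) * k) x - Z n (num_stages p) x)"
        unfolding d L2norm_tp ..
      also have "\<dots> \<le> (MAX n\<in>{0..M - 1}. L2norm (\<lambda>x. uN N (real (Suc n) * k) x - Z n (num_stages p) x))"
        unfolding v_def using n by (intro Max_ge) auto
      also have "\<dots> \<le> C1 * k ^ (\<alpha> + 1)" by (rule loc0)
      also have "\<dots> \<le> X" unfolding X_def using k by (intro mult_right_mono) auto
      finally show ?thesis by simp
    qed
    show ?thesis
    proof (intro conjI allI impI)
      show "uniquely_solvable s p N k u0 m" for m
        using cfl by (intro cfl_uniquely_solvable N k) (simp add: \<omega>_def)
      fix U Y assume fd: "fully_discrete s p N k u0 M U Y"
      define e where "e n = l2 N (\<lambda>l. fourier_coeff (U n) l - fourier_coeff (v (real n * k)) l)" for n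
      have boot: "l1 N (fourier_coeff (U n)) \<le> R" if n: "n \<le> M" and en: "e n \<le> exp (T * L) * real M * X" for n
        using alt[OF N k(1) cfl[unfolded \<omega>_def]]
      proof
        assume "sqrt (3 * real N) * l2 N (fourier_coeff u0) \<le> B0"
        then show ?thesis
          using l1_le_l2'[OF N, of "fourier_coeff (U n)"] fully_discrete_l2[OF fd n] by (simp add: R_def)
      next
        assume kN: "k * real N \<le> C0"
        let ?d = "\<lambda>l. fourier_coeff (U n) l - fourier_coeff (v (real n * k)) l"
        have "e n \<le> D * k" using en mult_left_mono[OF k\<alpha> D] by (simp add: MX)
        \<comment> \<open>Squaring exposes the bounded product \<open>k * real N\<close> and leaves
          a spare factor \<open>k\<close>, which provides the smallness.\<close>
        have "(sqrt (3 * real N) * (D * k))\<^sup>2 = (3 * (k * real N) * D\<^sup>2) * k"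
          by (simp add: power_mult_distrib power2_eq_square)
        also have "\<dots> \<le> (3 * C0 * D\<^sup>2) * k"
          using kN k by (intro mult_right_mono mult_left_mono) auto
        also have "\<dots> \<le> (3 * C0 * D\<^sup>2) * (1 / (3 * C0 * D\<^sup>2 + 1))"
          using CD k by (intro mult_left_mono) (auto simp: k0_def)
        also have "\<dots> \<le> 1\<^sup>2" using CD by (simp add: divide_simps)
        finally have small: "sqrt (3 * real N) * (D * k) \<le> 1" by (rule power2_le_imp_le) simp
        have "l1 N (fourier_coeff (U n)) \<le> l1 N (fourier_coeff (v (real n * k))) + l1 N ?d"
          using l1_triangle[of N "fourier_coeff (v (real n * k))" ?d] by simp
        also have "\<dots> \<le> A + sqrt (3 * real N) * e n"
          unfolding e_def by (intro add_mono A(2)[OF N v tn[OF n]] l1_le_l2' N)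
        also have "\<dots> \<le> A + sqrt (3 * real N) * (D * k)"
          using \<open>e n \<le> D * k\<close> by (intro add_left_mono mult_left_mono) auto
        also have "\<dots> \<le> R" using small by (simp add: R_def)
        finally show ?thesis .
      qed
      have en: "e n \<le> D * k ^ \<alpha>" if n: "n \<le> M" for n
        unfolding MX[symmetric] e_def L_def
      proof (rule fully_discrete_error[where Z = Z, OF N k(1) Mk assms(3) _ _ v fd _ _ _ _ n])
        show "18 * (k * max_coeff p * real N) * (l2 N (fourier_coeff u0))\<^sup>2 \<le> 1"
          using cfl by (simp add: \<omega>_def)
        show "k * max_coeff p * (3 * (2 * 5 ^ num_stages p * R)\<^sup>2) \<le> 1"
          using kG by (simp add: G_def mult.assoc)
        show "is_stages s p N k (v (real n * k)) (Z n)" if "n < M" for n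
          using Z that by (simp add: v_def)
        show "l2 N (\<lambda>l. fourier_coeff (v (real (Suc n) * k)) l - fourier_coeff (Z n (num_stages p)) l) \<le> X"
          if "n < M" for n
          by (rule loc[OF that])
        show "l1 N (fourier_coeff (v (real n * k))) \<le> R" if "n \<le> M" for n
          using A(2)[OF N v tn[OF that]] by (simp add: R_def)
        show "l1 N (fourier_coeff (U n)) \<le> R"
          if "n \<le> M" "l2 N (\<lambda>l. fourier_coeff (U n) l - fourier_coeff (v (real n * k)) l) \<le>
            exp (T * (6 * max_coeff p * (2 * 5 ^ num_stages p * R)\<^sup>2 * real (num_stages p))) * real M * X" for n
          using that by (intro boot) (simp_all add: e_def L_def)
      qed
      have "L2norm (\<lambda>x. U n x - u (real n * k) x) \<le> C * (k ^ \<alpha> + real N powr - \<mu>)" if n: "n \<le> M" for n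
      proof -
        have "L2norm (\<lambda>x. U n x - u (real n * k) x) \<le>
            sqrt (2 * pi) * (D * k ^ \<alpha> + B * (1 + exp (3 * A\<^sup>2 * T)) * real N powr - \<mu>)"
          using en[OF n] by (intro total_error[OF v N A(1) A(2)[OF N v] tn[OF n] fully_discrete_trig_poly[OF fd n]])
            (auto simp: e_def)
        also have "\<dots> \<le> sqrt (2 * pi) * (max D E * k ^ \<alpha> + max D E * real N powr - \<mu>)"
          using k by (intro mult_left_mono add_mono mult_right_mono) (auto simp: E_def)
        also have "\<dots> = C * (k ^ \<alpha> + real N powr - \<mu>)" by (simp add: C_def algebra_simps)
        finally show ?thesis .
      qed
      then show "(MAX n\<in>{0..M}. L2norm (\<lambda>x. U n x - u (real n * k) x)) \<le> C * (k ^ \<alpha> + real N powr (- \<mu>))"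
        by (intro Max.boundedI) auto
    qed
  qed
  show "\<exists>k0>0. \<exists>C. \<forall>(N :: nat) (M :: nat) (k :: real)
          (Z :: nat \<Rightarrow> nat \<Rightarrow> real \<Rightarrow> complex).
        1 \<le> N \<and> 0 < k \<and> k \<le> k0 \<and> T = real M * k \<and>
        3 * (L2norm (fourier_proj N u0))\<^sup>2 * (k * real N) *
          (MAX j\<in>{1..num_stages p}. \<bar>coeff_b p j\<bar>) < 1 \<and>
        (\<forall>n<M. is_stages s p N k (uN N (real n * k)) (Z n)) \<and>
        (MAX n\<in>{0..M - 1}.
            L2norm (\<lambda>x. uN N (real (Suc n) * k) x - Z n (num_stages p) x))
          \<le> C1 * k ^ (\<alpha> + 1) \<longrightarrow>
        (\<forall>m. uniquely_solvable s p N k u0 m) \<and>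
        (\<forall>U Y. fully_discrete s p N k u0 M U Y \<longrightarrow>
           (MAX n\<in>{0..M}. L2norm (\<lambda>x. U n x - u (real n * k) x))
             \<le> C * (k ^ \<alpha> + real N powr (- \<mu>)))"
    by (rule exI[of _ k0], rule conjI[OF k0], rule exI[of _ C], intro allI, rule impI, elim conjE,
        rule main) assumption+
qed

end
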